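(* Let $\dot A$ be a non-negative symmetric Schrödinger operator $\dot A y=-y''+q(x)y$, $y(\ell)=y'(\ell)=0$, in $\mathcal H=L_2[\ell,+\infty)$, with real locally summable potential $q$ and deficiency indices $(1,1)$, and let $m_\infty(z)$ be its Weyl-Titchmarsh function. Assume that $m_\infty(-0)$ is finite and $m_\infty(-0)\ge 0$. Then the Schrödinger L-system $\Theta_{0,i}$, which realizes the function $-m_\infty(z)$ (i.e. $V_{\Theta_{0,i}}(z)=-m_\infty(z)$), is accumulative, and the Schrödinger L-system $\Theta_{\infty,i}$, which realizes the function $1/m_\infty(z)$ (i.e. $V_{\Theta_{\infty,i}}(z)=1/m_\infty(z)$), is accretive.
   Context: Setting. Let $\ell\ge 0$, $l(y)=-y''+q(x)y$ with $q$ real and locally summable on $[\ell,+\infty)$. $\dot A$ is the minimal symmetric operator $\dot A y=l(y)$ with $y(\ell)=y'(\ell)=0$ in $\mathcal H=L_2[\ell,+\infty)$, assumed to have deficiency indices $(1,1)$. $\mathcal H_+=\mathrm{Dom}(\dot A^* )$ is the set of $y\in L_2[\ell,+\infty)$ that are locally absolutely continuous together with $y'$ and satisfy $l(y)\in L_2[\ell,+\infty)$; it carries the inner product $(y,w)_+=(y,w)+(l(y),l(w))$. $\mathcal H_+\subset\mathcal H\subset\mathcal H_-$ is the corresponding rigged Hilbert space, where $\mathcal H_-$ is the space of antilinear functionals on $\mathcal H_+$ and the pairing $(\cdot,\cdot)$ extends that of $\mathcal H$. $[\mathcal X,\mathcal Y]$ denotes the bounded linear operators from $\mathcal X$ to $\mathcal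 Y$. For $\mathbb A\in[\mathcal H_+,\mathcal H_-]$ the adjoint $\mathbb A^*$ is again in $[\mathcal H_+,\mathcal H_-]$, and $\mathrm{Re}\,\mathbb A=(\mathbb A+\mathbb A^* )/2$, $\mathrm{Im}\,\mathbb A=(\mathbb A-\mathbb A^* )/(2i)$. The elements $\delta(x-\ell),\delta'(x-\ell)\in\mathcal H_-$ act by $(y,\delta(x-\ell))=y(\ell)$, $(y,\delta'(x-\ell))=-y'(\ell)$ for $y\in\mathcal H_+$. Non-negativity of $\dot A$ means $(\dot A f,f)\ge0$ for all $f\in\mathrm{Dom}(\dot A)$. Weyl-Titchmarsh function. Let $\varphi_1,\varphi_2$ solve $l(\varphi_k)=z\varphi_k$ with $\varphi_1(\ell,z)=0,\ \varphi_1'(\ell,z)=1$ and $\varphi_2(\ell,z)=-1,\ \varphi_2'(\ell,z)=0$. Then $m_\infty(z)$ is the function for which $\varphi_2(x,z)+m_\infty(z)\varphi_1(x,z)\in L_2[\ell,+\infty)$. When $\dot A$ is non-negative, $m_\infty$ is holomorphic off $[0,+\infty)$, and $m_\infty(-0)=\lim_{x\to-0}m_\infty(x)$. Schrödinger L-systems. For $\mathrm{Im}\,h>0$ let $T_h y=l(y)$ on $\{y\in\mathcal H_+: y'(\ell)=hy(\ell)\}$. For $\mu\in\mathbb R\cup\{\infty\}$ define $\mathbb A_{\mu,h}\in[\mathcal H_+,\mathcal H_-]$ by $$\mathbb A_{\mu,h}y=l(y)-\frac1{\mu-h}\,[y'(\ell)-hy(\ell)]\,[\mu\,\delta(x-\ell)+\delta'(x-\ell)],$$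 where for $\mu=\infty$ this means the limit $\mathbb A_{\infty,h}y=l(y)-[y'(\ell)-hy(\ell)]\,\delta(x-\ell)$. Let $g_{\mu,h}=\frac{(\mathrm{Im}\,h)^{1/2}}{|\mu-h|}[\mu\,\delta(x-\ell)+\delta'(x-\ell)]$ (for $\mu=\infty$: $g_{\infty,h}=(\mathrm{Im}\,h)^{1/2}\delta(x-\ell)$) and $K_{\mu,h}c=c\,g_{\mu,h}$, $c\in\mathbb C$, so that $\mathrm{Im}\,\mathbb A_{\mu,h}=K_{\mu,h}K_{\mu,h}^*$. The Schrödinger L-system $\Theta_{\mu,h}$ is the collection consisting of the state-space operator $\mathbb A_{\mu,h}$, the channel operator $K_{\mu,h}$, the main operator $T_h$ and the triplet $\mathcal H_+\subset\mathcal H\subset\mathcal H_-$. Its impedance function is $V_{\Theta_{\mu,h}}(z)=K_{\mu,h}^*(\mathrm{Re}\,\mathbb A_{\mu,h}-zI)^{-1}K_{\mu,h}$. An L-system realizes a function $V$ if its impedance function is $V$. An L-system with state-space operator $\mathbb A$ is accretive if $\mathrm{Re}(\mathbb A f,f)\ge0$ for all $f\in\mathcal H_+$. It is accumulative if $(\mathrm{Re}\,\mathbb A f,f)\le(\dot A^*f,f)+(f,\dot A^*f)$ for all $f\in\mathcal H_+$. *)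

theory Defs
  imports "HOL-Analysis.Analysis" "HOL-Library.Function_Algebras"
begin

section \<open>Function spaces on the half-line\<close>

text \<open>Functions on \<open>[ell, \<infinity>)\<close> are represented by functions on all of \<open>\<real>\<close>; only their values on
  \<open>{ell..}\<close> matter.  Sums of functions are the pointwise ones of \<open>Function_Algebras\<close>.\<close>

definition cscale :: "complex \<Rightarrow> ('a \<Rightarrow> complex) \<Rightarrow> 'a \<Rightarrow> complex" where
  "cscale c f = (\<lambda>x. c * f x)"

definition L2 :: "real \<Rightarrow> (real \<Rightarrow> complex) set" where
  "L2 ell = {f. f \<in> borel_measurable (lebesgue_on {ell..})
               \<and> integrable (lebesgue_on {ell..}) (\<lambda>x. (cmod (f x))\<^sup>2)}"

definition l2_inner :: "real \<Rightarrow> (real \<Rightarrow> complex) \<Rightarrow> (real \<Rightarrow> complex) \<Rightarrow> complex" where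
  "l2_inner ell f g = (LINT x|lebesgue_on {ell..}. f x * cnj (g x))"

definition locally_summable :: "real \<Rightarrow> (real \<Rightarrow> real) \<Rightarrow> bool" where
  "locally_summable ell q \<longleftrightarrow> (\<forall>b\<ge>ell. q absolutely_integrable_on {ell..b})"

definition absolutely_continuous_on :: "real set \<Rightarrow> (real \<Rightarrow> complex) \<Rightarrow> bool" where
  "absolutely_continuous_on S f \<longleftrightarrow>
     (\<forall>\<epsilon>>0. \<exists>\<delta>>0. \<forall>I. finite I \<and> (\<forall>(s, t)\<in>I. s < t \<and> {s..t} \<subseteq> S)
         \<and> disjoint_family_on (\<lambda>(s, t). {s<..<t}) I \<and> (\<Sum>(s, t)\<in>I. t - s) < \<delta>
         \<longrightarrow> (\<Sum>(s, t)\<in>I. cmod (f t - f s)) < \<epsilon>)"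

definition locally_AC :: "real \<Rightarrow> (real \<Rightarrow> complex) \<Rightarrow> bool" where
  "locally_AC ell f \<longleftrightarrow> (\<forall>b\<ge>ell. absolutely_continuous_on {ell..b} f)"

text \<open>The derivative on the half-line, one-sided at the end point \<open>ell\<close>.\<close>

definition hderiv :: "real \<Rightarrow> (real \<Rightarrow> complex) \<Rightarrow> real \<Rightarrow> complex" where
  "hderiv ell y x = vector_derivative y (at x within {ell..})"

definition AC_with_deriv :: "real \<Rightarrow> (real \<Rightarrow> complex) \<Rightarrow> bool" where
  "AC_with_deriv ell y \<longleftrightarrow>
     locally_AC ell y \<and> (\<forall>x\<ge>ell. y differentiable (at x within {ell..}))
     \<and> locally_AC ell (hderiv ell y)"

section \<open>The differential expression and its operators\<close>

text \<open>If \<open>AC_with_deriv ell y\<close>, the second derivative exists almost everywhere on \<open>[ell, \<infinity>)\<close>;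
  the values of \<open>lexpr ell q y\<close> on the exceptional null set are immaterial.\<close>

definition lexpr :: "real \<Rightarrow> (real \<Rightarrow> real) \<Rightarrow> (real \<Rightarrow> complex) \<Rightarrow> real \<Rightarrow> complex" where
  "lexpr ell q y x = - hderiv ell (hderiv ell y) x + complex_of_real (q x) * y x"

text \<open>\<open>\<H>\<^sub>+\<close>, the domain of the maximal operator \<open>y \<mapsto> lexpr ell q y\<close>.  Its elements are continuous on
  \<open>[ell, \<infinity>)\<close>, so extending them by zero to the left of \<open>ell\<close> gives one representative for each.\<close>

definition Hplus :: "real \<Rightarrow> (real \<Rightarrow> real) \<Rightarrow> (real \<Rightarrow> complex) set" where
  "Hplus ell q = {y. (\<forall>x<ell. y x = 0) \<and> AC_with_deriv ell y \<and> y \<in> L2 ell \<and> lexpr ell q y \<in> L2 ell}"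

definition plus_inner ::
  "real \<Rightarrow> (real \<Rightarrow> real) \<Rightarrow> (real \<Rightarrow> complex) \<Rightarrow> (real \<Rightarrow> complex) \<Rightarrow> complex" where
  "plus_inner ell q y w = l2_inner ell y w + l2_inner ell (lexpr ell q y) (lexpr ell q w)"

text \<open>Domain of the minimal operator.  When the deficiency indices are \<open>(1,1)\<close> there is no boundary
  condition at infinity.\<close>

definition dom_min :: "real \<Rightarrow> (real \<Rightarrow> real) \<Rightarrow> (real \<Rightarrow> complex) set" where
  "dom_min ell q = {y \<in> Hplus ell q. y ell = 0 \<and> hderiv ell y ell = 0}"

definition nonnegative_min :: "real \<Rightarrow> (real \<Rightarrow> real) \<Rightarrow> bool" where
  "nonnegative_min ell q \<longleftrightarrow>
     (\<forall>f \<in> dom_min ell q. l2_inner ell (lexpr ell q f) f \<in> \<real>\<^sub>\<ge>\<^sub>0)"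

text \<open>The kernel of \<open>\<dot>A\<^sup>* - z\<close>, and its complex dimension.\<close>

definition deficiency_space :: "real \<Rightarrow> (real \<Rightarrow> real) \<Rightarrow> complex \<Rightarrow> (real \<Rightarrow> complex) set" where
  "deficiency_space ell q z =
     {y \<in> Hplus ell q. AE x in lebesgue_on {ell..}. lexpr ell q y x = z * y x}"

definition deficiency_indices :: "real \<Rightarrow> (real \<Rightarrow> real) \<Rightarrow> nat \<times> nat" where
  "deficiency_indices ell q =
     (vector_space.dim cscale (deficiency_space ell q \<i>),
      vector_space.dim cscale (deficiency_space ell q (- \<i>)))"

section \<open>The Weyl-Titchmarsh function\<close>

definition solves_ivp ::
  "real \<Rightarrow> (real \<Rightarrow> real) \<Rightarrow> complex \<Rightarrow> complex \<Rightarrow> complex \<Rightarrow> (real \<Rightarrow> complex) \<Rightarrow> bool" where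
  "solves_ivp ell q z y0 y1 y \<longleftrightarrow>
     AC_with_deriv ell y \<and> (AE x in lebesgue_on {ell..}. lexpr ell q y x = z * y x)
     \<and> y ell = y0 \<and> hderiv ell y ell = y1"

text \<open>The function is considered off \<open>[0, \<infinity>)\<close>, where it is holomorphic when the minimal operator is
  non-negative.\<close>

definition weyl_titchmarsh :: "real \<Rightarrow> (real \<Rightarrow> real) \<Rightarrow> (complex \<Rightarrow> complex) \<Rightarrow> bool" where
  "weyl_titchmarsh ell q m \<longleftrightarrow>
     (\<forall>z. z \<notin> \<real>\<^sub>\<ge>\<^sub>0 \<longrightarrow>
        (\<exists>\<phi>1 \<phi>2. solves_ivp ell q z 0 1 \<phi>1 \<and> solves_ivp ell q z (-1) 0 \<phi>2
            \<and> \<phi>2 + cscale (m z) \<phi>1 \<in> L2 ell))"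

section \<open>The rigged Hilbert space\<close>

text \<open>An element of \<open>\<H>\<^sub>-\<close> is the antilinear functional \<open>F\<close> on \<open>\<H>\<^sub>+\<close>, extended by zero off \<open>\<H>\<^sub>+\<close>, with
  \<open>F f = (F, f)\<close>; hence \<open>(f, F) = cnj (F f)\<close>.\<close>

type_synonym functional = "(real \<Rightarrow> complex) \<Rightarrow> complex"

definition Hminus :: "real \<Rightarrow> (real \<Rightarrow> real) \<Rightarrow> functional set" where
  "Hminus ell q = {F. (\<forall>f. f \<notin> Hplus ell q \<longrightarrow> F f = 0)
     \<and> (\<forall>f \<in> Hplus ell q. \<forall>g \<in> Hplus ell q. F (f + g) = F f + F g)
     \<and> (\<forall>c. \<forall>f \<in> Hplus ell q. F (cscale c f) = cnj c * F f)
     \<and> (\<exists>C. \<forall>f \<in> Hplus ell q. cmod (F f) \<le> C * sqrt (Re (plus_inner ell q f f)))}"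

definition embed :: "real \<Rightarrow> (real \<Rightarrow> real) \<Rightarrow> (real \<Rightarrow> complex) \<Rightarrow> functional" where
  "embed ell q u = (\<lambda>f. if f \<in> Hplus ell q then l2_inner ell u f else 0)"

text \<open>\<open>(y, \<delta>) = y(ell)\<close> and \<open>(y, \<delta>') = - y'(ell)\<close>, written for the pairing with \<open>y\<close> on the right.\<close>

definition delta :: "real \<Rightarrow> (real \<Rightarrow> real) \<Rightarrow> functional" where
  "delta ell q = (\<lambda>f. if f \<in> Hplus ell q then cnj (f ell) else 0)"

definition delta' :: "real \<Rightarrow> (real \<Rightarrow> real) \<Rightarrow> functional" where
  "delta' ell q = (\<lambda>f. if f \<in> Hplus ell q then cnj (- hderiv ell f ell) else 0)"

text \<open>The adjoint in \<open>[\<H>\<^sub>+, \<H>\<^sub>-]\<close> is determined by \<open>(A f, g) = (f, A\<^sup>* g)\<close>.\<close>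

definition rigged_adjoint ::
  "real \<Rightarrow> (real \<Rightarrow> real) \<Rightarrow> ((real \<Rightarrow> complex) \<Rightarrow> functional) \<Rightarrow> (real \<Rightarrow> complex) \<Rightarrow> functional" where
  "rigged_adjoint ell q A =
     (\<lambda>g f. if f \<in> Hplus ell q \<and> g \<in> Hplus ell q then cnj (A f g) else 0)"

definition rigged_Re ::
  "real \<Rightarrow> (real \<Rightarrow> real) \<Rightarrow> ((real \<Rightarrow> complex) \<Rightarrow> functional) \<Rightarrow> (real \<Rightarrow> complex) \<Rightarrow> functional" where
  "rigged_Re ell q A = (\<lambda>y. cscale (1 / 2) (A y + rigged_adjoint ell q A y))"

section \<open>L-systems\<close>

text \<open>The main operator is given by its graph, the triplet by its three spaces.\<close>

record lsystem =
  state_op :: "(real \<Rightarrow> complex) \<Rightarrow> functional"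
  channel_op :: "complex \<Rightarrow> functional"
  main_op :: "((real \<Rightarrow> complex) \<times> (real \<Rightarrow> complex)) set"
  triplet :: "(real \<Rightarrow> complex) set \<times> (real \<Rightarrow> complex) set \<times> functional set"

text \<open>\<open>K\<^sup>* : \<H>\<^sub>+ \<rightarrow> \<complex>\<close> is determined by \<open>(K c, y) = c * cnj (K\<^sup>* y)\<close>, so \<open>K\<^sup>* y = (y, K 1)\<close>.\<close>

definition channel_adjoint :: "(complex \<Rightarrow> functional) \<Rightarrow> (real \<Rightarrow> complex) \<Rightarrow> complex" where
  "channel_adjoint K y = cnj (K 1 y)"

definition shifted_Re ::
  "real \<Rightarrow> (real \<Rightarrow> real) \<Rightarrow> lsystem \<Rightarrow> complex \<Rightarrow> (real \<Rightarrow> complex) \<Rightarrow> functional" where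
  "shifted_Re ell q \<Theta> z = (\<lambda>y. rigged_Re ell q (state_op \<Theta>) y - cscale z (embed ell q y))"

text \<open>The impedance function is an operator on \<open>\<complex>\<close>, identified with its value at \<open>1\<close>.\<close>

definition impedance :: "real \<Rightarrow> (real \<Rightarrow> real) \<Rightarrow> lsystem \<Rightarrow> complex \<Rightarrow> complex" where
  "impedance ell q \<Theta> z =
     channel_adjoint (channel_op \<Theta>)
       (inv_into (Hplus ell q) (shifted_Re ell q \<Theta> z) (channel_op \<Theta> 1))"

text \<open>The first two conjuncts say that \<open>(Re A - z)\<^sup>-\<^sup>1 K\<close> is well-defined.\<close>

definition realizes_on ::
  "real \<Rightarrow> (real \<Rightarrow> real) \<Rightarrow> lsystem \<Rightarrow> (complex \<Rightarrow> complex) \<Rightarrow> complex set \<Rightarrow> bool" where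
  "realizes_on ell q \<Theta> V D \<longleftrightarrow>
     (\<forall>z \<in> D. inj_on (shifted_Re ell q \<Theta> z) (Hplus ell q)
        \<and> range (channel_op \<Theta>) \<subseteq> shifted_Re ell q \<Theta> z ` Hplus ell q
        \<and> impedance ell q \<Theta> z = V z)"

definition accretive :: "real \<Rightarrow> (real \<Rightarrow> real) \<Rightarrow> lsystem \<Rightarrow> bool" where
  "accretive ell q \<Theta> \<longleftrightarrow> (\<forall>f \<in> Hplus ell q. 0 \<le> Re (state_op \<Theta> f f))"

text \<open>Both sides of the defining inequality are real, since \<open>Re A\<close> is symmetric.\<close>

definition accumulative :: "real \<Rightarrow> (real \<Rightarrow> real) \<Rightarrow> lsystem \<Rightarrow> bool" where
  "accumulative ell q \<Theta> \<longleftrightarrow>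
     (\<forall>f \<in> Hplus ell q.
        Re (rigged_Re ell q (state_op \<Theta>) f f)
        \<le> Re (l2_inner ell (lexpr ell q f) f + l2_inner ell f (lexpr ell q f)))"

section \<open>Schroedinger L-systems\<close>

datatype boundary_param = Fin_param real | Inf_param

fun schroedinger_state ::
  "real \<Rightarrow> (real \<Rightarrow> real) \<Rightarrow> boundary_param \<Rightarrow> complex \<Rightarrow> (real \<Rightarrow> complex) \<Rightarrow> functional" where
  "schroedinger_state ell q (Fin_param \<mu>) h y =
     embed ell q (lexpr ell q y)
     - cscale (1 / (complex_of_real \<mu> - h) * (hderiv ell y ell - h * y ell))
         (cscale (complex_of_real \<mu>) (delta ell q) + delta' ell q)"
| "schroedinger_state ell q Inf_param h y =
     embed ell q (lexpr ell q y) - cscale (hderiv ell y ell - h * y ell) (delta ell q)"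

fun schroedinger_g ::
  "real \<Rightarrow> (real \<Rightarrow> real) \<Rightarrow> boundary_param \<Rightarrow> complex \<Rightarrow> functional" where
  "schroedinger_g ell q (Fin_param \<mu>) h =
     cscale (complex_of_real (sqrt (Im h) / cmod (complex_of_real \<mu> - h)))
       (cscale (complex_of_real \<mu>) (delta ell q) + delta' ell q)"
| "schroedinger_g ell q Inf_param h = cscale (complex_of_real (sqrt (Im h))) (delta ell q)"

definition schroedinger_main ::
  "real \<Rightarrow> (real \<Rightarrow> real) \<Rightarrow> complex \<Rightarrow> ((real \<Rightarrow> complex) \<times> (real \<Rightarrow> complex)) set" where
  "schroedinger_main ell q h =
     {(y, lexpr ell q y) | y. y \<in> Hplus ell q \<and> hderiv ell y ell = h * y ell}"

definition schroedinger_system ::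
  "real \<Rightarrow> (real \<Rightarrow> real) \<Rightarrow> boundary_param \<Rightarrow> complex \<Rightarrow> lsystem" where
  "schroedinger_system ell q \<mu> h =
     \<lparr> state_op = schroedinger_state ell q \<mu> h,
       channel_op = (\<lambda>c. cscale c (schroedinger_g ell q \<mu> h)),
       main_op = schroedinger_main ell q h,
       triplet = (Hplus ell q, L2 ell, Hminus ell q) \<rparr>"

end

theory Submission
  imports Defs
begin

text \<open>The quantity behind both systems is the Neumann form \<open>Q f = (lexpr f, f) - f' cnj f\<close>, with the
boundary term taken at \<open>ell\<close>. Integration by parts at \<open>ell\<close> turns \<open>Re A\<close> into
\<open>(lexpr f, g) - f' cnj g\<close> for \<open>\<Theta>\<^sub>\<infinity>\<^sub>,\<^sub>i\<close> and into \<open>(lexpr f, g) + f cnj g'\<close> for \<open>\<Theta>\<^sub>0\<^sub>,\<^sub>i\<close>, and then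
accretivity of the former and accumulativity of the latter are one and the same inequality
\<open>Re (Q f) \<ge> 0\<close> on all of \<open>Hplus\<close>.

The argument rests on Green's formula on \<open>Hplus\<close> without a term at infinity. It follows from
deficiency index one. The Weyl solution at \<open>\<i>\<close> already spans the deficiency space, so the solution
\<open>\<phi>\<close> with \<open>\<phi> ell = 0\<close> is not square integrable. Given \<open>f\<close> in \<open>Hplus\<close>, correct it by a multiple
\<open>\<alpha> n \<phi>\<close> so that the sum vanishes at \<open>n\<close>; Green's formula on \<open>[ell, n]\<close> then has no term at \<open>n\<close>,
and since the norm of \<open>\<phi>\<close> on \<open>[ell, n]\<close> diverges, \<open>\<alpha> n\<close> tends to \<open>0\<close>. In the limit this gives an
inequality for \<open>f\<close>, whose reverse comes from the complex conjugate of \<open>f\<close>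
(\<open>Im_form_le_boundary_term\<close>, \<open>deficiency_index_one_imp_limit_point\<close>).

If \<open>f ell = 0\<close>, then \<open>f\<close> minus a small bump at \<open>ell\<close> lies in the minimal domain, and the form of
the bump tends to \<open>0\<close> as its support shrinks; hence \<open>(lexpr f, f) \<ge> 0\<close> (\<open>dirichlet_form_nonneg\<close>).
For general \<open>f\<close> and \<open>t < 0\<close> the Weyl solution \<open>\<psi>\<close> at \<open>t\<close> has \<open>\<psi> ell = -1\<close> and \<open>\<psi>' ell = m t\<close>, so
\<open>f + f(ell) \<psi>\<close> vanishes at \<open>ell\<close> and Green's formula yields
\<open>Re (Q f) \<ge> |f ell|\<^sup>2 Re (m t) + t ||f||\<^sup>2\<close>. Letting \<open>t\<close> tend to \<open>0\<close> from the left bounds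
\<open>Re (Q f)\<close> below by \<open>|f ell|\<^sup>2 m0\<close> (\<open>neumann_form_nonneg\<close>).

Testing with the minimal domain, which is dense, shows that an element annihilated by \<open>Re A - z\<close>
solves the differential equation and satisfies \<open>f ell = 0\<close> or \<open>f' ell = 0\<close>. By Green's formula its
Wronskian with the Weyl solution is zero, so both boundary values vanish as soon as \<open>m z \<noteq> 0\<close>, and
with them the solution. That \<open>m\<close> has no zero off \<open>[0, \<infinity>)\<close> is again positivity: at a zero the Weyl
solution would give \<open>Q \<psi> = z ||\<psi>||\<^sup>2\<close>. The equation \<open>(Re A - z) y = K 1\<close> is solved by \<open>\<psi>\<close> and by
\<open>- \<psi> / m z\<close> respectively, and reading off the boundary values gives \<open>- m z\<close> and \<open>1 / m z\<close>.

Membership in \<open>Hplus\<close> only says that \<open>f'\<close> is locally absolutely continuous, so Green's formula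
needs Lebesgue's theorem that such a function is differentiable almost everywhere and is the
integral of its derivative; the first two sections prove it.\<close>

section \<open>Almost everywhere differentiability of absolutely continuous functions\<close>

text \<open>The Lebesgue measure of \<open>H ` A\<close>, as a function of \<open>A\<close>, is a measure that gives an interval
\<open>[a, b]\<close> the mass \<open>H b - H a\<close>. It is absolutely continuous because Lipschitz maps preserve null
sets, and its Radon-Nikodym density is the required \<open>g\<close>.\<close>

lemma bi_lipschitz_has_density:
  fixes H :: "real \<Rightarrow> real"
  assumes lower: "\<And>x y. x \<le> y \<Longrightarrow> y - x \<le> H y - H x"
    and upper: "\<And>x y. x \<le> y \<Longrightarrow> H y - H x \<le> L * (y - x)"
  obtains g where "\<And>a b. a \<le> b \<Longrightarrow> (g has_integral (H b - H a)) {a..b}"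
proof -
  have L: "L \<ge> 1" using lower[of 0 1] upper[of 0 1] by simp
  have Hlip: "\<bar>H y - H x\<bar> \<le> L * \<bar>y - x\<bar>" for x y
    using lower[of x y] upper[of x y] lower[of y x] upper[of y x] by (cases "x \<le> y") auto
  have Hexp: "\<bar>y - x\<bar> \<le> \<bar>H y - H x\<bar>" for x y
    using lower[of x y] lower[of y x] by (cases "x \<le> y") auto
  have contH: "continuous_on S H" for S
    by (rule lipschitz_on_continuous_on[of L])
       (use Hlip L in \<open>auto simp: lipschitz_on_def dist_real_def abs_minus_commute\<close>)
  have inj: "inj H"
  proof (rule injI)
    fix x y assume "H x = H y"
    then show "x = y" using Hexp[of x y] by simp
  qed
  have surj: "surj H"
  proof (rule surjI[where f="\<lambda>y. SOME x. H x = y"])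
    fix y
    define r where "r = \<bar>y - H 0\<bar>"
    have "H (-r) \<le> y" "y \<le> H r" using lower[of 0 r] lower[of "-r" 0] by (auto simp: r_def)
    then obtain x where "H x = y" using IVT'[of H "-r" y r] contH by (auto simp: r_def)
    then show "H (SOME x. H x = y) = y" by (rule someI)
  qed
  define J where "J = inv H"
  have HJ: "H (J y) = y" and JH: "J (H x) = x" for x y
    using inj surj by (simp_all add: J_def surj_f_inv_f)
  have contJ: "continuous_on UNIV J"
    by (rule lipschitz_on_continuous_on[of 1])
       (use Hexp[of "J _" "J _"] in \<open>auto simp: lipschitz_on_def dist_real_def HJ\<close>)
  then have Jm: "J \<in> borel_measurable borel" by (rule borel_measurable_continuous_onI)
  \<comment> \<open>The image measure takes preimages under \<open>J\<close>, which are images under \<open>H\<close>.\<close>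
  define \<mu> where "\<mu> = distr lborel lborel J"
  have pre: "J -` A = H ` A" for A
    by (auto simp: HJ JH image_iff) (metis HJ)
  have mu: "emeasure \<mu> A = emeasure lborel (H ` A)" if "A \<in> sets borel" for A
    using that Jm by (simp add: \<mu>_def emeasure_distr pre)
  have ac: "absolutely_continuous lborel \<mu>"
    unfolding absolutely_continuous_def
  proof
    fix A :: "real set" assume A: "A \<in> null_sets lborel"
    then have "negligible A" by (simp add: negligible_iff_null_sets null_sets_completionI)
    then have "negligible (H ` A)"
      by (rule negligible_locally_Lipschitz_image[rotated])
         (auto intro!: exI[of _ UNIV] exI[of _ L] simp: Hlip)
    moreover have "H ` A \<in> sets borel"
      using A measurable_sets[OF Jm, of A] by (simp add: pre null_sets_def)
    ultimately have "emeasure lborel (H ` A) = 0"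
      by (simp add: negligible_iff_null_sets null_sets_def)
    then show "A \<in> null_sets \<mu>" using A mu[of A] by (auto simp: null_sets_def \<mu>_def)
  qed
  then obtain f where f: "f \<in> borel_measurable lborel" and dens: "density lborel f = \<mu>"
    using sigma_finite_measure.Radon_Nikodym[OF sigma_finite_lborel, of \<mu>] by (auto simp: \<mu>_def)
  define g where "g = (\<lambda>x. enn2real (f x))"
  have main: "(g has_integral (H b - H a)) {a..b}" if "a \<le> b" for a b
  proof -
    have img: "H ` {a..b} = {H a..H b}"
    proof
      show "H ` {a..b} \<subseteq> {H a..H b}" using lower by fastforce
      show "{H a..H b} \<subseteq> H ` {a..b}"
      proof
        fix y assume "y \<in> {H a..H b}"
        then obtain x where "a \<le> x" "x \<le> b" "H x = y" using IVT'[of H a y b] contH \<open>a \<le> b\<close> by auto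
        then show "y \<in> H ` {a..b}" by auto
      qed
    qed
    have ab: "H a \<le> H b" using lower[OF that] that by linarith
    have nn: "(\<integral>\<^sup>+x. f x * indicator {a..b} x \<partial>lborel) = ennreal (H b - H a)"
      using mu[of "{a..b}"] f ab by (simp add: dens[symmetric] emeasure_density img)
    have fin: "AE x in lborel. f x * indicator {a..b} x \<noteq> \<infinity>"
      using f by (intro nn_integral_PInf_AE) (auto simp: nn)
    have "(\<integral>\<^sup>+x. ennreal (g x * indicator {a..b} x) \<partial>lborel) = ennreal (H b - H a)"
      unfolding nn[symmetric] using fin
      by (intro nn_integral_cong_AE) (auto elim!: eventually_mono simp: g_def indicator_def less_top)
    then have "has_bochner_integral lborel (\<lambda>x. g x * indicator {a..b} x) (H b - H a)"
      using f ab by (intro has_bochner_integral_nn_integral) (auto simp: g_def)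
    then have "((\<lambda>x. g x * indicator {a..b} x) has_integral (H b - H a)) UNIV"
      by (metis has_bochner_integral_iff has_integral_integral_lborel)
    moreover have "(\<lambda>x. g x * indicator {a..b} x) = (\<lambda>x. if x \<in> {a..b} then g x else 0)"
      by (auto simp: indicator_def)
    ultimately show ?thesis by (simp only: has_integral_restrict_UNIV)
  qed
  show thesis by (rule that) (rule main)
qed

text \<open>A Lipschitz function plus a steep linear function is bi-Lipschitz, hence an indefinite integral,
and indefinite integrals are differentiable almost everywhere.\<close>

lemma lipschitz_differentiable_ae:
  fixes G :: "real \<Rightarrow> real"
  assumes "K-lipschitz_on UNIV G"
  shows "negligible {x. \<not> G differentiable (at x)}"
proof -
  have K: "K \<ge> 0" using assms by (rule lipschitz_on_nonneg)
  have lip: "\<bar>G y - G x\<bar> \<le> K * \<bar>y - x\<bar>" for x y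
    using lipschitz_onD[OF assms, of y x] by (simp add: dist_real_def)
  \<comment> \<open>The slopes of \<open>H\<close> lie between \<open>1\<close> and \<open>2 * K + 1\<close>.\<close>
  define H where "H = (\<lambda>x. G x + (K + 1) * x)"
  have H_bounds: "y - x \<le> H y - H x" "H y - H x \<le> (2 * K + 1) * (y - x)" if "x \<le> y" for x y
    using that lip[of y x] by (auto simp: H_def algebra_simps)
  obtain g where g: "\<And>a b. a \<le> b \<Longrightarrow> (g has_integral (H b - H a)) {a..b}"
    using bi_lipschitz_has_density[of H "2 * K + 1"] H_bounds by blast
  \<comment> \<open>Lebesgue points are available for right-hand averages only; the left-hand ones come from
    the reflected density.\<close>
  have g_refl: "((\<lambda>x. g (- x)) has_integral (H (-a) - H (-b))) {a..b}" if "a \<le> b" for a b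
    using g[of "-b" "-a"] that has_integral_reflect_real[of g "H (-a) - H (-b)" "-a" "-b"] by simp
  have int: "g integrable_on cbox a b" "(\<lambda>x. g (-x)) integrable_on cbox a b" for a b
    using g[of a b] g_refl[of a b] by (cases "a \<le> b"; force simp: integrable_on_def)+
  obtain N1 where N1: "negligible N1" "\<And>x e. \<lbrakk>x \<notin> N1; 0 < e\<rbrakk> \<Longrightarrow> \<exists>d>0. \<forall>h. 0 < h \<and> h < d \<longrightarrow>
       norm (integral (cbox x (x + h *\<^sub>R One)) g /\<^sub>R h ^ DIM(real) - g x) < e"
    by (rule integrable_ccontinuous_explicit[OF int(1)]) blast
  obtain N2 where N2: "negligible N2" "\<And>x e. \<lbrakk>x \<notin> N2; 0 < e\<rbrakk> \<Longrightarrow> \<exists>d>0. \<forall>h. 0 < h \<and> h < d \<longrightarrow>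
       norm (integral (cbox x (x + h *\<^sub>R One)) (\<lambda>x. g (-x)) /\<^sub>R h ^ DIM(real) - g (-x)) < e"
    by (rule integrable_ccontinuous_explicit[OF int(2)]) blast
  have neg: "negligible (N1 \<union> uminus ` N2)"
    using N1(1) N2(1)
    by (intro negligible_Un negligible_locally_Lipschitz_image[of N2 uminus])
       (auto intro!: exI[of _ "UNIV :: real set"] exI[of _ "1 :: real"])
  have diff: "G differentiable (at x)" if x: "x \<notin> N1 \<union> uminus ` N2" for x
  proof -
    have "x \<notin> N1" "-x \<notin> N2" using x by (auto simp: image_iff)
    have "((\<lambda>y. (H y - H x) / (y - x)) \<longlongrightarrow> g x) (at x)"
    proof (rule LIM_I)
      fix e :: real assume "e > 0"
      obtain d1 where d1: "d1 > 0" "\<And>h. 0 < h \<Longrightarrow> h < d1 \<Longrightarrow> \<bar>integral {x..x + h} g / h - g x\<bar> < e"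
        using N1(2)[OF \<open>x \<notin> N1\<close> \<open>e > 0\<close>] by (auto simp: divide_inverse mult.commute)
      obtain d2 where d2: "d2 > 0"
        "\<And>h. 0 < h \<Longrightarrow> h < d2 \<Longrightarrow> \<bar>integral {-x..-x + h} (\<lambda>x. g (-x)) / h - g x\<bar> < e"
        using N2(2)[OF \<open>-x \<notin> N2\<close> \<open>e > 0\<close>] by (auto simp: divide_inverse mult.commute)
      have "norm ((H y - H x) / (y - x) - g x) < e" if y: "y \<noteq> x" "norm (y - x) < min d1 d2" for y
      proof (cases "y > x")
        case True
        then have "integral {x..x + (y - x)} g = H y - H x" using g[of x y] by (simp add: integral_unique)
        then show ?thesis using d1(2)[of "y - x"] y True by auto
      next
        case False
        then have "integral {-x..-x + (x - y)} (\<lambda>x. g (-x)) = H x - H y"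
          using g_refl[of "-x" "-y"] by (simp add: integral_unique)
        moreover have "(H x - H y) / (x - y) = (H y - H x) / (y - x)"
          by (metis minus_diff_eq minus_divide_divide)
        ultimately show ?thesis using d2(2)[of "x - y"] y False by auto
      qed
      then show "\<exists>s>0. \<forall>y. y \<noteq> x \<and> norm (y - x) < s \<longrightarrow> norm ((H y - H x) / (y - x) - g x) < e"
        using d1(1) d2(1) by (intro exI[of _ "min d1 d2"]) auto
    qed
    then have "(H has_field_derivative g x) (at x)"
      by (simp add: has_field_derivative_iff)
    then have "((\<lambda>x. H x - (K + 1) * x) has_field_derivative (g x - (K + 1))) (at x)"
      by (auto intro!: derivative_eq_intros)
    then have "(G has_field_derivative (g x - (K + 1))) (at x)" by (simp add: H_def)
    then show ?thesis
      using real_differentiable_def by blast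
  qed
  show ?thesis by (rule negligible_subset[OF neg]) (use diff in blast)
qed

text \<open>The infimal convolution is the largest \<open>K\<close>-Lipschitz function that lies below \<open>G\<close> on \<open>T\<close>; the
bound \<open>B\<close> keeps the infimum finite.\<close>

lemma inf_convolution_lipschitz:
  fixes G :: "real \<Rightarrow> real"
  assumes T: "T \<noteq> {}" and bd: "\<forall>y\<in>T. - B \<le> G y" and K: "0 \<le> K"
  shows "K-lipschitz_on UNIV (\<lambda>x. INF y\<in>T. G y + K * \<bar>x - y\<bar>)"
    and "\<And>x y. y \<in> T \<Longrightarrow> (INF y\<in>T. G y + K * \<bar>x - y\<bar>) \<le> G y + K * \<bar>x - y\<bar>"
proof -
  let ?F = "\<lambda>x. INF y\<in>T. G y + K * \<bar>x - y\<bar>"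
  have bdd: "bdd_below ((\<lambda>y. G y + K * \<bar>x - y\<bar>) ` T)" for x
    using bd K by (intro bdd_belowI2[of _ "-B"] add_increasing2) auto
  show le: "?F x \<le> G y + K * \<bar>x - y\<bar>" if "y \<in> T" for x y
    using cINF_lower[OF bdd that] .
  have half: "?F x \<le> ?F z + K * \<bar>x - z\<bar>" for x z
  proof -
    have "?F x - K * \<bar>x - z\<bar> \<le> ?F z"
    proof (rule cINF_greatest[OF T])
      fix y assume "y \<in> T"
      have "K * \<bar>x - y\<bar> \<le> K * \<bar>x - z\<bar> + K * \<bar>z - y\<bar>"
        using mult_left_mono[OF _ K, of "\<bar>x - y\<bar>" "\<bar>x - z\<bar> + \<bar>z - y\<bar>"]
        by (simp add: distrib_left)
      then show "?F x - K * \<bar>x - z\<bar> \<le> G y + K * \<bar>z - y\<bar>" using le[OF \<open>y \<in> T\<close>, of x] by linarith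
    qed
    then show ?thesis by linarith
  qed
  show "K-lipschitz_on UNIV ?F"
  proof (rule lipschitz_onI)
    fix x z
    show "dist (?F x) (?F z) \<le> K * dist x z"
      using half[of x z] half[of z x] by (auto simp: dist_real_def abs_minus_commute abs_le_iff)
  qed (rule K)
qed

text \<open>One-dimensional Stepanov theorem. At the points in question \<open>G\<close> agrees with both its largest
\<open>K\<close>-Lipschitz minorant and its least \<open>K\<close>-Lipschitz majorant. Almost everywhere these two are
differentiable, and \<open>G\<close> is squeezed between them.\<close>

lemma differentiable_ae_where_pointwise_lipschitz:
  fixes G :: "real \<Rightarrow> real"
  assumes bd: "\<And>y. y \<in> {a<..<b} \<Longrightarrow> \<bar>G y\<bar> \<le> B" and K: "0 \<le> K"
  shows "negligible {x \<in> {a<..<b}. (\<forall>y\<in>{a<..<b}. \<bar>G y - G x\<bar> \<le> K * \<bar>x - y\<bar>) \<and> \<not> G differentiable (at x)}"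
proof (cases "a < b")
  case True
  let ?T = "{a<..<b}"
  have T: "?T \<noteq> {}" using True by simp
  define lo where "lo = (\<lambda>x. INF y\<in>?T. G y + K * \<bar>x - y\<bar>)"
  define up where "up = (\<lambda>x. - (INF y\<in>?T. - G y + K * \<bar>x - y\<bar>))"
  have bd': "\<forall>y\<in>?T. - B \<le> G y" "\<forall>y\<in>?T. - B \<le> - G y" using bd by (force simp: abs_le_iff)+
  note lo1 = inf_convolution_lipschitz[OF T bd'(1) K, folded lo_def]
  note up1 = inf_convolution_lipschitz[where G="\<lambda>y. - G y", OF T bd'(2) K]
  have up_lip: "K-lipschitz_on UNIV up"
    using up1(1) by (simp add: up_def lipschitz_on_def dist_real_def abs_minus_commute)
  have up_ge: "G y - K * \<bar>x - y\<bar> \<le> up x" if "y \<in> ?T" for x y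
    using up1(2)[OF that, of x] by (simp add: up_def)
  have "negligible ({x. \<not> lo differentiable (at x)} \<union> {x. \<not> up differentiable (at x)})"
    using lo1(1) up_lip by (intro negligible_Un lipschitz_differentiable_ae)
  moreover have "G differentiable (at x)"
    if x: "x \<in> ?T" "\<forall>y\<in>?T. \<bar>G y - G x\<bar> \<le> K * \<bar>x - y\<bar>"
      and dlo: "lo differentiable (at x)" and dup: "up differentiable (at x)" for x
  proof -
    have lo_le: "lo y \<le> G y" and le_up: "G y \<le> up y" if "y \<in> ?T" for y
      using lo1(2)[OF that, of y] up_ge[OF that, of y] by (auto simp: lo_def)
    have "G x \<le> lo x" unfolding lo_def
      by (rule cINF_greatest[OF T]) (use x(2) in force)
    then have lox: "lo x = G x" using lo_le[OF x(1)] by simp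
    have "G x \<ge> up x"
    proof -
      have "- G x \<le> (INF y\<in>?T. - G y + K * \<bar>x - y\<bar>)"
        by (rule cINF_greatest[OF T]) (use x(2) in force)
      then show ?thesis by (simp add: up_def)
    qed
    then have upx: "up x = G x" using le_up[OF x(1)] by simp
    obtain l where l: "(lo has_real_derivative l) (at x)" using dlo real_differentiable_def by blast
    obtain u where u: "(up has_real_derivative u) (at x)" using dup real_differentiable_def by blast
    have d: "((\<lambda>y. up y - lo y) has_real_derivative (u - l)) (at x)"
      using l u by (auto intro!: derivative_eq_intros)
    obtain e where e: "e > 0" "\<And>y. \<bar>x - y\<bar> < e \<Longrightarrow> y \<in> ?T"
    proof -
      have "min (x - a) (b - x) > 0" using x(1) by auto
      moreover have "y \<in> ?T" if "\<bar>x - y\<bar> < min (x - a) (b - x)" for y using that by auto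
      ultimately show thesis using that by blast
    qed
    \<comment> \<open>The gap between majorant and minorant is minimal at \<open>x\<close>, where it is \<open>0\<close>.\<close>
    have "u - l = 0"
    proof (rule DERIV_local_min[OF d e(1)], intro allI impI)
      fix y assume "\<bar>x - y\<bar> < e"
      then show "up x - lo x \<le> up y - lo y" using e(2)[of y] lo_le[of y] le_up[of y] lox upx by simp
    qed
    have "((\<lambda>y. G y - lo y) has_real_derivative 0) (at x)"
      unfolding has_field_derivative_iff
    proof (rule Lim_null_comparison)
      show "((\<lambda>y. \<bar>((up y - lo y) - (up x - lo x)) / (y - x)\<bar>) \<longlongrightarrow> 0) (at x)"
        using d \<open>u - l = 0\<close> unfolding has_field_derivative_iff by (intro tendsto_rabs_zero) simp
      show "\<forall>\<^sub>F y in at x. norm ((G y - lo y - (G x - lo x)) / (y - x))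
              \<le> \<bar>((up y - lo y) - (up x - lo x)) / (y - x)\<bar>"
        unfolding eventually_at
      proof (intro exI[of _ e] conjI ballI impI e(1))
        fix y assume "y \<noteq> x \<and> dist y x < e"
        then have "y \<in> ?T" using e(2)[of y] by (simp add: dist_real_def abs_minus_commute)
        then show "norm ((G y - lo y - (G x - lo x)) / (y - x))
              \<le> \<bar>((up y - lo y) - (up x - lo x)) / (y - x)\<bar>"
          using lo_le[of y] le_up[of y] lox upx by (simp add: divide_right_mono)
      qed
    qed
    then have "((\<lambda>y. (G y - lo y) + lo y) has_real_derivative 0 + l) (at x)"
      using l by (rule DERIV_add)
    then show ?thesis using real_differentiable_def by force
  qed
  ultimately show ?thesis by (elim negligible_subset) blast
qed simp

lemma sum_lengths_le_measure:
  assumes "finite I" "\<And>s t. (s, t) \<in> I \<Longrightarrow> s < t \<and> {s<..<t} \<subseteq> U"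
    and "disjoint_family_on (\<lambda>(s, t). {s<..<t}) I" "U \<in> lmeasurable"
  shows "(\<Sum>(s, t)\<in>I. t - s) \<le> measure lebesgue (U :: real set)"
proof -
  have "(\<Sum>(s, t)\<in>I. t - s) = (\<Sum>p\<in>I. measure lebesgue (case p of (s, t) \<Rightarrow> {s<..<t}))"
    using assms(2) by (intro sum.cong) (auto simp: less_imp_le)
  also have "\<dots> = measure lebesgue (\<Union>p\<in>I. case p of (s, t) \<Rightarrow> {s<..<t})"
    using assms by (intro measure_UNION'[symmetric])
      (auto simp: pairwise_def disjnt_def disjoint_family_on_def split: prod.splits)
  also have "\<dots> \<le> measure lebesgue U"
    using assms by (intro measure_mono_fmeasurable) (auto split: prod.splits)
  finally show ?thesis .
qed

text \<open>The definition of absolute continuity stripped of its quantifiers over \<open>\<epsilon>\<close> and \<open>\<delta>\<close>, so that one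
pair can be fixed and passed to smaller sets.\<close>

definition variation_below :: "real set \<Rightarrow> (real \<Rightarrow> complex) \<Rightarrow> real \<Rightarrow> real \<Rightarrow> bool" where
  "variation_below S F \<delta> \<epsilon> \<longleftrightarrow>
     (\<forall>I. finite I \<and> (\<forall>(s, t)\<in>I. s < t \<and> {s..t} \<subseteq> S)
         \<and> disjoint_family_on (\<lambda>(s, t). {s<..<t}) I \<and> (\<Sum>(s, t)\<in>I. t - s) < \<delta>
         \<longrightarrow> (\<Sum>(s, t)\<in>I. cmod (F t - F s)) < \<epsilon>)"

lemma absolutely_continuous_on_iff_variation_below:
  "absolutely_continuous_on S F \<longleftrightarrow> (\<forall>\<epsilon>>0. \<exists>\<delta>>0. variation_below S F \<delta> \<epsilon>)"
  by (simp add: absolutely_continuous_on_def variation_below_def)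

lemma absolutely_continuous_onD:
  assumes "absolutely_continuous_on S F" "\<epsilon> > 0"
  obtains \<delta> where "\<delta> > 0" "variation_below S F \<delta> \<epsilon>"
  using assms unfolding absolutely_continuous_on_iff_variation_below by blast

lemma variation_belowD:
  assumes "variation_below S F \<delta> \<epsilon>" "finite I" "\<And>s t. (s, t) \<in> I \<Longrightarrow> s < t \<and> {s..t} \<subseteq> S"
    "disjoint_family_on (\<lambda>(s, t). {s<..<t}) I" "(\<Sum>(s, t)\<in>I. t - s) < \<delta>"
  shows "(\<Sum>(s, t)\<in>I. cmod (F t - F s)) < \<epsilon>"
proof -
  have "\<forall>(s, t)\<in>I. s < t \<and> {s..t} \<subseteq> S" using assms(3) by auto
  then show ?thesis using assms(1,2,4,5) unfolding variation_below_def by blast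
qed

text \<open>Intervals obtained from coverings and tagged divisions come indexed and may be degenerate. The
degenerate ones contribute nothing, and without them the indexing is injective.\<close>

lemma variation_below_family:
  fixes lo hi :: "'i \<Rightarrow> real"
  assumes var: "variation_below S F \<delta> \<epsilon>" and fin: "finite P"
    and itv: "\<And>p. p \<in> P \<Longrightarrow> lo p \<le> hi p \<and> {lo p..hi p} \<subseteq> S \<inter> U"
    and disj: "\<And>p p'. p \<in> P \<Longrightarrow> p' \<in> P \<Longrightarrow> p \<noteq> p' \<Longrightarrow> {lo p<..<hi p} \<inter> {lo p'<..<hi p'} = {}"
    and U: "U \<in> lmeasurable" "measure lebesgue U < \<delta>"
  shows "(\<Sum>p\<in>P. cmod (F (hi p) - F (lo p))) < \<epsilon>"
proof -
  define Q where "Q = {p \<in> P. lo p < hi p}"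
  let ?j = "\<lambda>p. (lo p, hi p)"
  have finQ: "finite (?j ` Q)" using fin by (simp add: Q_def)
  have itvQ: "s < t \<and> {s..t} \<subseteq> S \<inter> U" if "(s, t) \<in> ?j ` Q" for s t
    using that itv by (auto simp: Q_def)
  have inj: "inj_on ?j Q"
  proof (rule inj_onI, rule ccontr)
    fix p p' assume "p \<in> Q" "p' \<in> Q" "?j p = ?j p'" "p \<noteq> p'"
    then show False using disj[of p p'] by (auto simp: Q_def)
  qed
  have dis: "disjoint_family_on (\<lambda>(s, t). {s<..<t}) (?j ` Q)"
    unfolding disjoint_family_on_def
  proof (intro ballI impI)
    fix m n assume "m \<in> ?j ` Q" "n \<in> ?j ` Q" "m \<noteq> n"
    then obtain p p' where "p \<in> P" "p' \<in> P" "m = ?j p" "n = ?j p'" "p \<noteq> p'" by (auto simp: Q_def)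
    then show "(\<lambda>(s, t). {s<..<t}) m \<inter> (\<lambda>(s, t). {s<..<t}) n = {}" using disj by simp
  qed
  have "(\<Sum>p\<in>P. cmod (F (hi p) - F (lo p))) = (\<Sum>p\<in>Q. cmod (F (hi p) - F (lo p)))"
  proof (rule sum.mono_neutral_right[OF fin])
    show "\<forall>p\<in>P - Q. cmod (F (hi p) - F (lo p)) = 0" using itv by (force simp: Q_def)
  qed (auto simp: Q_def)
  also have "\<dots> = (\<Sum>(s, t)\<in>?j ` Q. cmod (F t - F s))"
    using inj by (simp add: sum.reindex)
  also have "\<dots> < \<epsilon>"
  proof (rule variation_belowD[OF var finQ _ dis])
    show "s < t \<and> {s..t} \<subseteq> S" if "(s, t) \<in> ?j ` Q" for s t using itvQ[OF that] by blast
    have "(\<Sum>(s, t)\<in>?j ` Q. t - s) \<le> measure lebesgue U"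
    proof (rule sum_lengths_le_measure[OF finQ _ dis U(1)])
      fix s t assume "(s, t) \<in> ?j ` Q"
      from itvQ[OF this] show "s < t \<and> {s<..<t} \<subseteq> U" by (auto simp: subset_eq)
    qed
    then show "(\<Sum>(s, t)\<in>?j ` Q. t - s) < \<delta>" using U(2) by linarith
  qed
  finally show ?thesis .
qed

lemma absolutely_continuous_on_imp_continuous_on:
  assumes "absolutely_continuous_on {a..b} F"
  shows "continuous_on {a..b} F"
  unfolding continuous_on_iff
proof (intro ballI allI impI)
  fix x e assume x: "x \<in> {a..b}" and "(e::real) > 0"
  obtain \<delta> where d: "\<delta> > 0" "variation_below {a..b} F \<delta> e"
    by (rule absolutely_continuous_onD[OF assms \<open>e > 0\<close>]) blast
  have "dist (F y) (F x) < e" if y: "y \<in> {a..b}" "dist y x < \<delta>" for y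
  proof (cases "x = y")
    case False
    have "(\<Sum>(s, t)\<in>{(min x y, max x y)}. cmod (F t - F s)) < e"
      using x y False by (intro variation_belowD[OF d(2)]) (auto simp: disjoint_family_on_def dist_real_def)
    then show ?thesis by (auto simp: min_def max_def dist_norm norm_minus_commute split: if_splits)
  qed (use \<open>e > 0\<close> in auto)
  then show "\<exists>d>0. \<forall>y\<in>{a..b}. dist y x < d \<longrightarrow> dist (F y) (F x) < e"
    using d(1) by blast
qed

lemma absolutely_continuous_on_bounded:
  assumes "absolutely_continuous_on {a..b} F"
  obtains B where "\<And>x. x \<in> {a..b} \<Longrightarrow> cmod (F x) \<le> B"
proof -
  have "bounded (F ` {a..b})"
    using absolutely_continuous_on_imp_continuous_on[OF assms] compact_continuous_image compact_imp_bounded by blast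
  then show thesis using that unfolding bounded_iff by blast
qed

text \<open>A point at which no \<open>K\<close> bounds all difference quotients is covered by arbitrarily small intervals
over which \<open>F\<close> moves by more than \<open>K\<close> times the radius. A disjoint Vitali subfamily has total
variation at most \<open>M\<close>, hence total length at most \<open>2 M / K\<close>, and it covers all but a null set of
such points.\<close>

lemma pointwise_lipschitz_ae_if_variation_below:
  assumes var: "variation_below {c<..<d} F \<delta> M" "d - c < \<delta>" "0 < M" "0 < \<delta>"
    and inside: "{c<..<d} \<subseteq> T" and bdd: "\<And>x. x \<in> T \<Longrightarrow> cmod (F x) \<le> B"
  shows "negligible {x \<in> {c<..<d}. \<forall>K. \<exists>y\<in>T. K * \<bar>x - y\<bar> < cmod (F y - F x)}"
    (is "negligible ?E")
  unfolding negligible_outer_le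
proof (intro allI impI)
  fix e :: real assume e: "e > 0"
  \<comment> \<open>With this slope the total length of the selected intervals is at most \<open>e\<close>.\<close>
  define K where "K = 2 * M / e"
  have K: "K > 0" using e var(3) by (simp add: K_def)
  define P where "P = {(x, y). x \<in> {c<..<d} \<and> y \<in> {c<..<d} \<and> K * \<bar>x - y\<bar> < cmod (F y - F x)}"
  \<comment> \<open>An index \<open>(x, y)\<close> stands for the interval with centre \<open>x\<close> and radius \<open>|x - y|\<close>, which contains the
    half between \<open>x\<close> and \<open>y\<close>; disjoint intervals have disjoint halves.\<close>
  define r where "r = (\<lambda>(x::real, y). \<bar>x - y\<bar>)"
  have rpos: "0 < r p" if "p \<in> P" for p using that K by (auto simp: P_def r_def)
  have fine: "\<exists>p. p \<in> P \<and> x \<in> cball (fst p) (r p) \<and> r p < h" if x: "x \<in> ?E" and h: "0 < h" for x h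
  proof -
    \<comment> \<open>As \<open>F\<close> is bounded by \<open>B\<close>, a slope above \<open>2 * B / h'\<close> is possible only at distance less than \<open>h'\<close>.\<close>
    define h' where "h' = min h (min (x - c) (d - x))"
    have h': "h' > 0" using x h by (auto simp: h'_def)
    obtain y where y: "y \<in> T" "max K (2 * B / h') * \<bar>x - y\<bar> < cmod (F y - F x)"
      using x by blast
    have B0: "B \<ge> 0" using bdd[OF y(1)] norm_ge_zero order_trans by blast
    have "2 * B / h' * \<bar>x - y\<bar> \<le> max K (2 * B / h') * \<bar>x - y\<bar>" by (intro mult_right_mono) auto
    also have "\<dots> < cmod (F y - F x)" by (rule y(2))
    also have "\<dots> \<le> cmod (F y) + cmod (F x)" by (rule norm_triangle_ineq4)
    also have "\<dots> \<le> 2 * B" using bdd[OF y(1)] bdd[of x] x inside by auto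
    finally have "B * \<bar>x - y\<bar> < B * h'" using h' by (simp add: field_simps)
    then have "\<bar>x - y\<bar> < h'" using B0 by (metis mult_less_cancel_left not_le)
    then have "\<bar>x - y\<bar> < h" "y \<in> {c<..<d}" by (auto simp: h'_def)
    moreover have "K * \<bar>x - y\<bar> \<le> max K (2 * B / h') * \<bar>x - y\<bar>" by (intro mult_right_mono) auto
    ultimately show ?thesis using x y
      by (intro exI[of _ "(x, y)"]) (auto simp: P_def r_def)
  qed
  obtain C where C: "countable C" "C \<subseteq> P"
      "pairwise (\<lambda>i j. disjnt (cball (fst i) (r i)) (cball (fst j) (r j))) C"
      "negligible (?E - (\<Union>i \<in> C. cball (fst i) (r i)))"
    by (rule Vitali_covering_theorem_cballs[OF rpos fine]) blast+
  let ?U = "\<Union>i\<in>C. cball (fst i) (r i)"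
  have fin_bound: "measure lebesgue (\<Union>i\<in>C'. cball (fst i) (r i)) \<le> e" if C': "C' \<subseteq> C" "finite C'" for C'
  proof -
    define lo where "lo = (\<lambda>(x::real, y). min x y)"
    define hi where "hi = (\<lambda>(x::real, y). max x y)"
    have sub: "{lo p<..<hi p} \<subseteq> cball (fst p) (r p)" for p
      by (auto simp: lo_def hi_def r_def dist_real_def split: prod.splits)
    have "(\<Sum>p\<in>C'. K * r p) \<le> (\<Sum>p\<in>C'. cmod (F (hi p) - F (lo p)))"
    proof (rule sum_mono)
      fix p assume "p \<in> C'"
      then have "p \<in> P" using C' C(2) by auto
      then show "K * r p \<le> cmod (F (hi p) - F (lo p))"
        by (auto simp: P_def r_def lo_def hi_def min_def max_def norm_minus_commute abs_minus_commute)
    qed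
    also have "\<dots> < M"
    proof (rule variation_below_family[OF var(1) C'(2), where U="{c<..<d}"])
      show "lo p \<le> hi p \<and> {lo p..hi p} \<subseteq> {c<..<d} \<inter> {c<..<d}" if "p \<in> C'" for p
      proof -
        have "p \<in> P" using that C' C(2) by auto
        then show ?thesis by (auto simp: P_def lo_def hi_def)
      qed
      show "{lo p<..<hi p} \<inter> {lo p'<..<hi p'} = {}" if "p \<in> C'" "p' \<in> C'" "p \<noteq> p'" for p p'
      proof -
        have "disjnt (cball (fst p) (r p)) (cball (fst p') (r p'))"
          using C(3) C'(1) that by (auto simp: pairwise_def)
        then show ?thesis using sub[of p] sub[of p'] by (metis disjnt_def disjnt_subset1 disjnt_subset2)
      qed
      show "measure lebesgue {c<..<d} < \<delta>" using var(2,4) by (cases "c \<le> d") auto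
    qed simp
    finally have KM: "K * (\<Sum>p\<in>C'. r p) \<le> M" by (simp add: sum_distrib_left)
    have "measure lebesgue (\<Union>i\<in>C'. cball (fst i) (r i)) \<le> (\<Sum>p\<in>C'. measure lebesgue (cball (fst p) (r p)))"
      using C' by (intro measure_UNION_le) auto
    also have "\<dots> = (\<Sum>p\<in>C'. 2 * r p)"
      by (intro sum.cong refl) (auto simp: cball_eq_atLeastAtMost r_def)
    also have "\<dots> \<le> e" using KM e var(3) by (simp add: K_def sum_distrib_left[symmetric] sum_distrib_right[symmetric] field_simps)
    finally show ?thesis .
  qed
  have U: "?U \<in> lmeasurable" "measure lebesgue ?U \<le> e"
    using fmeasurable_UN_bound[OF C(1), of "\<lambda>i. cball (fst i) (r i)" lebesgue e]
      measure_UN_bound[OF C(1), of "\<lambda>i. cball (fst i) (r i)" lebesgue e] fin_bound by auto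
  let ?N = "?E - ?U"
  have "measure lebesgue (?U \<union> ?N) = measure lebesgue ?U" "?U \<union> ?N \<in> lmeasurable"
    using C(4) U(1) measure_Un_null_set[OF fmeasurableD[OF U(1)], of ?N]
      fmeasurable.Un[OF U(1) negligible_imp_measurable[OF C(4)]]
    by (simp_all only: negligible_iff_null_sets)
  then show "\<exists>T. ?E \<subseteq> T \<and> T \<in> lmeasurable \<and> measure lebesgue T \<le> e"
    using U(2) by (intro exI[of _ "?U \<union> ?N"]) auto
qed

lemma AC_pointwise_lipschitz_ae:
  assumes "absolutely_continuous_on {a..b} F"
  shows "negligible {x \<in> {a<..<b}. \<forall>K. \<exists>y\<in>{a<..<b}. K * \<bar>x - y\<bar> < cmod (F y - F x)}"
proof -
  let ?E = "\<lambda>c d. {x \<in> {c<..<d}. \<forall>K. \<exists>y\<in>{a<..<b}. K * \<bar>x - y\<bar> < cmod (F y - F x)}"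
  obtain B where B: "\<And>x. x \<in> {a..b} \<Longrightarrow> cmod (F x) \<le> B" using absolutely_continuous_on_bounded[OF assms] by blast
  obtain \<delta> where d: "\<delta> > 0" "variation_below {a..b} F \<delta> 1"
    by (rule absolutely_continuous_onD[OF assms zero_less_one]) blast
  \<comment> \<open>An interval shorter than \<open>\<delta>\<close> cannot contain disjoint intervals of total length \<open>\<delta>\<close> or more.\<close>
  have local: "negligible (?E (max a (q - \<delta> / 4)) (min b (q + \<delta> / 4)))" for q
  proof (rule pointwise_lipschitz_ae_if_variation_below[where \<delta>=\<delta> and M=1 and B=B])
    have "{max a (q - \<delta> / 4)<..<min b (q + \<delta> / 4)} \<subseteq> {a..b}" by auto
    then show "variation_below {max a (q - \<delta> / 4)<..<min b (q + \<delta> / 4)} F \<delta> 1"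
      using d(2) unfolding variation_below_def by (fast intro: order_trans)
  qed (use B d(1) in auto)
  have "negligible (\<Union>q\<in>\<rat>. ?E (max a (q - \<delta> / 4)) (min b (q + \<delta> / 4)))"
    using local countable_rat by (intro negligible_countable_Union) auto
  moreover have "?E a b \<subseteq> (\<Union>q\<in>\<rat>. ?E (max a (q - \<delta> / 4)) (min b (q + \<delta> / 4)))"
  proof
    fix x assume x: "x \<in> ?E a b"
    obtain q where "q \<in> \<rat>" "x - \<delta> / 4 < q" "q < x + \<delta> / 4"
      using Rats_dense_in_real[of "x - \<delta> / 4" "x + \<delta> / 4"] d(1) by auto
    then show "x \<in> (\<Union>q\<in>\<rat>. ?E (max a (q - \<delta> / 4)) (min b (q + \<delta> / 4)))"
      using x by (intro UN_I[of q]) auto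
  qed
  ultimately show ?thesis by (rule negligible_subset)
qed

lemma AC_differentiable_ae:
  assumes AC: "absolutely_continuous_on {a..b} F"
  shows "negligible {x \<in> {a<..<b}. \<not> F differentiable (at x)}"
proof -
  obtain B where B: "\<And>x. x \<in> {a..b} \<Longrightarrow> cmod (F x) \<le> B" using absolutely_continuous_on_bounded[OF AC] by blast
  define bad where "bad = (\<lambda>(G::real \<Rightarrow> real) n. {x \<in> {a<..<b}.
      (\<forall>y\<in>{a<..<b}. \<bar>G y - G x\<bar> \<le> real n * \<bar>x - y\<bar>) \<and> \<not> G differentiable (at x)})"
  have bad: "negligible (bad (Re \<circ> F) n)" "negligible (bad (Im \<circ> F) n)" for n
    unfolding bad_def
    by (rule differentiable_ae_where_pointwise_lipschitz[where B=B];
        use B in \<open>force intro: order_trans[OF abs_Re_le_cmod] order_trans[OF abs_Im_le_cmod]\<close>)+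
  let ?E = "{x \<in> {a<..<b}. \<forall>K. \<exists>y\<in>{a<..<b}. K * \<bar>x - y\<bar> < cmod (F y - F x)}"
  let ?N = "?E \<union> (\<Union>n. bad (Re \<circ> F) n \<union> bad (Im \<circ> F) n)"
  have "negligible ?N"
    using bad AC_pointwise_lipschitz_ae[OF AC] by (intro negligible_Un negligible_countable_Union) auto
  moreover have "{x \<in> {a<..<b}. \<not> F differentiable (at x)} \<subseteq> ?N"
  proof (rule subsetI, rule ccontr)
    fix x assume x: "x \<in> {x \<in> {a<..<b}. \<not> F differentiable (at x)}" "x \<notin> ?N"
    then obtain K where K: "\<forall>y\<in>{a<..<b}. cmod (F y - F x) \<le> K * \<bar>x - y\<bar>"
      by (auto simp: not_less)
    obtain n where n: "K \<le> real n" using real_arch_simple by blast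
    have le: "cmod (F y - F x) \<le> real n * \<bar>x - y\<bar>" if "y \<in> {a<..<b}" for y
      using bspec[OF K that] n by (meson abs_ge_zero mult_right_mono order_trans)
    have "\<bar>(Re \<circ> F) y - (Re \<circ> F) x\<bar> \<le> real n * \<bar>x - y\<bar>" "\<bar>(Im \<circ> F) y - (Im \<circ> F) x\<bar> \<le> real n * \<bar>x - y\<bar>"
      if "y \<in> {a<..<b}" for y
      using le[OF that] abs_Re_le_cmod[of "F y - F x"] abs_Im_le_cmod[of "F y - F x"] by auto
    moreover have "x \<notin> bad (Re \<circ> F) n" "x \<notin> bad (Im \<circ> F) n" "x \<in> {a<..<b}" using x by auto
    ultimately have "(Re \<circ> F) differentiable (at x)" "(Im \<circ> F) differentiable (at x)"
      unfolding bad_def by blast+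
    then obtain u v where "(Re \<circ> F has_vector_derivative u) (at x)" "(Im \<circ> F has_vector_derivative v) (at x)"
      by (metis vector_derivative_works)
    then have "((\<lambda>t. Complex ((Re \<circ> F) t) ((Im \<circ> F) t)) has_vector_derivative Complex u v) (at x)"
      by (simp add: has_vector_derivative_complex_iff has_real_derivative_iff_has_vector_derivative comp_def)
    then have "F differentiable (at x)"
      by (simp add: differentiableI_vector)
    then show False using x by simp
  qed
  ultimately show ?thesis by (rule negligible_subset)
qed

section \<open>The fundamental theorem of calculus for absolutely continuous functions\<close>

text \<open>A direct gauge argument. At a tag where \<open>F\<close> is differentiable the gauge makes the increment of \<open>F\<close>
close to \<open>f x\<close> times the length. Tags in the null set \<open>N\<close> have their intervals confined to an open
set of small measure, where absolute continuity bounds the sum of the increments.\<close>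

lemma AC_fundamental_theorem:
  assumes AC: "absolutely_continuous_on {a..b} F" and ab: "a \<le> b" and N: "negligible N"
    and deriv: "\<And>x. x \<in> {a..b} - N \<Longrightarrow> (F has_vector_derivative f x) (at x within {a..b})"
  shows "(f has_integral (F b - F a)) {a..b}"
proof -
  define g where "g = (\<lambda>x. if x \<in> N then 0 else f x)"
  have "(g has_integral (F b - F a)) {a..b}"
    unfolding has_integral_real
  proof (intro allI impI)
    fix e :: real assume e: "e > 0"
    define e1 where "e1 = e / 3 / (b - a + 1)"
    have e1: "e1 > 0" using e ab by (simp add: e1_def)
    obtain \<delta> where d: "\<delta> > 0" "variation_below {a..b} F \<delta> (e / 3)"
      by (rule absolutely_continuous_onD[OF AC, of "e/3"]) (use e in auto)
    \<comment> \<open>The intervals tagged in \<open>N\<close> will lie in \<open>U\<close>, hence have total length below \<open>\<delta>\<close>.\<close>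
    obtain U where U: "open U" "N \<subseteq> U" "U \<in> lmeasurable" "measure lebesgue U < \<delta>"
    proof -
      obtain T where T: "open T" "N \<subseteq> T" "T - N \<in> lmeasurable" "emeasure lebesgue (T - N) < ennreal \<delta>"
        by (rule sets_lebesgue_outer_open[OF negligible_imp_sets[OF N] d(1)])
      have "T = (T - N) \<union> N" using T(2) by blast
      moreover have "N \<in> null_sets lebesgue" using N negligible_iff_null_sets by blast
      ultimately have "T \<in> lmeasurable" "measure lebesgue T = measure lebesgue (T - N)"
        using T(3) N by (metis fmeasurable.Un negligible_imp_measurable, metis T(3) fmeasurableD measure_Un_null_set)
      moreover have "measure lebesgue (T - N) < \<delta>"
        using T(3,4) d(1) by (simp add: emeasure_eq_measure2 ennreal_less_iff)
      ultimately show thesis using that[of T] T by auto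
    qed
    have "\<exists>r>0. x \<in> {a..b} - N \<longrightarrow>
        (\<forall>y\<in>{a..b}. \<bar>y - x\<bar> < r \<longrightarrow> cmod (F y - F x - (y - x) *\<^sub>R f x) \<le> e1 * \<bar>y - x\<bar>)" for x
    proof (cases "x \<in> {a..b} - N")
      case True
      then show ?thesis
        using deriv[OF True] e1 unfolding has_vector_derivative_def has_derivative_within_alt by auto
    qed (auto intro: exI[of _ 1])
    then obtain r where r: "\<And>x. r x > 0"
      "\<And>x y. x \<in> {a..b} - N \<Longrightarrow> y \<in> {a..b} \<Longrightarrow> \<bar>y - x\<bar> < r x \<Longrightarrow>
        cmod (F y - F x - (y - x) *\<^sub>R f x) \<le> e1 * \<bar>y - x\<bar>"
      by metis
    define \<gamma> where "\<gamma> = (\<lambda>x. if x \<in> N then U else ball x (r x))"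
    have gauge: "gauge \<gamma>" using U r(1) by (auto simp: gauge_def \<gamma>_def)
    have fine_sum: "cmod ((\<Sum>(x, k)\<in>\<D>. measure lborel k *\<^sub>R g x) - (F b - F a)) < e"
      if tag: "\<D> tagged_division_of {a..b}" and fine: "\<gamma> fine \<D>" for \<D>
    proof -
      have fin: "finite \<D>" using tag by blast
      have itv: "\<exists>u v. k = {u..v} \<and> u \<le> x \<and> x \<le> v \<and> a \<le> u \<and> v \<le> b \<and> k \<subseteq> \<gamma> x" if xk: "(x, k) \<in> \<D>" for x k
      proof -
        obtain u v where "k = cbox u v" using tagged_division_ofD(4)[OF tag xk] by blast
        moreover have "x \<in> k" "k \<subseteq> {a..b}" using tagged_division_ofD(2,3)[OF tag xk] by auto
        moreover have "k \<subseteq> \<gamma> x" using fine xk by (auto simp: fine_def)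
        ultimately show ?thesis by (intro exI[of _ u] exI[of _ v]) auto
      qed
      define err where "err = (\<lambda>(x, k). measure lborel k *\<^sub>R g x - (F (Sup k) - F (Inf k)))"
      define p1 where "p1 = {(x, k) \<in> \<D>. x \<notin> N}"
      define p2 where "p2 = {(x, k) \<in> \<D>. x \<in> N}"
      have split: "\<D> = p1 \<union> p2" "p1 \<inter> p2 = {}" by (auto simp: p1_def p2_def)
      have fins: "finite p1" "finite p2" using fin split(1) by (metis finite_Un)+
      have "(\<Sum>(x, k)\<in>\<D>. measure lborel k *\<^sub>R g x) - (F b - F a) = sum err \<D>"
        unfolding additive_tagged_division_1[OF ab tag, of F, symmetric]
        by (simp add: err_def sum_subtractf[symmetric] case_prod_unfold)
      then have eq: "(\<Sum>(x, k)\<in>\<D>. measure lborel k *\<^sub>R g x) - (F b - F a) = sum err p1 + sum err p2"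
        using fins split by (simp add: sum.union_disjoint)
      have "cmod (sum err p1) \<le> (\<Sum>(x, k)\<in>p1. e1 * measure lborel k)"
      proof (rule sum_norm_le, clarify)
        fix x k assume xk: "(x, k) \<in> p1"
        then have xk': "(x, k) \<in> \<D>" "x \<notin> N" by (auto simp: p1_def)
        obtain u v where uv: "k = {u..v}" "u \<le> x" "x \<le> v" "a \<le> u" "v \<le> b" "k \<subseteq> \<gamma> x" using itv[OF xk'(1)] by blast
        have near: "u \<in> ball x (r x)" "v \<in> ball x (r x)" using uv xk'(2) by (auto simp: \<gamma>_def subset_eq)
        have 1: "cmod (F u - F x - (u - x) *\<^sub>R f x) \<le> e1 * \<bar>u - x\<bar>"
          using near uv xk'(2) by (intro r(2)) (auto simp: dist_real_def)
        have 2: "cmod (F v - F x - (v - x) *\<^sub>R f x) \<le> e1 * \<bar>v - x\<bar>"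
          using near uv xk'(2) by (intro r(2)) (auto simp: dist_real_def)
        have "err (x, k) = (F u - F x - (u - x) *\<^sub>R f x) - (F v - F x - (v - x) *\<^sub>R f x)"
          using uv xk'(2) by (simp add: err_def g_def algebra_simps)
        also have "cmod \<dots> \<le> e1 * \<bar>u - x\<bar> + e1 * \<bar>v - x\<bar>"
          using 1 2 norm_triangle_ineq4 by (smt (verit, best))
        also have "\<dots> = e1 * measure lborel k" using uv by (simp add: algebra_simps)
        finally show "cmod (err (x, k)) \<le> e1 * measure lborel k" .
      qed
      also have "\<dots> \<le> (\<Sum>(x, k)\<in>\<D>. e1 * measure lborel k)"
        using fin e1 split(1) by (intro sum_mono2) auto
      also have "\<dots> = e1 * (b - a)"
        using additive_content_tagged_division[of \<D> a b] tag ab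
        by (simp add: sum_distrib_left[symmetric] case_prod_unfold)
      also have "\<dots> \<le> e / 3"
        using e ab by (simp add: e1_def field_simps)
      finally have part1: "cmod (sum err p1) \<le> e / 3" .
      have p2: "\<exists>u v. k = {u..v} \<and> u \<le> v \<and> {u..v} \<subseteq> {a..b} \<inter> U" if "(x, k) \<in> p2" for x k
      proof -
        have "(x, k) \<in> \<D>" "x \<in> N" using that by (auto simp: p2_def)
        then show ?thesis using itv[of x k] by (fastforce simp: \<gamma>_def)
      qed
      have "cmod (sum err p2) \<le> (\<Sum>p\<in>p2. cmod (F (Sup (snd p)) - F (Inf (snd p))))"
        by (rule sum_norm_le) (auto simp: p2_def err_def g_def norm_minus_commute)
      also have "\<dots> < e / 3"
      proof (rule variation_below_family[OF d(2) fins(2) _ _ U(3,4)])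
        show "Inf (snd p) \<le> Sup (snd p) \<and> {Inf (snd p)..Sup (snd p)} \<subseteq> {a..b} \<inter> U" if "p \<in> p2" for p
          using p2[of "fst p" "snd p"] that by auto
        show "{Inf (snd p)<..<Sup (snd p)} \<inter> {Inf (snd p')<..<Sup (snd p')} = {}"
          if "p \<in> p2" "p' \<in> p2" "p \<noteq> p'" for p p'
        proof -
          obtain x k x' k' where pp: "p = (x, k)" "p' = (x', k')" by (metis surj_pair)
          have "interior k \<inter> interior k' = {}"
            using tagged_division_ofD(5)[OF tag, of x k x' k'] that pp by (auto simp: p2_def)
          then show ?thesis using p2[of x k] p2[of x' k'] that pp by auto
        qed
      qed
      finally have part2: "cmod (sum err p2) < e / 3" .
      show ?thesis unfolding eq using part1 part2 norm_triangle_ineq[of "sum err p1" "sum err p2"] e by linarith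
    qed
    show "\<exists>\<gamma>. gauge \<gamma> \<and> (\<forall>\<D>. \<D> tagged_division_of {a..b} \<and> \<gamma> fine \<D> \<longrightarrow>
        cmod ((\<Sum>(x, k)\<in>\<D>. measure lborel k *\<^sub>R g x) - (F b - F a)) < e)"
    proof (intro exI[of _ \<gamma>] conjI allI impI)
      fix \<D> assume "\<D> tagged_division_of {a..b} \<and> \<gamma> fine \<D>"
      then show "cmod ((\<Sum>(x, k)\<in>\<D>. measure lborel k *\<^sub>R g x) - (F b - F a)) < e"
        by (intro fine_sum) auto
    qed (rule gauge)
  qed
  then show ?thesis
    by (rule has_integral_spike[OF N, rotated]) (auto simp: g_def)
qed

text \<open>Sums, products and conjugates of absolutely continuous functions are all instances of this
estimate.\<close>

lemma absolutely_continuous_on_dominated: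
  assumes F: "absolutely_continuous_on S F" and G: "absolutely_continuous_on S G"
    and dom: "\<And>s t. s \<in> S \<Longrightarrow> t \<in> S \<Longrightarrow> cmod (H t - H s) \<le> A * cmod (F t - F s) + B * cmod (G t - G s)"
    and AB: "0 \<le> A" "0 \<le> B"
  shows "absolutely_continuous_on S H"
  unfolding absolutely_continuous_on_iff_variation_below
proof (intro allI impI)
  fix e :: real assume "e > 0"
  define e1 where "e1 = e / (A + B + 1)"
  have e1: "e1 > 0" using \<open>e > 0\<close> AB by (simp add: e1_def)
  obtain d1 where d1: "d1 > 0" "variation_below S F d1 e1"
    by (rule absolutely_continuous_onD[OF F e1])
  obtain d2 where d2: "d2 > 0" "variation_below S G d2 e1"
    by (rule absolutely_continuous_onD[OF G e1])
  have "variation_below S H (min d1 d2) e"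
    unfolding variation_below_def
  proof (intro allI impI, elim conjE)
    fix I assume I: "finite I" "\<forall>(s, t)\<in>I. s < t \<and> {s..t} \<subseteq> S" "disjoint_family_on (\<lambda>(s, t). {s<..<t}) I"
      "(\<Sum>(s, t)\<in>I. t - s) < min d1 d2"
    have 1: "(\<Sum>(s, t)\<in>I. cmod (F t - F s)) < e1" by (rule variation_belowD[OF d1(2)]) (use I in auto)
    have 2: "(\<Sum>(s, t)\<in>I. cmod (G t - G s)) < e1" by (rule variation_belowD[OF d2(2)]) (use I in auto)
    have "(\<Sum>(s, t)\<in>I. cmod (H t - H s)) \<le> (\<Sum>(s, t)\<in>I. A * cmod (F t - F s) + B * cmod (G t - G s))"
    proof (rule sum_mono, clarify)
      fix s t assume "(s, t) \<in> I"
      then have "s < t" "{s..t} \<subseteq> S" using I(2) by auto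
      then have "s \<in> S" "t \<in> S" by auto
      then show "cmod (H t - H s) \<le> A * cmod (F t - F s) + B * cmod (G t - G s)" by (rule dom)
    qed
    also have "\<dots> = A * (\<Sum>(s, t)\<in>I. cmod (F t - F s)) + B * (\<Sum>(s, t)\<in>I. cmod (G t - G s))"
      by (simp add: sum.distrib sum_distrib_left case_prod_unfold)
    also have "\<dots> \<le> A * e1 + B * e1"
      using 1 2 AB by (intro add_mono mult_left_mono) auto
    also have "\<dots> < (A + B + 1) * e1" using e1 by (simp add: algebra_simps)
    also have "\<dots> = e" using AB by (simp add: e1_def)
    finally show "(\<Sum>(s, t)\<in>I. cmod (H t - H s)) < e" .
  qed
  then show "\<exists>\<delta>>0. variation_below S H \<delta> e" using d1(1) d2(1) by (intro exI[of _ "min d1 d2"]) auto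
qed

lemma absolutely_continuous_on_lipschitz:
  assumes "\<And>s t. s \<in> S \<Longrightarrow> t \<in> S \<Longrightarrow> s \<le> t \<Longrightarrow> cmod (F t - F s) \<le> K * (t - s)"
  shows "absolutely_continuous_on S F"
  unfolding absolutely_continuous_on_iff_variation_below
proof (intro allI impI)
  fix e :: real assume "e > 0"
  have "variation_below S F (e / (\<bar>K\<bar> + 1)) e"
    unfolding variation_below_def
  proof (intro allI impI, elim conjE)
    fix I assume I: "\<forall>(s, t)\<in>I. s < t \<and> {s..t} \<subseteq> S" "(\<Sum>(s, t)\<in>I. t - s) < e / (\<bar>K\<bar> + 1)"
    have "(\<Sum>(s, t)\<in>I. cmod (F t - F s)) \<le> (\<Sum>(s, t)\<in>I. (\<bar>K\<bar> + 1) * (t - s))"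
    proof (rule sum_mono, clarify)
      fix s t assume "(s, t) \<in> I"
      then have "s < t" "{s..t} \<subseteq> S" using I(1) by auto
      then have st: "s \<in> S" "t \<in> S" "s \<le> t" by auto
      have "K * (t - s) \<le> (\<bar>K\<bar> + 1) * (t - s)" using st by (intro mult_right_mono) auto
      then show "cmod (F t - F s) \<le> (\<bar>K\<bar> + 1) * (t - s)" using assms[OF st] by linarith
    qed
    also have "\<dots> = (\<bar>K\<bar> + 1) * (\<Sum>(s, t)\<in>I. t - s)"
      by (simp add: sum_distrib_left case_prod_unfold)
    also have "\<dots> < e" using I(2) by (simp add: field_simps)
    finally show "(\<Sum>(s, t)\<in>I. cmod (F t - F s)) < e" .
  qed
  then show "\<exists>\<delta>>0. variation_below S F \<delta> e" using \<open>e > 0\<close> by (intro exI[of _ "e / (\<bar>K\<bar> + 1)"]) auto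
qed

lemma AC_add:
  assumes "absolutely_continuous_on S F" "absolutely_continuous_on S G"
  shows "absolutely_continuous_on S (\<lambda>x. F x + G x)"
proof (rule absolutely_continuous_on_dominated[OF assms, of _ 1 1])
  fix s t
  have "F t + G t - (F s + G s) = (F t - F s) + (G t - G s)" by simp
  then show "cmod (F t + G t - (F s + G s)) \<le> 1 * cmod (F t - F s) + 1 * cmod (G t - G s)"
    by (metis mult_1 norm_triangle_ineq)
qed auto

lemma AC_mult:
  assumes F: "absolutely_continuous_on {a..b} F" and G: "absolutely_continuous_on {a..b} G"
  shows "absolutely_continuous_on {a..b} (\<lambda>x. F x * G x)"
proof -
  obtain A where A: "\<And>x. x \<in> {a..b} \<Longrightarrow> cmod (F x) \<le> A" using absolutely_continuous_on_bounded[OF F] by blast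
  obtain B where B: "\<And>x. x \<in> {a..b} \<Longrightarrow> cmod (G x) \<le> B" using absolutely_continuous_on_bounded[OF G] by blast
  show ?thesis
  proof (rule absolutely_continuous_on_dominated[OF F G, of _ "\<bar>B\<bar>" "\<bar>A\<bar>"])
    fix s t assume st: "s \<in> {a..b}" "t \<in> {a..b}"
    have "F t * G t - F s * G s = (F t - F s) * G t + F s * (G t - G s)" by (simp add: algebra_simps)
    also have "cmod \<dots> \<le> cmod (F t - F s) * cmod (G t) + cmod (F s) * cmod (G t - G s)"
      by (metis norm_mult norm_triangle_ineq)
    also have "\<dots> \<le> cmod (F t - F s) * \<bar>B\<bar> + \<bar>A\<bar> * cmod (G t - G s)"
      using A[OF st(1)] B[OF st(2)] by (intro add_mono mult_left_mono mult_right_mono) auto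
    finally show "cmod (F t * G t - F s * G s) \<le> \<bar>B\<bar> * cmod (F t - F s) + \<bar>A\<bar> * cmod (G t - G s)"
      by (simp add: mult.commute)
  qed auto
qed

lemma AC_const: "absolutely_continuous_on S (\<lambda>x. c)"
  by (rule absolutely_continuous_on_lipschitz[where K=0]) auto

lemma AC_cnj:
  assumes "absolutely_continuous_on S F"
  shows "absolutely_continuous_on S (\<lambda>x. cnj (F x))"
  by (rule absolutely_continuous_on_dominated[OF assms assms, of _ 1 0])
     (auto simp flip: complex_cnj_diff)

lemma AC_cong:
  assumes "absolutely_continuous_on S F" "\<And>x. x \<in> S \<Longrightarrow> F x = G x"
  shows "absolutely_continuous_on S G"
  by (rule absolutely_continuous_on_dominated[OF assms(1,1), of _ 1 0]) (auto simp: assms(2))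

lemma AC_C1:
  assumes "\<And>x. (e has_real_derivative e' x) (at x)" "continuous_on UNIV e'"
  shows "absolutely_continuous_on {a..b} (\<lambda>x. complex_of_real (e x))"
proof -
  have "bounded (e' ` {a..b})"
    using assms(2) by (meson compact_Icc compact_continuous_image compact_imp_bounded continuous_on_subset subset_UNIV)
  then obtain K where K: "\<And>x. x \<in> {a..b} \<Longrightarrow> \<bar>e' x\<bar> \<le> K" unfolding bounded_iff real_norm_def by blast
  show ?thesis
  proof (rule absolutely_continuous_on_lipschitz[where K=K])
    fix s t assume st: "s \<in> {a..b}" "t \<in> {a..b}" "s \<le> t"
    have "norm (e t - e s) \<le> K * norm (t - s)"
      by (rule field_differentiable_bound[of "{a..b}" e e'])
         (use K st assms(1) in \<open>auto intro: has_field_derivative_at_within\<close>)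
    then show "cmod (complex_of_real (e t) - complex_of_real (e s)) \<le> K * (t - s)"
      using st by (simp flip: of_real_diff)
  qed
qed

section \<open>The differential expression on the half-line\<close>

abbreviation halfline :: "real \<Rightarrow> real measure" where
  "halfline ell \<equiv> lebesgue_on {ell..}"

abbreviation eigen_eq :: "real \<Rightarrow> (real \<Rightarrow> real) \<Rightarrow> complex \<Rightarrow> (real \<Rightarrow> complex) \<Rightarrow> bool" where
  "eigen_eq ell q z u \<equiv> AE x in halfline ell. lexpr ell q u x = z * u x"

abbreviation op_form :: "real \<Rightarrow> (real \<Rightarrow> real) \<Rightarrow> (real \<Rightarrow> complex) \<Rightarrow> (real \<Rightarrow> complex) \<Rightarrow> complex" where
  "op_form ell q f g \<equiv> l2_inner ell (lexpr ell q f) g"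

lemma at_within_atLeast_neq_bot: "ell \<le> x \<Longrightarrow> at x within {ell..} \<noteq> (bot :: real filter)"
proof -
  assume "ell \<le> x"
  have "at x within {x<..} \<le> at x within {ell..}"
    using \<open>ell \<le> x\<close> by (intro at_le) auto
  then show ?thesis using trivial_limit_at_right_real[of x] by (auto simp: bot.extremum_unique)
qed

lemma AE_halfline_iff:
  fixes ell :: real
  shows
  "(AE x in halfline ell. P x) \<longleftrightarrow> (\<exists>N. negligible N \<and> (\<forall>x\<ge>ell. x \<notin> N \<longrightarrow> P x))"
proof -
  have "(AE x in halfline ell. P x) \<longleftrightarrow> (AE x in lebesgue. x \<in> {ell..} \<longrightarrow> P x)"
    by (rule AE_restrict_space_iff) auto
  also have "\<dots> \<longleftrightarrow> (\<exists>N. negligible N \<and> (\<forall>x\<ge>ell. x \<notin> N \<longrightarrow> P x))"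
  proof
    assume "AE x in lebesgue. x \<in> {ell..} \<longrightarrow> P x"
    then obtain N where "{x \<in> space lebesgue. \<not> (x \<in> {ell..} \<longrightarrow> P x)} \<subseteq> N" "N \<in> null_sets lebesgue"
      by (auto elim!: AE_E simp: null_sets_def)
    then show "\<exists>N. negligible N \<and> (\<forall>x\<ge>ell. x \<notin> N \<longrightarrow> P x)"
      by (intro exI[of _ N]) (auto simp: negligible_iff_null_sets)
  next
    assume "\<exists>N. negligible N \<and> (\<forall>x\<ge>ell. x \<notin> N \<longrightarrow> P x)"
    then obtain N where "N \<in> null_sets lebesgue" "\<forall>x\<ge>ell. x \<notin> N \<longrightarrow> P x"
      by (auto simp: negligible_iff_null_sets)
    then show "AE x in lebesgue. x \<in> {ell..} \<longrightarrow> P x" by (intro AE_I'[of N]) auto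
  qed
  finally show ?thesis .
qed

lemma AE_halflineI:
  fixes ell :: real
  shows
  "negligible N \<Longrightarrow> (\<And>x. ell \<le> x \<Longrightarrow> x \<notin> N \<Longrightarrow> P x) \<Longrightarrow> AE x in halfline ell. P x"
  by (auto simp: AE_halfline_iff)

lemma AE_halfline_space: "AE x in halfline ell. ell \<le> x" for ell :: real
  by (rule AE_halflineI[of "{}"]) auto

text \<open>Completeness of Lebesgue measure. It is what allows \<open>lexpr\<close> to be computed only almost everywhere.\<close>

lemma borel_measurable_halfline_cong_AE:
  fixes f g :: "real \<Rightarrow> complex"
  assumes f: "f \<in> borel_measurable (halfline ell)" and eq: "AE x in halfline ell. f x = g x"
  shows "g \<in> borel_measurable (halfline ell)"
proof -
  obtain N where N: "negligible N" "\<And>x. ell \<le> x \<Longrightarrow> x \<notin> N \<Longrightarrow> f x = g x"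
    using eq by (auto simp: AE_halfline_iff)
  show ?thesis
  proof (rule measurableI)
    fix A :: "complex set" assume "A \<in> sets borel"
    then have "f -` A \<inter> space (halfline ell) \<in> sets (halfline ell)"
      using f by (rule measurable_sets[rotated])
    then have "f -` A \<inter> {ell..} \<in> sets lebesgue" by (simp add: sets_restrict_space_iff)
    moreover have "g -` A \<inter> {ell..} = (f -` A \<inter> {ell..} - N) \<union> (g -` A \<inter> {ell..} \<inter> N)"
      using N(2) by auto
    moreover have "g -` A \<inter> {ell..} \<inter> N \<in> sets lebesgue"
      by (rule negligible_imp_sets, rule negligible_subset[OF N(1)]) auto
    ultimately have "g -` A \<inter> {ell..} \<in> sets lebesgue"
      using negligible_imp_sets[OF N(1)] by (metis sets.Diff sets.Un)
    then show "g -` A \<inter> space (halfline ell) \<in> sets (halfline ell)"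
      by (simp add: sets_restrict_space_iff)
  qed simp
qed

lemma locally_AC_continuous_on:
  assumes "locally_AC ell f"
  shows "continuous_on {ell..} f"
  unfolding continuous_on_eq_continuous_within
proof
  fix x assume x: "x \<in> {ell..}"
  have "continuous_on {ell..x + 1} f"
    using assms x by (intro absolutely_continuous_on_imp_continuous_on) (auto simp: locally_AC_def)
  then have "continuous (at x within {ell..x + 1}) f"
    using x by (auto simp: continuous_on_eq_continuous_within)
  moreover have "at x within {ell..x + 1} = at x within {ell..}"
    using x by (intro at_within_nhd[of x "{..<x + 1}"]) auto
  ultimately show "continuous (at x within {ell..}) f" by simp
qed

lemma locally_AC_differentiable_ae:
  assumes "locally_AC ell f"
  obtains N where "negligible N" "\<And>x. ell \<le> x \<Longrightarrow> x \<notin> N \<Longrightarrow> f differentiable (at x within {ell..})"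
proof
  let ?N = "{ell} \<union> (\<Union>n::nat. {x \<in> {ell<..<ell + real n}. \<not> f differentiable (at x)})"
  have "negligible {x \<in> {ell<..<ell + real n}. \<not> f differentiable (at x)}" for n
    using assms by (intro AC_differentiable_ae) (simp add: locally_AC_def)
  then show "negligible ?N"
    by (intro negligible_Un negligible_countable_Union) auto
  fix x assume x: "ell \<le> x" "x \<notin> ?N"
  obtain n :: nat where "x - ell < real n" using reals_Archimedean2 by blast
  then have "f differentiable (at x)" using x by (cases "x = ell") (auto dest: spec[of _ n])
  then show "f differentiable (at x within {ell..})" by (rule differentiable_at_withinI)
qed

lemma AC_with_deriv_continuous: "AC_with_deriv ell y \<Longrightarrow> continuous_on {ell..} y"
  "AC_with_deriv ell y \<Longrightarrow> continuous_on {ell..} (hderiv ell y)"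
  by (auto simp: AC_with_deriv_def intro: locally_AC_continuous_on)

lemma hderiv_eqI:
  "ell \<le> x \<Longrightarrow> (y has_vector_derivative d) (at x within {ell..}) \<Longrightarrow> hderiv ell y x = d"
  unfolding hderiv_def using at_within_atLeast_neq_bot by (intro vector_derivative_within) auto

lemma AC_with_deriv_has_deriv:
  "AC_with_deriv ell y \<Longrightarrow> ell \<le> x \<Longrightarrow> (y has_vector_derivative hderiv ell y x) (at x within {ell..})"
  unfolding AC_with_deriv_def hderiv_def by (simp add: vector_derivative_works[symmetric])

text \<open>Without differentiability almost everywhere, \<open>hderiv ell (hderiv ell y)\<close> would be an arbitrary
value on a set of positive measure, and \<open>lexpr\<close> would carry no information about \<open>y\<close>.\<close>

lemma AC_with_deriv_has_second_deriv:
  assumes "AC_with_deriv ell y"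
  shows "AE x in halfline ell. ell \<le> x \<and>
    (hderiv ell y has_vector_derivative hderiv ell (hderiv ell y) x) (at x within {ell..})"
proof -
  obtain N where "negligible N" "\<And>x. ell \<le> x \<Longrightarrow> x \<notin> N \<Longrightarrow> hderiv ell y differentiable (at x within {ell..})"
    using assms unfolding AC_with_deriv_def by (metis locally_AC_differentiable_ae)
  then show ?thesis
    by (intro AE_halflineI[of N]) (auto simp: hderiv_def[of ell "hderiv ell y"] vector_derivative_works[symmetric])
qed

lemma AC_with_derivI:
  assumes y: "locally_AC ell y" and y1: "locally_AC ell y1"
    and d1: "\<And>x. ell \<le> x \<Longrightarrow> (y has_vector_derivative y1 x) (at x within {ell..})"
  shows "AC_with_deriv ell y" and "\<And>x. ell \<le> x \<Longrightarrow> hderiv ell y x = y1 x"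
    and "\<And>x d. ell \<le> x \<Longrightarrow> (y1 has_vector_derivative d) (at x within {ell..}) \<Longrightarrow> hderiv ell (hderiv ell y) x = d"
proof -
  show eq: "hderiv ell y x = y1 x" if "ell \<le> x" for x
    using hderiv_eqI[OF that d1[OF that]] .
  show "AC_with_deriv ell y"
    unfolding AC_with_deriv_def
  proof (intro conjI allI impI y)
    show "y differentiable (at x within {ell..})" if "ell \<le> x" for x
      using d1[OF that] by (rule differentiableI_vector)
    show "locally_AC ell (hderiv ell y)"
      unfolding locally_AC_def
    proof (intro allI impI)
      fix b assume "ell \<le> b"
      show "absolutely_continuous_on {ell..b} (hderiv ell y)"
        by (rule AC_cong[of _ y1]) (use y1 \<open>ell \<le> b\<close> eq in \<open>auto simp: locally_AC_def\<close>)
    qed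
  qed
  show "hderiv ell (hderiv ell y) x = d" if x: "ell \<le> x" and d: "(y1 has_vector_derivative d) (at x within {ell..})" for x d
  proof (rule hderiv_eqI[OF x])
    show "(hderiv ell y has_vector_derivative d) (at x within {ell..})"
      using x eq by (intro has_vector_derivative_transform[OF _ _ d]) auto
  qed
qed

lemma AC_with_deriv_cong:
  assumes "AC_with_deriv ell u" "\<And>x. ell \<le> x \<Longrightarrow> u x = y x"
  shows "AC_with_deriv ell y" "\<And>x. ell \<le> x \<Longrightarrow> hderiv ell y x = hderiv ell u x"
    "AE x in halfline ell. lexpr ell q y x = lexpr ell q u x"
proof -
  have y: "locally_AC ell y"
    using assms by (auto simp: AC_with_deriv_def locally_AC_def intro!: AC_cong[of _ u y])
  have u1: "locally_AC ell (hderiv ell u)" using assms(1) by (simp add: AC_with_deriv_def)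
  have d: "(y has_vector_derivative hderiv ell u x) (at x within {ell..})" if "ell \<le> x" for x
    using assms that by (intro has_vector_derivative_transform[OF _ _ AC_with_deriv_has_deriv[OF assms(1) that]]) auto
  note R = AC_with_derivI[OF y u1 d]
  show "AC_with_deriv ell y" "\<And>x. ell \<le> x \<Longrightarrow> hderiv ell y x = hderiv ell u x"
    using R(1,2) by auto
  show "AE x in halfline ell. lexpr ell q y x = lexpr ell q u x"
    using AC_with_deriv_has_second_deriv[OF assms(1)] by eventually_elim (simp add: lexpr_def R(3) assms(2))
qed

lemma AC_with_deriv_add:
  assumes u: "AC_with_deriv ell u" and v: "AC_with_deriv ell v"
  shows "AC_with_deriv ell (u + v)" "\<And>x. ell \<le> x \<Longrightarrow> hderiv ell (u + v) x = hderiv ell u x + hderiv ell v x"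
    "AE x in halfline ell. lexpr ell q (u + v) x = lexpr ell q u x + lexpr ell q v x"
proof -
  have uv: "locally_AC ell (u + v)" "locally_AC ell (\<lambda>x. hderiv ell u x + hderiv ell v x)"
    using u v by (auto simp: AC_with_deriv_def locally_AC_def plus_fun_def intro!: AC_add)
  have d: "((u + v) has_vector_derivative hderiv ell u x + hderiv ell v x) (at x within {ell..})" if "ell \<le> x" for x
    unfolding plus_fun_def using AC_with_deriv_has_deriv[OF u that] AC_with_deriv_has_deriv[OF v that]
    by (rule has_vector_derivative_add)
  note R = AC_with_derivI[OF uv d]
  show "AC_with_deriv ell (u + v)" "\<And>x. ell \<le> x \<Longrightarrow> hderiv ell (u + v) x = hderiv ell u x + hderiv ell v x"
    using R(1,2) by auto
  show "AE x in halfline ell. lexpr ell q (u + v) x = lexpr ell q u x + lexpr ell q v x"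
    using AC_with_deriv_has_second_deriv[OF u] AC_with_deriv_has_second_deriv[OF v]
  proof eventually_elim
    case (elim x)
    then have "hderiv ell (hderiv ell (u + v)) x = hderiv ell (hderiv ell u) x + hderiv ell (hderiv ell v) x"
      by (intro R(3) has_vector_derivative_add) auto
    then show ?case by (simp add: lexpr_def algebra_simps)
  qed
qed

lemma AC_with_deriv_scale:
  assumes u: "AC_with_deriv ell u"
  shows "AC_with_deriv ell (cscale c u)" "\<And>x. ell \<le> x \<Longrightarrow> hderiv ell (cscale c u) x = c * hderiv ell u x"
    "AE x in halfline ell. lexpr ell q (cscale c u) x = c * lexpr ell q u x"
proof -
  have uv: "locally_AC ell (cscale c u)" "locally_AC ell (\<lambda>x. c * hderiv ell u x)"
    using u by (auto simp: AC_with_deriv_def locally_AC_def cscale_def intro!: AC_mult AC_const)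
  have d: "(cscale c u has_vector_derivative c * hderiv ell u x) (at x within {ell..})" if "ell \<le> x" for x
    unfolding cscale_def using AC_with_deriv_has_deriv[OF u that] by (rule has_vector_derivative_mult_right)
  note R = AC_with_derivI[OF uv d]
  show "AC_with_deriv ell (cscale c u)" "\<And>x. ell \<le> x \<Longrightarrow> hderiv ell (cscale c u) x = c * hderiv ell u x"
    using R(1,2) by auto
  show "AE x in halfline ell. lexpr ell q (cscale c u) x = c * lexpr ell q u x"
    using AC_with_deriv_has_second_deriv[OF u]
  proof eventually_elim
    case (elim x)
    then have "hderiv ell (hderiv ell (cscale c u)) x = c * hderiv ell (hderiv ell u) x"
      by (intro R(3) has_vector_derivative_mult_right) auto
    then show ?case by (simp add: lexpr_def cscale_def algebra_simps)
  qed
qed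

lemma AC_with_deriv_cnj:
  assumes u: "AC_with_deriv ell u"
  shows "AC_with_deriv ell (\<lambda>x. cnj (u x))" "\<And>x. ell \<le> x \<Longrightarrow> hderiv ell (\<lambda>x. cnj (u x)) x = cnj (hderiv ell u x)"
    "AE x in halfline ell. lexpr ell q (\<lambda>x. cnj (u x)) x = cnj (lexpr ell q u x)"
proof -
  have uv: "locally_AC ell (\<lambda>x. cnj (u x))" "locally_AC ell (\<lambda>x. cnj (hderiv ell u x))"
    using u by (auto simp: AC_with_deriv_def locally_AC_def intro!: AC_cnj)
  have d: "((\<lambda>x. cnj (u x)) has_vector_derivative cnj (hderiv ell u x)) (at x within {ell..})" if "ell \<le> x" for x
    using AC_with_deriv_has_deriv[OF u that] by (rule has_vector_derivative_cnj)
  note R = AC_with_derivI[OF uv d]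
  show "AC_with_deriv ell (\<lambda>x. cnj (u x))" "\<And>x. ell \<le> x \<Longrightarrow> hderiv ell (\<lambda>x. cnj (u x)) x = cnj (hderiv ell u x)"
    using R(1,2) by auto
  show "AE x in halfline ell. lexpr ell q (\<lambda>x. cnj (u x)) x = cnj (lexpr ell q u x)"
    using AC_with_deriv_has_second_deriv[OF u]
  proof eventually_elim
    case (elim x)
    then have "hderiv ell (hderiv ell (\<lambda>x. cnj (u x))) x = cnj (hderiv ell (hderiv ell u) x)"
      by (intro R(3) has_vector_derivative_cnj) auto
    then show ?case by (simp add: lexpr_def)
  qed
qed

text \<open>Since \<open>q\<close> is only locally integrable, a smooth function need not lie in the domain of the
operator. A solution times a smooth cutoff does, because \<open>q\<close> enters only through \<open>lexpr ell q u\<close>;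
all test functions below are of this kind.\<close>

lemma AC_with_deriv_mult_C2:
  assumes u: "AC_with_deriv ell u"
    and e: "\<And>x. (e has_real_derivative e1 x) (at x)" "\<And>x. (e1 has_real_derivative e2 x) (at x)" "continuous_on UNIV e2"
  shows "AC_with_deriv ell (\<lambda>x. of_real (e x) * u x)"
    "\<And>x. ell \<le> x \<Longrightarrow> hderiv ell (\<lambda>x. of_real (e x) * u x) x = of_real (e1 x) * u x + of_real (e x) * hderiv ell u x"
    "AE x in halfline ell. lexpr ell q (\<lambda>x. of_real (e x) * u x) x =
       of_real (e x) * lexpr ell q u x - 2 * of_real (e1 x) * hderiv ell u x - of_real (e2 x) * u x"
proof -
  have cont1: "continuous_on UNIV e1"
    using e(2) by (meson DERIV_isCont continuous_at_imp_continuous_on)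
  have AC: "absolutely_continuous_on {a..b} (\<lambda>x. complex_of_real (e x))"
      "absolutely_continuous_on {a..b} (\<lambda>x. complex_of_real (e1 x))" for a b
    using AC_C1[OF e(1) cont1] AC_C1[OF e(2,3)] by auto
  have uv: "locally_AC ell (\<lambda>x. of_real (e x) * u x)"
    "locally_AC ell (\<lambda>x. of_real (e1 x) * u x + of_real (e x) * hderiv ell u x)"
    using u by (auto simp: AC_with_deriv_def locally_AC_def intro!: AC_add AC_mult AC)
  have c: "((\<lambda>x. complex_of_real (e x)) has_vector_derivative complex_of_real (e1 x)) (at x within S)"
      "((\<lambda>x. complex_of_real (e1 x)) has_vector_derivative complex_of_real (e2 x)) (at x within S)" for x S
    using e(1,2)[of x]
    by (auto intro!: has_vector_derivative_of_real
        intro: has_vector_derivative_at_within simp: has_real_derivative_iff_has_vector_derivative)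
  have d: "((\<lambda>x. of_real (e x) * u x) has_vector_derivative (of_real (e1 x) * u x + of_real (e x) * hderiv ell u x)) (at x within {ell..})"
    if "ell \<le> x" for x
    using has_vector_derivative_mult[OF c(1) AC_with_deriv_has_deriv[OF u that]] by (simp add: algebra_simps)
  note R = AC_with_derivI[OF uv d]
  show "AC_with_deriv ell (\<lambda>x. of_real (e x) * u x)"
    "\<And>x. ell \<le> x \<Longrightarrow> hderiv ell (\<lambda>x. of_real (e x) * u x) x = of_real (e1 x) * u x + of_real (e x) * hderiv ell u x"
    using R(1,2) by auto
  show "AE x in halfline ell. lexpr ell q (\<lambda>x. of_real (e x) * u x) x =
       of_real (e x) * lexpr ell q u x - 2 * of_real (e1 x) * hderiv ell u x - of_real (e2 x) * u x"
    using AC_with_deriv_has_second_deriv[OF u]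
  proof eventually_elim
    case (elim x)
    then have "hderiv ell (hderiv ell (\<lambda>x. of_real (e x) * u x)) x =
      (of_real (e1 x) * hderiv ell u x + of_real (e2 x) * u x)
      + (complex_of_real (e x) * hderiv ell (hderiv ell u) x + of_real (e1 x) * hderiv ell u x)"
      using AC_with_deriv_has_deriv[OF u] by (intro R(3) has_vector_derivative_add has_vector_derivative_mult c) auto
    then show ?case by (simp add: lexpr_def algebra_simps)
  qed
qed

text \<open>The integrand is the derivative of \<open>u v' - u' v\<close>, in which \<open>q\<close> cancels. Neither function is
conjugated, so that the same identity serves Wronskians and, with \<open>v\<close> replaced by a conjugate,
inner products.\<close>

lemma lagrange_identity:
  assumes u: "AC_with_deriv ell u" and v: "AC_with_deriv ell v" and b: "ell \<le> b"
  shows "((\<lambda>x. lexpr ell q u x * v x - u x * lexpr ell q v x) has_integral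
     ((hderiv ell u ell * v ell - u ell * hderiv ell v ell) - (hderiv ell u b * v b - u b * hderiv ell v b))) {ell..b}"
proof -
  let ?W = "\<lambda>x. u x * hderiv ell v x + (- 1) * (hderiv ell u x * v x)"
  obtain N where N: "negligible N" "\<And>x. ell \<le> x \<Longrightarrow> x \<notin> N \<Longrightarrow>
    (hderiv ell u has_vector_derivative hderiv ell (hderiv ell u) x) (at x within {ell..}) \<and>
    (hderiv ell v has_vector_derivative hderiv ell (hderiv ell v) x) (at x within {ell..})"
    using AC_with_deriv_has_second_deriv[OF u] AC_with_deriv_has_second_deriv[OF v]
    unfolding AE_halfline_iff by (metis Un_iff negligible_Un)
  have "absolutely_continuous_on {ell..b} ?W"
    using u v b by (intro AC_add AC_mult AC_const) (simp_all add: AC_with_deriv_def locally_AC_def)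
  then have "((\<lambda>x. lexpr ell q u x * v x - u x * lexpr ell q v x) has_integral (?W b - ?W ell)) {ell..b}"
  proof (rule AC_fundamental_theorem[OF _ b N(1)])
    fix x assume x: "x \<in> {ell..b} - N"
    then have "(?W has_vector_derivative (u x * hderiv ell (hderiv ell v) x + hderiv ell u x * hderiv ell v x)
        + (- 1) * (hderiv ell u x * hderiv ell v x + hderiv ell (hderiv ell u) x * v x)) (at x within {ell..})"
      using N(2)[of x] AC_with_deriv_has_deriv[OF u, of x] AC_with_deriv_has_deriv[OF v, of x]
      by (intro has_vector_derivative_add has_vector_derivative_mult has_vector_derivative_mult_right) auto
    also have "(u x * hderiv ell (hderiv ell v) x + hderiv ell u x * hderiv ell v x)
        + (- 1) * (hderiv ell u x * hderiv ell v x + hderiv ell (hderiv ell u) x * v x)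
        = lexpr ell q u x * v x - u x * lexpr ell q v x"
      by (simp add: lexpr_def algebra_simps)
    finally show "(?W has_vector_derivative lexpr ell q u x * v x - u x * lexpr ell q v x) (at x within {ell..b})"
      by (rule has_vector_derivative_within_subset) auto
  qed
  then show ?thesis by (simp add: algebra_simps)
qed

lemma wronskian_constant:
  assumes u: "AC_with_deriv ell u" "eigen_eq ell q z u"
    and v: "AC_with_deriv ell v" "eigen_eq ell q z v"
    and b: "ell \<le> b"
  shows "hderiv ell u b * v b - u b * hderiv ell v b = hderiv ell u ell * v ell - u ell * hderiv ell v ell"
proof -
  have "AE x in halfline ell. lexpr ell q u x * v x - u x * lexpr ell q v x = 0"
    using u(2) v(2) by eventually_elim simp
  then obtain N where N: "negligible N" "\<And>x. ell \<le> x \<Longrightarrow> x \<notin> N \<Longrightarrow> lexpr ell q u x * v x - u x * lexpr ell q v x = 0"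
    unfolding AE_halfline_iff by blast
  have "((\<lambda>x. 0) has_integral ((hderiv ell u ell * v ell - u ell * hderiv ell v ell) - (hderiv ell u b * v b - u b * hderiv ell v b))) {ell..b}"
    by (rule has_integral_spike[OF N(1) _ lagrange_identity[OF u(1) v(1) b, of q]]) (use N(2) in auto)
  then show ?thesis using has_integral_unique[OF has_integral_0] by fastforce
qed

section \<open>Square integrable functions and the maximal domain\<close>

lemma L2_measurable: "f \<in> L2 ell \<Longrightarrow> f \<in> borel_measurable (halfline ell)"
  by (simp add: L2_def)

lemma L2_square_integrable: "f \<in> L2 ell \<Longrightarrow> integrable (halfline ell) (\<lambda>x. (cmod (f x))\<^sup>2)"
  by (simp add: L2_def)

lemma L2_dominated:
  assumes "g \<in> borel_measurable (halfline ell)" "f1 \<in> L2 ell" "f2 \<in> L2 ell"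
    and "AE x in halfline ell. cmod (g x) \<le> A * cmod (f1 x) + A * cmod (f2 x)"
  shows "g \<in> L2 ell"
proof -
  have "integrable (halfline ell) (\<lambda>x. (cmod (g x))\<^sup>2)"
  proof (rule Bochner_Integration.integrable_bound)
    show "integrable (halfline ell) (\<lambda>x. 2 * A\<^sup>2 * (cmod (f1 x))\<^sup>2 + 2 * A\<^sup>2 * (cmod (f2 x))\<^sup>2)"
      using assms(2,3) by (auto simp: L2_def)
    show "AE x in halfline ell. norm ((cmod (g x))\<^sup>2) \<le> norm (2 * A\<^sup>2 * (cmod (f1 x))\<^sup>2 + 2 * A\<^sup>2 * (cmod (f2 x))\<^sup>2)"
      using assms(4)
    proof eventually_elim
      case (elim x)
      let ?a = "A * cmod (f1 x)" and ?b = "A * cmod (f2 x)"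
      have "(cmod (g x))\<^sup>2 \<le> (?a + ?b)\<^sup>2" using elim by (intro power_mono) auto
      also have "\<dots> \<le> 2 * ?a\<^sup>2 + 2 * ?b\<^sup>2" using sum_squares_bound[of ?a ?b] by (simp add: power2_sum)
      finally show ?case by (simp add: power_mult_distrib)
    qed
  qed (use assms(1) in measurable)
  then show ?thesis using assms(1) by (simp add: L2_def)
qed

lemma L2_cong_AE:
  assumes f: "f \<in> L2 ell" and eq: "AE x in halfline ell. f x = g x"
  shows "g \<in> L2 ell"
  by (rule L2_dominated[OF borel_measurable_halfline_cong_AE[OF L2_measurable[OF f] eq] f f, of 1])
     (use eq in eventually_elim, simp)

lemma L2_add: "f \<in> L2 ell \<Longrightarrow> g \<in> L2 ell \<Longrightarrow> (\<lambda>x. f x + g x) \<in> L2 ell"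
  by (rule L2_dominated[of _ _ f g 1])
     (auto simp: L2_def norm_triangle_ineq intro!: borel_measurable_add)

lemma L2_scale: "f \<in> L2 ell \<Longrightarrow> (\<lambda>x. c * f x) \<in> L2 ell"
  by (rule L2_dominated[of _ _ f f "cmod c"])
     (auto simp: L2_def norm_mult intro!: borel_measurable_times)

lemma L2_cnj: "f \<in> L2 ell \<Longrightarrow> (\<lambda>x. cnj (f x)) \<in> L2 ell"
proof -
  have "cnj \<in> borel_measurable borel" by (intro borel_measurable_continuous_onI continuous_intros)
  then show "f \<in> L2 ell \<Longrightarrow> (\<lambda>x. cnj (f x)) \<in> L2 ell"
    by (auto simp: L2_def intro: measurable_compose)
qed

lemma L2_diff: "f \<in> L2 ell \<Longrightarrow> g \<in> L2 ell \<Longrightarrow> (\<lambda>x. f x - g x) \<in> L2 ell"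
  using L2_add[of f ell "\<lambda>x. (- 1) * g x"] L2_scale[of g ell "- 1"] by simp

lemma L2_mult_integrable:
  assumes "f \<in> L2 ell" "g \<in> L2 ell"
  shows "integrable (halfline ell) (\<lambda>x. f x * g x)"
proof (rule Bochner_Integration.integrable_bound)
  show "integrable (halfline ell) (\<lambda>x. (cmod (f x))\<^sup>2 + (cmod (g x))\<^sup>2)"
    using assms by (auto simp: L2_def)
  show "AE x in halfline ell. norm (f x * g x) \<le> norm ((cmod (f x))\<^sup>2 + (cmod (g x))\<^sup>2)"
  proof (rule AE_I2)
    fix x
    have "cmod (f x) * cmod (g x) \<le> (cmod (f x))\<^sup>2 + (cmod (g x))\<^sup>2"
      using sum_squares_bound[of "cmod (f x)" "cmod (g x)"]
        mult_nonneg_nonneg[OF norm_ge_zero norm_ge_zero, of "f x" "g x"] by linarith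
    then show "norm (f x * g x) \<le> norm ((cmod (f x))\<^sup>2 + (cmod (g x))\<^sup>2)" by (simp add: norm_mult)
  qed
qed (use assms in \<open>auto simp: L2_def intro!: borel_measurable_times\<close>)

lemma l2_inner_integrable:
  "f \<in> L2 ell \<Longrightarrow> g \<in> L2 ell \<Longrightarrow> integrable (halfline ell) (\<lambda>x. f x * cnj (g x))"
  by (intro L2_mult_integrable L2_cnj)

lemma l2_inner_add_left:
  "f \<in> L2 ell \<Longrightarrow> g \<in> L2 ell \<Longrightarrow> k \<in> L2 ell \<Longrightarrow>
    l2_inner ell (\<lambda>x. f x + g x) k = l2_inner ell f k + l2_inner ell g k"
  by (simp add: l2_inner_def distrib_right l2_inner_integrable)

lemma l2_inner_scale_left: "l2_inner ell (\<lambda>x. c * f x) k = c * l2_inner ell f k"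
  by (simp add: l2_inner_def mult.assoc)

lemma l2_inner_cnj: "l2_inner ell g f = cnj (l2_inner ell f g)"
  unfolding l2_inner_def by (simp add: mult.commute flip: Bochner_Integration.integral_cnj)

lemma l2_inner_add_right:
  "f \<in> L2 ell \<Longrightarrow> g \<in> L2 ell \<Longrightarrow> k \<in> L2 ell \<Longrightarrow>
    l2_inner ell k (\<lambda>x. f x + g x) = l2_inner ell k f + l2_inner ell k g"
  by (subst (1 2 3) l2_inner_cnj) (simp add: l2_inner_add_left)

lemma l2_inner_scale_right: "l2_inner ell k (\<lambda>x. c * f x) = cnj c * l2_inner ell k f"
  by (subst (1 2) l2_inner_cnj) (simp add: l2_inner_scale_left)

lemma l2_inner_plus_left:
  "f \<in> L2 ell \<Longrightarrow> g \<in> L2 ell \<Longrightarrow> k \<in> L2 ell \<Longrightarrow> l2_inner ell (f + g) k = l2_inner ell f k + l2_inner ell g k"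
  by (simp add: plus_fun_def l2_inner_add_left)

lemma l2_inner_cscale_left: "l2_inner ell (cscale c f) k = c * l2_inner ell f k"
  by (simp add: cscale_def l2_inner_scale_left)

lemma l2_inner_cong_left:
  assumes "f' \<in> L2 ell" "g \<in> L2 ell" "AE x in halfline ell. f x = f' x"
  shows "l2_inner ell f g = l2_inner ell f' g"
proof -
  have "f \<in> L2 ell" by (rule L2_cong_AE[OF assms(1)]) (use assms(3) in \<open>auto elim: eventually_mono\<close>)
  then show ?thesis unfolding l2_inner_def
    using assms l2_inner_integrable[of f ell g] l2_inner_integrable[of f' ell g]
    by (intro integral_cong_AE) (auto elim: eventually_mono)
qed

lemma l2_inner_self: "f \<in> L2 ell \<Longrightarrow> l2_inner ell f f = complex_of_real (LINT x|halfline ell. (cmod (f x))\<^sup>2)"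
  unfolding l2_inner_def by (simp add: complex_norm_square[symmetric] flip: integral_complex_of_real)

lemma indicator_atMost_measurable:
  "(indicator {..b} :: real \<Rightarrow> 'a :: real_normed_algebra_1) \<in> borel_measurable (halfline ell)"
  by (intro measurable_restrict_space1 borel_measurable_indicator) simp

lemma L2_truncate:
  assumes "f \<in> L2 ell"
  shows "(\<lambda>x. indicator {..b} x * f x) \<in> L2 ell"
proof (rule L2_dominated[OF _ assms assms, of _ 1])
  show "(\<lambda>x. indicator {..b} x * f x) \<in> borel_measurable (halfline ell)"
    using L2_measurable[OF assms]
    by (intro borel_measurable_times indicator_atMost_measurable)
qed (auto simp: indicator_def)

lemma continuous_truncate_L2:
  assumes f: "continuous_on {ell..} f"
  shows "(\<lambda>x. indicator {..b} x * f x) \<in> L2 ell"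
proof -
  have m: "(\<lambda>x. indicator {..b} x * f x) \<in> borel_measurable (halfline ell)"
    using f by (intro borel_measurable_times indicator_atMost_measurable
        continuous_imp_measurable_on_sets_lebesgue) auto
  have "continuous_on {ell..b} (\<lambda>x. (cmod (f x))\<^sup>2)"
    using f by (intro continuous_intros) (auto elim: continuous_on_subset)
  then have "(\<lambda>x. (cmod (f x))\<^sup>2) absolutely_integrable_on {ell..b}"
    by (rule absolutely_integrable_continuous_real)
  then have "integrable lebesgue (\<lambda>x. indicator {ell..b} x *\<^sub>R (cmod (f x))\<^sup>2)"
    by (simp add: set_integrable_def)
  also have "(\<lambda>x. indicator {ell..b} x *\<^sub>R (cmod (f x))\<^sup>2)
      = (\<lambda>x. indicator {ell..} x *\<^sub>R (cmod (indicator {..b} x * f x))\<^sup>2)"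
    by (auto simp: indicator_def fun_eq_iff)
  finally have "integrable (halfline ell) (\<lambda>x. (cmod (indicator {..b} x * f x))\<^sup>2)"
    by (subst integrable_restrict_space) auto
  then show ?thesis using m by (simp add: L2_def)
qed

lemma L2_bounded_support:
  assumes f: "continuous_on {ell..} f" and z: "\<And>x. b \<le> x \<Longrightarrow> f x = 0"
  shows "f \<in> L2 ell"
  by (rule L2_cong_AE[OF continuous_truncate_L2[OF f, of b]]) (auto simp: indicator_def z)

lemma integrable_ext: "integrable M f \<Longrightarrow> (\<And>x. f x = g x) \<Longrightarrow> integrable M g"
  by (metis ext)

lemma truncated_square_integrable:
  assumes "(\<lambda>x. indicator {..b} x * f x) \<in> L2 ell"
  shows "integrable (halfline ell) (\<lambda>x. indicator {..b} x * (cmod (f x))\<^sup>2)"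
  using L2_square_integrable[OF assms]
  by (rule integrable_ext) (auto simp: indicator_def)

lemma has_integral_halfline_truncate:
  fixes g :: "real \<Rightarrow> 'a :: euclidean_space"
  assumes "integrable (halfline ell) (\<lambda>x. indicator {..b} x *\<^sub>R g x)" "(g has_integral I) {ell..b}"
  shows "(LINT x|halfline ell. indicator {..b} x *\<^sub>R g x) = I"
proof -
  have eq: "(\<lambda>x. indicator {ell..} x *\<^sub>R (indicator {..b} x *\<^sub>R g x)) = (\<lambda>x. indicator {ell..b} x *\<^sub>R g x)"
    by (auto simp: indicator_def fun_eq_iff)
  have "integrable lebesgue (\<lambda>x. indicator {ell..b} x *\<^sub>R g x)"
    using assms(1) unfolding eq[symmetric] by (subst (asm) integrable_restrict_space) auto
  then have "set_integrable lebesgue {ell..b} g" by (simp add: set_integrable_def)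
  then have "(LINT x:{ell..b}|lebesgue. g x) = integral {ell..b} g"
    by (rule set_lebesgue_integral_eq_integral)
  also have "(LINT x:{ell..b}|lebesgue. g x) = (LINT x|halfline ell. indicator {..b} x *\<^sub>R g x)"
    unfolding set_lebesgue_integral_def eq[symmetric] by (subst integral_restrict_space) auto
  finally show ?thesis using assms(2) by (simp add: integral_unique)
qed

lemma indicator_atMost_tendsto: "(\<lambda>n. indicator {..real n} x :: real) \<longlonglongrightarrow> 1"
proof (rule tendsto_eventually)
  show "eventually (\<lambda>n. indicator {..real n} x = (1 :: real)) sequentially"
    using eventually_ge_at_top[of "nat \<lceil>x\<rceil>"]
  proof eventually_elim
    case (elim n)
    then have "x \<le> real n" by linarith
    then show ?case by simp
  qed
qed

lemma integral_truncate_tendsto: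
  fixes g :: "real \<Rightarrow> 'a :: {banach, second_countable_topology}"
  assumes "integrable (halfline ell) g"
  shows "(\<lambda>n. LINT x|halfline ell. indicator {..real n} x *\<^sub>R g x) \<longlonglongrightarrow> (LINT x|halfline ell. g x)"
proof (rule integral_dominated_convergence[where w="\<lambda>x. norm (g x)"])
  show "(\<lambda>x. indicator {..real n} x *\<^sub>R g x) \<in> borel_measurable (halfline ell)" for n
    using assms by (intro borel_measurable_scaleR indicator_atMost_measurable) auto
  show "AE x in halfline ell. (\<lambda>n. indicator {..real n} x *\<^sub>R g x) \<longlonglongrightarrow> g x"
    using tendsto_scaleR[OF indicator_atMost_tendsto tendsto_const] by auto
qed (use assms in \<open>auto simp: indicator_def\<close>)

lemma HplusD:
  assumes "f \<in> Hplus ell q"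
  shows "AC_with_deriv ell f" "f \<in> L2 ell" "lexpr ell q f \<in> L2 ell" "\<And>x. x < ell \<Longrightarrow> f x = 0"
  using assms by (auto simp: Hplus_def)

lemma Hplus_add:
  assumes "f \<in> Hplus ell q" "g \<in> Hplus ell q"
  shows "f + g \<in> Hplus ell q"
    "AE x in halfline ell. lexpr ell q (f + g) x = lexpr ell q f x + lexpr ell q g x"
proof -
  note F = HplusD[OF assms(1)] and G = HplusD[OF assms(2)]
  note A = AC_with_deriv_add[OF F(1) G(1)]
  show "AE x in halfline ell. lexpr ell q (f + g) x = lexpr ell q f x + lexpr ell q g x" by (rule A(3))
  then have "lexpr ell q (f + g) \<in> L2 ell"
    by (intro L2_cong_AE[OF L2_add[OF F(3) G(3)]]) (auto elim: eventually_mono)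
  then show "f + g \<in> Hplus ell q"
    using A(1) F G L2_add[OF F(2) G(2)] by (auto simp: Hplus_def plus_fun_def)
qed

lemma Hplus_scale:
  assumes "f \<in> Hplus ell q"
  shows "cscale c f \<in> Hplus ell q"
    "AE x in halfline ell. lexpr ell q (cscale c f) x = c * lexpr ell q f x"
proof -
  note F = HplusD[OF assms(1)]
  note A = AC_with_deriv_scale[OF F(1), where c=c]
  show "AE x in halfline ell. lexpr ell q (cscale c f) x = c * lexpr ell q f x" by (rule A(3))
  then have "lexpr ell q (cscale c f) \<in> L2 ell"
    by (intro L2_cong_AE[OF L2_scale[OF F(3), of c]]) (auto elim: eventually_mono)
  then show "cscale c f \<in> Hplus ell q"
    using A(1) F L2_scale[OF F(2), of c] by (auto simp: Hplus_def cscale_def)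
qed

lemma Hplus_cnj:
  assumes "f \<in> Hplus ell q"
  shows "(\<lambda>x. cnj (f x)) \<in> Hplus ell q"
    "AE x in halfline ell. lexpr ell q (\<lambda>x. cnj (f x)) x = cnj (lexpr ell q f x)"
proof -
  note F = HplusD[OF assms(1)]
  note A = AC_with_deriv_cnj[OF F(1)]
  show "AE x in halfline ell. lexpr ell q (\<lambda>x. cnj (f x)) x = cnj (lexpr ell q f x)" by (rule A(3))
  then have "lexpr ell q (\<lambda>x. cnj (f x)) \<in> L2 ell"
    by (intro L2_cong_AE[OF L2_cnj[OF F(3)]]) (auto elim: eventually_mono)
  then show "(\<lambda>x. cnj (f x)) \<in> Hplus ell q"
    using A(1) F L2_cnj[OF F(2)] by (auto simp: Hplus_def)
qed

lemma Hplus_boundary: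
  assumes "f \<in> Hplus ell q" "g \<in> Hplus ell q"
  shows "hderiv ell (f + g) ell = hderiv ell f ell + hderiv ell g ell"
    "hderiv ell (cscale c f) ell = c * hderiv ell f ell"
    "(f + g) ell = f ell + g ell" "cscale c f ell = c * f ell"
  using AC_with_deriv_add(2)[OF HplusD(1)[OF assms(1)] HplusD(1)[OF assms(2)]]
    AC_with_deriv_scale(2)[OF HplusD(1)[OF assms(1)]] by (auto simp: cscale_def)

lemma l2_inner_lexpr_add:
  assumes "f \<in> Hplus ell q" "g \<in> Hplus ell q" "k \<in> L2 ell"
  shows "op_form ell q (f + g) k = op_form ell q f k + op_form ell q g k"
  using l2_inner_cong_left[OF L2_add[OF HplusD(3)[OF assms(1)] HplusD(3)[OF assms(2)]] assms(3) Hplus_add(2)[OF assms(1,2)]]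
    l2_inner_add_left[OF HplusD(3)[OF assms(1)] HplusD(3)[OF assms(2)] assms(3)] by simp

lemma l2_inner_lexpr_scale:
  assumes "f \<in> Hplus ell q" "k \<in> L2 ell"
  shows "op_form ell q (cscale c f) k = c * op_form ell q f k"
  using l2_inner_cong_left[OF L2_scale[OF HplusD(3)[OF assms(1)]] assms(2) Hplus_scale(2)[OF assms(1), of c]]
  by (simp add: l2_inner_scale_left)

lemma l2_inner_lexpr_expand:
  assumes f: "f \<in> Hplus ell q" and g: "g \<in> Hplus ell q"
  shows "op_form ell q (f + cscale c g) (f + cscale c g) =
    op_form ell q f f + cnj c * op_form ell q f g
    + c * op_form ell q g f + c * cnj c * op_form ell q g g"
proof -
  have cg: "cscale c g \<in> Hplus ell q" by (rule Hplus_scale(1)[OF g])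
  have right: "l2_inner ell k (f + cscale c g) = l2_inner ell k f + cnj c * l2_inner ell k g" if "k \<in> L2 ell" for k
    using l2_inner_add_right[OF HplusD(2)[OF f] HplusD(2)[OF cg] that]
    by (simp add: plus_fun_def cscale_def l2_inner_scale_right)
  show ?thesis
    using f g cg HplusD[OF f] HplusD[OF g] HplusD[OF Hplus_add(1)[OF f cg]]
    by (simp add: l2_inner_lexpr_add l2_inner_lexpr_scale right algebra_simps)
qed

lemma l2_inner_self_eq_0:
  assumes f: "f \<in> Hplus ell q" and z: "l2_inner ell f f = 0" and x: "ell \<le> x"
  shows "f x = 0"
proof -
  note F = HplusD[OF f]
  have i: "integrable (halfline ell) (\<lambda>x. (cmod (f x))\<^sup>2)" by (rule L2_square_integrable[OF F(2)])
  have "(LINT x|halfline ell. (cmod (f x))\<^sup>2) = 0"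
    using z l2_inner_self[OF F(2)] by simp
  then have "AE x in halfline ell. (cmod (f x))\<^sup>2 = 0"
    using integral_nonneg_eq_0_iff_AE[OF i] by simp
  then obtain N where N: "negligible N" "\<And>x. ell \<le> x \<Longrightarrow> x \<notin> N \<Longrightarrow> (cmod (f x))\<^sup>2 = 0"
    unfolding AE_halfline_iff by blast
  have "((\<lambda>x. (cmod (f x))\<^sup>2) has_integral 0) (cbox ell (x + 1))"
    by (rule has_integral_spike[OF N(1) _ has_integral_0]) (use N(2) in auto)
  moreover have "continuous_on (cbox ell (x + 1)) (\<lambda>x. (cmod (f x))\<^sup>2)"
    by (intro continuous_intros continuous_on_subset[OF AC_with_deriv_continuous(1)[OF F(1)]]) auto
  ultimately show ?thesis
    using has_integral_0_cbox_imp_0[of ell "x + 1" "\<lambda>x. (cmod (f x))\<^sup>2" x] x by simp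
qed

text \<open>The representative that \<open>Hplus\<close> requires of a function known on the half-line only.\<close>

definition zero_left :: "real \<Rightarrow> (real \<Rightarrow> complex) \<Rightarrow> real \<Rightarrow> complex" where
  "zero_left ell f x = (if x < ell then 0 else f x)"

lemma Hplus_zero_left:
  assumes f: "AC_with_deriv ell f" "f \<in> L2 ell" and lf: "AE x in halfline ell. lexpr ell q f x = g x" "g \<in> L2 ell"
  shows "zero_left ell f \<in> Hplus ell q" "\<And>x. ell \<le> x \<Longrightarrow> zero_left ell f x = f x"
    "\<And>x. ell \<le> x \<Longrightarrow> hderiv ell (zero_left ell f) x = hderiv ell f x"
    "AE x in halfline ell. lexpr ell q (zero_left ell f) x = g x"
proof -
  show val: "zero_left ell f x = f x" if "ell \<le> x" for x using that by (simp add: zero_left_def)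
  note C = AC_with_deriv_cong[OF f(1), of "zero_left ell f"]
  show "hderiv ell (zero_left ell f) x = hderiv ell f x" if "ell \<le> x" for x
    using C(2) that val by auto
  show L: "AE x in halfline ell. lexpr ell q (zero_left ell f) x = g x"
    using C(3)[of q] lf(1) val by (auto elim: eventually_elim2)
  have "zero_left ell f \<in> L2 ell"
    by (rule L2_cong_AE[OF f(2)]) (use AE_halfline_space val in \<open>auto elim!: eventually_mono\<close>)
  moreover have "lexpr ell q (zero_left ell f) \<in> L2 ell"
    by (rule L2_cong_AE[OF lf(2)]) (use L in \<open>auto elim!: eventually_mono\<close>)
  ultimately show "zero_left ell f \<in> Hplus ell q"
    using C(1) val by (auto simp: Hplus_def) (simp add: zero_left_def)
qed

text \<open>The source of all test functions: a solution of the differential equation, which is available for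
every \<open>z\<close> off \<open>[0, \<infinity>)\<close>, times a cutoff of bounded support.\<close>

lemma cutoff_in_Hplus:
  fixes e :: "real \<Rightarrow> real"
  assumes u: "AC_with_deriv ell u" "eigen_eq ell q z u"
    and e: "\<And>x. (e has_real_derivative e1 x) (at x)" "\<And>x. (e1 has_real_derivative e2 x) (at x)" "continuous_on UNIV e2"
    and supp: "\<And>x. b \<le> x \<Longrightarrow> e x = 0"
  defines "y \<equiv> zero_left ell (\<lambda>x. of_real (e x) * u x)"
  shows "y \<in> Hplus ell q" "\<And>x. ell \<le> x \<Longrightarrow> y x = of_real (e x) * u x"
    "hderiv ell y ell = of_real (e1 ell) * u ell + of_real (e ell) * hderiv ell u ell"
    "AE x in halfline ell. lexpr ell q y x = z * (of_real (e x) * u x)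
       - 2 * of_real (e1 x) * hderiv ell u x - of_real (e2 x) * u x"
proof -
  let ?v = "\<lambda>x. of_real (e x) * u x"
  let ?l = "\<lambda>x. z * (of_real (e x) * u x)
       - 2 * of_real (e1 x) * hderiv ell u x - of_real (e2 x) * u x"
  note C = AC_with_deriv_mult_C2[OF u(1) e]
  \<comment> \<open>The derivatives vanish for \<open>x > b\<close> as well; the margins \<open>1\<close> and \<open>2\<close> keep \<open>x\<close> in the interior.\<close>
  have e1: "e1 x = 0" if "b + 1 \<le> x" for x
  proof -
    have "(e has_real_derivative 0) (at x)"
      by (rule has_field_derivative_transform_within_open[of "\<lambda>x. 0" _ _ "{b<..}"]) (use supp that in auto)
    then show ?thesis using e(1) DERIV_unique by blast
  qed
  have e2: "e2 x = 0" if "b + 2 \<le> x" for x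
  proof -
    have "(e1 has_real_derivative 0) (at x)"
      by (rule has_field_derivative_transform_within_open[of "\<lambda>x. 0" _ _ "{b + 1<..}"]) (use e1 that in auto)
    then show ?thesis using e(2) DERIV_unique by blast
  qed
  have cont: "continuous_on S e" "continuous_on S e1" "continuous_on S e2" for S
    using e(1,2) continuous_on_subset[OF e(3)] by (meson DERIV_isCont continuous_at_imp_continuous_on subset_UNIV)+
  note cu = AC_with_deriv_continuous[OF u(1)]
  have v: "?v \<in> L2 ell"
    by (rule L2_bounded_support[of _ _ b]) (use supp cont cu in \<open>auto intro!: continuous_intros\<close>)
  have l: "?l \<in> L2 ell"
    by (rule L2_bounded_support[of _ _ "b + 2"]) (use supp e1 e2 cont cu in \<open>auto intro!: continuous_intros\<close>)
  have lv: "AE x in halfline ell. lexpr ell q ?v x = ?l x"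
    using C(3)[of q] u(2) by eventually_elim (simp add: algebra_simps)
  note Z = Hplus_zero_left[OF C(1) v lv l]
  show "y \<in> Hplus ell q" "\<And>x. ell \<le> x \<Longrightarrow> y x = of_real (e x) * u x"
    "AE x in halfline ell. lexpr ell q y x = ?l x"
    unfolding y_def using Z by auto
  show "hderiv ell y ell = of_real (e1 ell) * u ell + of_real (e ell) * hderiv ell u ell"
    unfolding y_def using Z(3)[of ell] C(2)[of ell] by simp
qed

section \<open>The limit-point case\<close>

text \<open>Green's formula on the maximal domain without a boundary term at infinity.\<close>

definition limit_point :: "real \<Rightarrow> (real \<Rightarrow> real) \<Rightarrow> bool" where
  "limit_point ell q \<longleftrightarrow> (\<forall>f \<in> Hplus ell q. \<forall>g \<in> Hplus ell q.
     op_form ell q f g - l2_inner ell f (lexpr ell q g)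
       = hderiv ell f ell * cnj (g ell) - f ell * cnj (hderiv ell g ell))"

lemma limit_pointD:
  assumes "limit_point ell q" "f \<in> Hplus ell q" "g \<in> Hplus ell q"
  shows "op_form ell q f g - l2_inner ell f (lexpr ell q g)
       = hderiv ell f ell * cnj (g ell) - f ell * cnj (hderiv ell g ell)"
  using assms by (auto simp: limit_point_def)

text \<open>The boundary term at infinity, up to sign: a skew-Hermitian form whose vanishing is \<open>limit_point\<close>.\<close>

definition green_defect where
  "green_defect ell q f g = op_form ell q f g - l2_inner ell f (lexpr ell q g)
       - (hderiv ell f ell * cnj (g ell) - f ell * cnj (hderiv ell g ell))"

lemma green_defect_add_left:
  assumes "f \<in> Hplus ell q" "g \<in> Hplus ell q" "k \<in> Hplus ell q"
  shows "green_defect ell q (f + g) k = green_defect ell q f k + green_defect ell q g k"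
  using assms HplusD[OF assms(1)] HplusD[OF assms(2)] HplusD[OF assms(3)]
  by (simp add: green_defect_def l2_inner_lexpr_add l2_inner_plus_left Hplus_boundary algebra_simps)

lemma green_defect_scale_left:
  assumes "f \<in> Hplus ell q" "k \<in> Hplus ell q"
  shows "green_defect ell q (cscale c f) k = c * green_defect ell q f k"
  using assms HplusD[OF assms(1)] HplusD[OF assms(2)]
  by (simp add: green_defect_def l2_inner_lexpr_scale l2_inner_cscale_left Hplus_boundary algebra_simps)

lemma green_defect_skew: "green_defect ell q g f = - cnj (green_defect ell q f g)"
  unfolding green_defect_def
  by (subst (1 2) l2_inner_cnj) simp

text \<open>Polarization of a skew-Hermitian form.\<close>

lemma limit_pointI:
  assumes "\<And>f. f \<in> Hplus ell q \<Longrightarrow> green_defect ell q f f = 0"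
  shows "limit_point ell q"
  unfolding limit_point_def
proof (intro ballI)
  fix f g assume f: "f \<in> Hplus ell q" and g: "g \<in> Hplus ell q"
  have right_add: "green_defect ell q k (u + v) = green_defect ell q k u + green_defect ell q k v"
    if "u \<in> Hplus ell q" "v \<in> Hplus ell q" "k \<in> Hplus ell q" for u v k
    using that by (subst (1 2 3) green_defect_skew) (simp add: green_defect_add_left)
  have right_scale: "green_defect ell q k (cscale c u) = cnj c * green_defect ell q k u"
    if "u \<in> Hplus ell q" "k \<in> Hplus ell q" for u k c
    using that by (subst (1 2) green_defect_skew) (simp add: green_defect_scale_left)
  have sum0: "green_defect ell q u v + green_defect ell q v u = 0"
    if u: "u \<in> Hplus ell q" and v: "v \<in> Hplus ell q" for u v
    using assms[OF Hplus_add(1)[OF u v]] assms[OF u] assms[OF v] u v Hplus_add(1)[OF u v]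
    by (simp add: green_defect_add_left right_add)
  \<comment> \<open>Replacing \<open>g\<close> by \<open>\<i> g\<close> turns the symmetric combination of the two mixed values into the antisymmetric one.\<close>
  have ig: "cscale \<i> g \<in> Hplus ell q" by (rule Hplus_scale(1)[OF g])
  have "green_defect ell q f g + green_defect ell q g f = 0" by (rule sum0[OF f g])
  moreover have "- \<i> * green_defect ell q f g + \<i> * green_defect ell q g f = 0"
    using sum0[OF f ig] f g by (simp add: right_scale green_defect_scale_left)
  then have "\<i> * (green_defect ell q g f - green_defect ell q f g) = 0" by (simp add: algebra_simps)
  then have "green_defect ell q g f = green_defect ell q f g" by simp
  ultimately have "green_defect ell q f g = 0" by simp
  then show "op_form ell q f g - l2_inner ell f (lexpr ell q g)
       = hderiv ell f ell * cnj (g ell) - f ell * cnj (hderiv ell g ell)"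
    by (simp add: green_defect_def)
qed

text \<open>Green's formula on \<open>[ell, b]\<close> for \<open>u\<close> and its conjugate, for the equation \<open>lexpr u = \<i> u + h\<close>. The
term at \<open>b\<close> is absent because \<open>u b = 0\<close>.\<close>

lemma energy_identity:
  assumes u: "AC_with_deriv ell u" and lu: "AE x in halfline ell. lexpr ell q u x = \<i> * u x + h x"
    and b: "ell \<le> b" and ub: "u b = 0"
  shows "((\<lambda>x. (cmod (u x))\<^sup>2 + Im (h x * cnj (u x))) has_integral Im (hderiv ell u ell * cnj (u ell))) {ell..b}"
proof -
  note C = AC_with_deriv_cnj[OF u]
  have AE: "AE x in halfline ell. lexpr ell q u x * cnj (u x) - u x * lexpr ell q (\<lambda>x. cnj (u x)) x
      = 2 * \<i> * complex_of_real ((cmod (u x))\<^sup>2 + Im (h x * cnj (u x)))"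
    using lu C(3)[of q]
  proof eventually_elim
    case (elim x)
    then show ?case by (simp add: complex_eq_iff cmod_power2) (simp add: power2_eq_square algebra_simps)
  qed
  then obtain N where N: "negligible N" "\<And>x. ell \<le> x \<Longrightarrow> x \<notin> N \<Longrightarrow>
      lexpr ell q u x * cnj (u x) - u x * lexpr ell q (\<lambda>x. cnj (u x)) x
      = 2 * \<i> * complex_of_real ((cmod (u x))\<^sup>2 + Im (h x * cnj (u x)))"
    unfolding AE_halfline_iff by blast
  have "((\<lambda>x. 2 * \<i> * complex_of_real ((cmod (u x))\<^sup>2 + Im (h x * cnj (u x)))) has_integral
     ((hderiv ell u ell * cnj (u ell) - u ell * hderiv ell (\<lambda>x. cnj (u x)) ell)
       - (hderiv ell u b * cnj (u b) - u b * hderiv ell (\<lambda>x. cnj (u x)) b))) {ell..b}"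
    by (rule has_integral_spike[OF N(1) _ lagrange_identity[OF u C(1) b, of q]], rule N(2)[symmetric]) auto
  also have "((hderiv ell u ell * cnj (u ell) - u ell * hderiv ell (\<lambda>x. cnj (u x)) ell)
       - (hderiv ell u b * cnj (u b) - u b * hderiv ell (\<lambda>x. cnj (u x)) b))
      = 2 * \<i> * complex_of_real (Im (hderiv ell u ell * cnj (u ell)))"
    using C(2)[of ell] ub by (simp add: complex_eq_iff)
  finally have "((\<lambda>x. Im (2 * \<i> * complex_of_real ((cmod (u x))\<^sup>2 + Im (h x * cnj (u x)))) / 2) has_integral
      Im (2 * \<i> * complex_of_real (Im (hderiv ell u ell * cnj (u ell)))) / 2) {ell..b}"
    by (intro has_integral_divide has_integral_linear[OF _ bounded_linear_Im, unfolded comp_def])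
  moreover have "Im (2 * \<i> * complex_of_real r) / 2 = r" for r by simp
  ultimately show ?thesis by (simp only:)
qed

text \<open>Otherwise \<open>\<i>\<close> would be an eigenvalue of the Dirichlet problem on \<open>[ell, b]\<close>, which is symmetric.\<close>

lemma nonreal_dirichlet_solution_nonzero:
  assumes u: "AC_with_deriv ell u" and lu: "eigen_eq ell q \<i> u"
    and u0: "u ell = 0" "hderiv ell u ell \<noteq> 0" and b: "ell < b"
  shows "u b \<noteq> 0"
proof
  assume ub: "u b = 0"
  have "((\<lambda>x. (cmod (u x))\<^sup>2) has_integral 0) (cbox ell b)"
    using energy_identity[OF u, of q "\<lambda>x. 0", OF _ less_imp_le[OF b] ub] lu u0 by simp
  moreover have "continuous_on {ell..b} (\<lambda>x. (cmod (u x))\<^sup>2)"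
    using continuous_on_subset[OF AC_with_deriv_continuous(1)[OF u], of "{ell..b}"]
    by (intro continuous_intros) auto
  ultimately have z: "u x = 0" if "x \<in> {ell..b}" for x
    using has_integral_0_cbox_imp_0[of ell b "\<lambda>x. (cmod (u x))\<^sup>2" x] that b by auto
  have "(u has_vector_derivative hderiv ell u ell) (at ell within {ell..b})"
    using AC_with_deriv_has_deriv[OF u order_refl] by (rule has_vector_derivative_within_subset) auto
  moreover have "(u has_vector_derivative 0) (at ell within {ell..b})"
    by (rule has_vector_derivative_transform[of _ _ _ "\<lambda>x. 0"]) (use z b in auto)
  ultimately have "hderiv ell u ell = 0"
    using b by (intro vector_derivative_unique_within[of ell "{ell..b}"]) (auto simp: trivial_limit_within)
  then show False using u0 by simp
qed

text \<open>Completing squares in the integrand of \<open>energy_identity\<close> for \<open>u = f + a \<phi>\<close>. The first bound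
controls the tail of the integral, the second forces the coefficient \<open>a\<close> to be small, the third is
a dominating function.\<close>

lemma energy_density_bounds:
  fixes f \<phi> h a :: complex
  defines "G \<equiv> (cmod (f + a * \<phi>))\<^sup>2 + Im (h * cnj (f + a * \<phi>))"
  shows "- (cmod h)\<^sup>2 / 4 \<le> G"
    "(cmod a)\<^sup>2 * (cmod \<phi>)\<^sup>2 / 4 - (cmod f)\<^sup>2 / 2 - (cmod h)\<^sup>2 / 2 \<le> G"
    "\<bar>G\<bar> \<le> 4 * (cmod f)\<^sup>2 + 4 * (cmod a)\<^sup>2 * (cmod \<phi>)\<^sup>2 + (cmod h)\<^sup>2"
proof -
  let ?g = "f + a * \<phi>"
  have im: "\<bar>Im (h * cnj ?g)\<bar> \<le> cmod h * cmod ?g"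
    using abs_Im_le_cmod[of "h * cnj ?g"] unfolding norm_mult complex_mod_cnj .
  have s1: "0 \<le> (cmod ?g - cmod h / 2)\<^sup>2" and s2: "0 \<le> (cmod ?g - cmod h)\<^sup>2" by simp_all
  show "- (cmod h)\<^sup>2 / 4 \<le> G"
    using im s1 unfolding G_def power2_eq_square by (simp add: algebra_simps)
  have "cmod (a * \<phi>) \<le> cmod ?g + cmod f" using norm_triangle_ineq4[of ?g f] by simp
  then have "(cmod (a * \<phi>))\<^sup>2 \<le> (cmod ?g + cmod f)\<^sup>2" by (intro power_mono) auto
  then have t1: "(cmod a)\<^sup>2 * (cmod \<phi>)\<^sup>2 \<le> 2 * (cmod ?g)\<^sup>2 + 2 * (cmod f)\<^sup>2"
    using sum_squares_bound[of "cmod ?g" "cmod f"] by (simp add: norm_mult power_mult_distrib power2_sum)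
  have "(cmod ?g)\<^sup>2 / 2 - (cmod h)\<^sup>2 / 2 \<le> G"
    using im s2 unfolding G_def power2_diff by (simp add: algebra_simps)
  then show "(cmod a)\<^sup>2 * (cmod \<phi>)\<^sup>2 / 4 - (cmod f)\<^sup>2 / 2 - (cmod h)\<^sup>2 / 2 \<le> G"
    using t1 by linarith
  have "(cmod ?g)\<^sup>2 \<le> (cmod f + cmod (a * \<phi>))\<^sup>2" by (intro power_mono norm_triangle_ineq) auto
  then have t2: "(cmod ?g)\<^sup>2 \<le> 2 * (cmod f)\<^sup>2 + 2 * ((cmod a)\<^sup>2 * (cmod \<phi>)\<^sup>2)"
    using sum_squares_bound[of "cmod f" "cmod (a * \<phi>)"] by (simp add: norm_mult power_mult_distrib power2_sum)
  have "\<bar>G\<bar> \<le> (cmod ?g)\<^sup>2 + cmod h * cmod ?g" unfolding G_def using im zero_le_power2[of "cmod ?g"] by linarith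
  also have "\<dots> \<le> 2 * (cmod ?g)\<^sup>2 + (cmod h)\<^sup>2"
    using sum_squares_bound[of "cmod h" "cmod ?g"] mult_nonneg_nonneg[OF norm_ge_zero norm_ge_zero, of h ?g] by linarith
  finally show "\<bar>G\<bar> \<le> 4 * (cmod f)\<^sup>2 + 4 * (cmod a)\<^sup>2 * (cmod \<phi>)\<^sup>2 + (cmod h)\<^sup>2" using t2 by linarith
qed

lemma not_L2_truncated_norm_unbounded:
  assumes c: "continuous_on {ell..} \<phi>" and n: "\<phi> \<notin> L2 ell"
  shows "filterlim (\<lambda>n. LINT x|halfline ell. indicator {..real n} x * (cmod (\<phi> x))\<^sup>2) at_top sequentially"
    (is "filterlim ?\<Phi> at_top sequentially")
proof -
  have int: "integrable (halfline ell) (\<lambda>x. indicator {..b} x * (cmod (\<phi> x))\<^sup>2)" for b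
    by (intro truncated_square_integrable continuous_truncate_L2 c)
  have mono: "mono ?\<Phi>"
    by (rule monoI, rule integral_mono[OF int int]) (auto simp: indicator_def)
  have "\<exists>n. Z \<le> ?\<Phi> n" for Z
  proof (rule ccontr)
    assume "\<nexists>n. Z \<le> ?\<Phi> n"
    then have "\<forall>n. ?\<Phi> n \<le> Z" by (auto simp: not_le intro: less_imp_le)
    then obtain L where L: "?\<Phi> \<longlonglongrightarrow> L" using incseq_convergent[OF mono] by blast
    have "integrable (halfline ell) (\<lambda>x. (cmod (\<phi> x))\<^sup>2)"
    proof (rule integrable_monotone_convergence[OF int _ _ L])
      show "AE x in halfline ell. mono (\<lambda>n. indicator {..real n} x * (cmod (\<phi> x))\<^sup>2)"
        by (rule AE_I2, rule monoI) (auto simp: indicator_def)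
      show "AE x in halfline ell. (\<lambda>n. indicator {..real n} x * (cmod (\<phi> x))\<^sup>2) \<longlonglongrightarrow> (cmod (\<phi> x))\<^sup>2"
        using tendsto_mult[OF indicator_atMost_tendsto tendsto_const] by auto
      have "\<phi> \<in> borel_measurable (halfline ell)"
        by (rule continuous_imp_measurable_on_sets_lebesgue[OF c]) simp
      then show "(\<lambda>x. (cmod (\<phi> x))\<^sup>2) \<in> borel_measurable (halfline ell)" by measurable
    qed
    then have "\<phi> \<in> L2 ell"
      using continuous_imp_measurable_on_sets_lebesgue[OF c] by (simp add: L2_def)
    then show False using n by simp
  qed
  then show ?thesis
    unfolding filterlim_at_top eventually_sequentially using mono by (meson monoD order_trans)
qed

text \<open>The energy identity is applied on \<open>[ell, n]\<close> to \<open>f + \<alpha> n \<phi>\<close> with \<open>\<alpha> n\<close> chosen such that the sum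
vanishes at \<open>n\<close>. The integral of \<open>|\<phi>|\<^sup>2\<close> over \<open>[ell, n]\<close> diverges, which forces \<open>\<alpha> n\<close> to tend to
\<open>0\<close>. Cutting the integral off at a fixed \<open>N\<close>, with the first bound of \<open>energy_density_bounds\<close> for
the rest, lets \<open>n\<close> and then \<open>N\<close> tend to infinity. Only an inequality survives, because the energy
of \<open>\<alpha> n \<phi>\<close> may escape to infinity.\<close>

lemma Im_form_le_boundary_term:
  assumes f: "f \<in> Hplus ell q"
    and \<phi>: "AC_with_deriv ell \<phi>" "eigen_eq ell q \<i> \<phi>"
    "\<phi> ell = 0" "hderiv ell \<phi> ell = 1" "\<phi> \<notin> L2 ell"
  shows "Im (op_form ell q f f) \<le> Im (hderiv ell f ell * cnj (f ell))"
proof -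
  note F = HplusD[OF f]
  define M where "M = halfline ell"
  define h where "h = (\<lambda>x. lexpr ell q f x - \<i> * f x)"
  let ?H = "\<lambda>x. (cmod (h x))\<^sup>2" and ?F = "\<lambda>x. (cmod (f x))\<^sup>2" and ?P = "\<lambda>x. (cmod (\<phi> x))\<^sup>2"
  have h: "h \<in> L2 ell" unfolding h_def by (intro L2_diff L2_scale F)
  have cphi: "continuous_on {ell..} \<phi>" by (rule AC_with_deriv_continuous(1)[OF \<phi>(1)])
  \<comment> \<open>The energy density of \<open>f + a \<phi>\<close>.\<close>
  define G where "G = (\<lambda>a x. (cmod (f x + a * \<phi> x))\<^sup>2 + Im (h x * cnj (f x + a * \<phi> x)))"
  define f0 f1 where "f0 = f ell" and "f1 = hderiv ell f ell"
  have G_bounds: "- ?H x / 4 \<le> G a x"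
    "(cmod a)\<^sup>2 * ?P x / 4 - ?F x / 2 - ?H x / 2 \<le> G a x"
    "\<bar>G a x\<bar> \<le> 4 * ?F x + 4 * (cmod a)\<^sup>2 * ?P x + ?H x" for a x
    unfolding G_def by (rule energy_density_bounds)+
  have phi_tr: "(\<lambda>x. indicator {..b} x * \<phi> x) \<in> L2 ell" for b
    by (rule continuous_truncate_L2[OF cphi])
  have phi_int: "integrable M (\<lambda>x. indicator {..b} x * ?P x)" for b
    unfolding M_def by (intro truncated_square_integrable phi_tr)
  have f_int: "integrable M (\<lambda>x. ?F x)" and h_int: "integrable M (\<lambda>x. ?H x)"
    using L2_square_integrable F(2) h unfolding M_def by auto
  have h_int_tr: "integrable M (\<lambda>x. indicator {..b} x * ?H x)" for b
    unfolding M_def by (intro truncated_square_integrable L2_truncate h)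
  have G_int: "integrable M (\<lambda>x. indicator {..b} x * G a x)" for a b
  proof -
    have g: "(\<lambda>x. indicator {..b} x * f x + a * (indicator {..b} x * \<phi> x)) \<in> L2 ell" (is "?g \<in> _")
      by (intro L2_add L2_truncate L2_scale phi_tr F)
    have "integrable M (\<lambda>x. (cmod (?g x))\<^sup>2 + Im (h x * cnj (?g x)))"
      using L2_square_integrable[OF g] l2_inner_integrable[OF h g] unfolding M_def
      by (intro Bochner_Integration.integrable_add integrable_Im)
    then show ?thesis
      by (rule integrable_ext) (auto simp: indicator_def G_def)
  qed
  define J where "J = (\<lambda>b a. LINT x|M. indicator {..b} x * G a x)"
  \<comment> \<open>The correction that makes \<open>f + \<alpha> n \<phi>\<close> vanish at \<open>n\<close>.\<close>
  define \<alpha> where "\<alpha> = (\<lambda>n. - f (real n) / \<phi> (real n))"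
  have big: "eventually (\<lambda>n. ell < real n) sequentially"
    using eventually_gt_at_top[of "nat \<lceil>ell\<rceil>"] by eventually_elim linarith
  have J_eq: "J (real n) (\<alpha> n) = Im ((f1 + \<alpha> n) * cnj f0)" if n: "ell < real n" for n
  proof -
    have "\<phi> (real n) \<noteq> 0"
      by (rule nonreal_dirichlet_solution_nonzero[OF \<phi>(1,2) \<phi>(3) _ n]) (simp add: \<phi>(4))
    then have z: "(f + cscale (\<alpha> n) \<phi>) (real n) = 0" by (simp add: \<alpha>_def cscale_def)
    note S = AC_with_deriv_scale[OF \<phi>(1), where c="\<alpha> n"]
    note A = AC_with_deriv_add[OF F(1) S(1)]
    have "AE x in halfline ell. lexpr ell q (f + cscale (\<alpha> n) \<phi>) x = \<i> * (f + cscale (\<alpha> n) \<phi>) x + h x"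
      using A(3)[of q] S(3)[of q] \<phi>(2) by eventually_elim (simp add: h_def cscale_def algebra_simps)
    note E = energy_identity[OF A(1) this less_imp_le[OF n] z]
    have "(\<lambda>x. (cmod ((f + cscale (\<alpha> n) \<phi>) x))\<^sup>2 + Im (h x * cnj ((f + cscale (\<alpha> n) \<phi>) x))) = G (\<alpha> n)"
      by (simp add: G_def cscale_def fun_eq_iff)
    moreover have "hderiv ell (f + cscale (\<alpha> n) \<phi>) ell * cnj ((f + cscale (\<alpha> n) \<phi>) ell) = (f1 + \<alpha> n) * cnj f0"
      using A(2)[of ell] S(2)[of ell] \<phi>(3,4) by (simp add: cscale_def f0_def f1_def)
    ultimately have "(G (\<alpha> n) has_integral Im ((f1 + \<alpha> n) * cnj f0)) {ell..real n}" using E by (simp only:)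
    then show ?thesis
      unfolding J_def M_def
      using has_integral_halfline_truncate[of ell "real n" "G (\<alpha> n)"] G_int[of "real n" "\<alpha> n"] by (simp add: M_def)
  qed
  define \<Phi> where "\<Phi> = (\<lambda>n. LINT x|M. indicator {..real n} x * ?P x)"
  have Phi: "filterlim \<Phi> at_top sequentially"
    unfolding \<Phi>_def M_def by (rule not_L2_truncated_norm_unbounded[OF cphi \<phi>(5)])
  define C where "C = cmod f1 * cmod f0 + (LINT x|M. ?F x) / 2 + (LINT x|M. ?H x) / 2"
  define D where "D = cmod f0"
  have CD: "0 \<le> C" "0 \<le> D" by (auto simp: C_def D_def intro!: add_nonneg_nonneg)
  \<comment> \<open>Integrating the second density bound compares \<open>|\<alpha> n|\<^sup>2 \<Phi> n / 4\<close> with a term linear in \<open>|\<alpha> n|\<close>, which is then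
    absorbed by \<open>|\<alpha> n| \<le> 1 + |\<alpha> n|\<^sup>2\<close>.\<close>
  have alpha_bound: "(cmod (\<alpha> n))\<^sup>2 * (\<Phi> n / 4 - D) \<le> C + D" if n: "ell < real n" for n
  proof -
    let ?b = "real n"
    have "(LINT x|M. (cmod (\<alpha> n))\<^sup>2 / 4 * (indicator {..?b} x * ?P x) - ?F x / 2 - ?H x / 2)
       \<le> (LINT x|M. indicator {..?b} x * G (\<alpha> n) x)"
    proof (rule integral_mono)
      show "integrable M (\<lambda>x. (cmod (\<alpha> n))\<^sup>2 / 4 * (indicator {..?b} x * ?P x) - ?F x / 2 - ?H x / 2)"
        by (intro Bochner_Integration.integrable_diff integrable_mult_right integrable_divide phi_int f_int h_int)
      fix x
      show "(cmod (\<alpha> n))\<^sup>2 / 4 * (indicator {..?b} x * ?P x) - ?F x / 2 - ?H x / 2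
          \<le> indicator {..?b} x * G (\<alpha> n) x"
        using G_bounds(2)[where x=x and a="\<alpha> n"] zero_le_power2[of "cmod (f x)"] zero_le_power2[of "cmod (h x)"]
        by (auto simp: indicator_def)
    qed (rule G_int)
    also have "\<dots> = Im ((f1 + \<alpha> n) * cnj f0)" using J_eq[OF n] by (simp add: J_def)
    also have "\<dots> \<le> cmod ((f1 + \<alpha> n) * cnj f0)" by (rule order_trans[OF abs_ge_self abs_Im_le_cmod])
    also have "\<dots> \<le> cmod f1 * cmod f0 + cmod (\<alpha> n) * D"
      by (simp add: norm_mult D_def distrib_right[symmetric] mult_right_mono norm_triangle_ineq)
    finally have "(cmod (\<alpha> n))\<^sup>2 * (\<Phi> n / 4) \<le> C + cmod (\<alpha> n) * D"
      using phi_int f_int h_int by (simp add: C_def \<Phi>_def)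
    also have "cmod (\<alpha> n) * D \<le> (1 + (cmod (\<alpha> n))\<^sup>2) * D"
      using CD sum_squares_bound[of 1 "cmod (\<alpha> n)"] norm_ge_zero[of "\<alpha> n"]
      by (intro mult_right_mono) (simp_all del: norm_ge_zero)
    finally show ?thesis by (simp add: algebra_simps)
  qed
  have alpha0: "\<alpha> \<longlonglongrightarrow> 0"
  proof -
    have lim: "(\<lambda>n. (C + D) / (\<Phi> n / 4 - D)) \<longlonglongrightarrow> 0"
    proof (rule tendsto_divide_0[OF tendsto_const])
      have "filterlim (\<lambda>n. \<Phi> n * (1 / 4)) at_top sequentially"
        by (rule filterlim_at_top_mult_tendsto_pos[OF tendsto_const _ Phi]) auto
      then have "filterlim (\<lambda>n. - D + \<Phi> n * (1 / 4)) at_top sequentially"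
        by (rule filterlim_tendsto_add_at_top[OF tendsto_const])
      then show "filterlim (\<lambda>n. \<Phi> n / 4 - D) at_infinity sequentially"
        by (intro filterlim_at_top_imp_at_infinity) (simp add: algebra_simps)
    qed
    have ev: "eventually (\<lambda>n. norm ((cmod (\<alpha> n))\<^sup>2) \<le> (C + D) / (\<Phi> n / 4 - D)) sequentially"
      using big filterlim_at_top_dense[THEN iffD1, OF Phi, rule_format, of "4 * D"]
    proof eventually_elim
      case (elim n)
      then show ?case using alpha_bound[of n] by (simp add: pos_le_divide_eq)
    qed
    have "(\<lambda>n. (cmod (\<alpha> n))\<^sup>2) \<longlonglongrightarrow> 0" by (rule Lim_null_comparison[OF ev lim])
    then have "(\<lambda>n. sqrt ((cmod (\<alpha> n))\<^sup>2)) \<longlonglongrightarrow> sqrt 0" by (rule tendsto_real_sqrt)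
    then show ?thesis by (simp add: tendsto_norm_zero_iff)
  qed
  \<comment> \<open>The squared norm of \<open>h\<close> beyond \<open>N\<close>.\<close>
  define T where "T = (\<lambda>N::nat. LINT x|M. ?H x - indicator {..real N} x * ?H x)"
  have step: "J (real N) 0 \<le> Im (f1 * cnj f0) + T N / 4" for N
  proof -
    have "(\<lambda>n. J (real N) (\<alpha> n)) \<longlonglongrightarrow> J (real N) 0"
    proof -
      obtain A where A: "\<And>n. cmod (\<alpha> n) \<le> A"
        using alpha0 convergent_imp_Bseq convergentI Bseq_def by metis
      show ?thesis unfolding J_def
      proof (rule integral_dominated_convergence[where
            w="\<lambda>x. 4 * ?F x + 4 * A\<^sup>2 * (indicator {..real N} x * ?P x) + ?H x"])
        show "integrable M (\<lambda>x. 4 * ?F x + 4 * A\<^sup>2 * (indicator {..real N} x * ?P x) + ?H x)"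
          by (intro Bochner_Integration.integrable_add integrable_mult_right phi_int f_int h_int)
        show "AE x in M. (\<lambda>n. indicator {..real N} x * G (\<alpha> n) x) \<longlonglongrightarrow> indicator {..real N} x * G 0 x"
        proof (rule AE_I2)
          fix x
          show "(\<lambda>n. indicator {..real N} x * G (\<alpha> n) x) \<longlonglongrightarrow> indicator {..real N} x * G 0 x"
            unfolding G_def using alpha0 by (intro tendsto_intros)
        qed
        fix n
        show "AE x in M. norm (indicator {..real N} x * G (\<alpha> n) x)
           \<le> 4 * ?F x + 4 * A\<^sup>2 * (indicator {..real N} x * ?P x) + ?H x"
        proof (rule AE_I2)
          fix x
          have "(cmod (\<alpha> n))\<^sup>2 * ?P x \<le> A\<^sup>2 * ?P x"
            using A[of n] by (intro mult_right_mono power_mono) auto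
          then show "norm (indicator {..real N} x * G (\<alpha> n) x)
           \<le> 4 * ?F x + 4 * A\<^sup>2 * (indicator {..real N} x * ?P x) + ?H x"
            using G_bounds(3)[where x=x and a="\<alpha> n"] by (auto simp: indicator_def)
        qed
      qed (use G_int in auto)
    qed
    moreover have "(\<lambda>n. Im ((f1 + \<alpha> n) * cnj f0) + T N / 4) \<longlonglongrightarrow> Im ((f1 + 0) * cnj f0) + T N / 4"
      using alpha0 by (intro tendsto_intros)
    moreover have "eventually (\<lambda>n. J (real N) (\<alpha> n) \<le> Im ((f1 + \<alpha> n) * cnj f0) + T N / 4) sequentially"
      using big eventually_ge_at_top[of N]
    proof eventually_elim
      case (elim n)
      have "J (real N) (\<alpha> n) \<le> (LINT x|M. indicator {..real n} x * G (\<alpha> n) x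
          + (?H x - indicator {..real N} x * ?H x) / 4)"
        unfolding J_def
      proof (rule integral_mono[OF G_int])
        show "integrable M (\<lambda>x. indicator {..real n} x * G (\<alpha> n) x
          + (?H x - indicator {..real N} x * ?H x) / 4)"
          by (intro Bochner_Integration.integrable_add Bochner_Integration.integrable_diff integrable_divide G_int h_int h_int_tr)
        fix x
        show "indicator {..real N} x * G (\<alpha> n) x \<le> indicator {..real n} x * G (\<alpha> n) x
          + (?H x - indicator {..real N} x * ?H x) / 4"
          using G_bounds(1)[where x=x and a="\<alpha> n"] elim(2) by (auto simp: indicator_def)
      qed
      also have "\<dots> = J (real n) (\<alpha> n) + T N / 4"
        unfolding J_def T_def using G_int h_int h_int_tr by simp
      finally show ?case using J_eq[OF elim(1)] by simp
    qed
    ultimately have "J (real N) 0 \<le> Im ((f1 + 0) * cnj f0) + T N / 4"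
      by (intro tendsto_le[OF sequentially_bot]) auto
    then show ?thesis by simp
  qed
  have G0: "integrable M (G 0)"
    unfolding G_def M_def using L2_square_integrable[OF F(2)] l2_inner_integrable[OF h F(2)]
    by (intro Bochner_Integration.integrable_add integrable_Im) simp_all
  have "(\<lambda>N. J (real N) 0) \<longlonglongrightarrow> (LINT x|M. G 0 x)"
    unfolding J_def using integral_truncate_tendsto[of ell "G 0"] G0 by (simp add: M_def)
  moreover have "(\<lambda>N. Im (f1 * cnj f0) + T N / 4) \<longlonglongrightarrow> Im (f1 * cnj f0) + 0 / 4"
  proof (intro tendsto_add tendsto_divide tendsto_const)
    have "(\<lambda>N. (LINT x|M. ?H x) - (LINT x|M. indicator {..real N} x * ?H x)) \<longlonglongrightarrow>
        (LINT x|M. ?H x) - (LINT x|M. ?H x)"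
      using integral_truncate_tendsto[of ell "\<lambda>x. ?H x"] h_int by (intro tendsto_diff tendsto_const) (simp add: M_def)
    then show "T \<longlonglongrightarrow> 0" unfolding T_def using h_int h_int_tr by simp
  qed simp
  ultimately have "(LINT x|M. G 0 x) \<le> Im (f1 * cnj f0) + 0 / 4"
    using step by (intro LIMSEQ_le) auto
  also have "(LINT x|M. G 0 x) = Im (op_form ell q f f)"
  proof -
    have "Im (op_form ell q f f) = (LINT x|M. Im (lexpr ell q f x * cnj (f x)))"
      unfolding l2_inner_def M_def by (rule integral_Im[OF l2_inner_integrable[OF F(3,2)], symmetric])
    also have "(\<lambda>x. Im (lexpr ell q f x * cnj (f x))) = G 0"
      by (auto simp: G_def h_def fun_eq_iff cmod_power2) (simp add: power2_eq_square algebra_simps)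
    finally show ?thesis by simp
  qed
  finally show ?thesis by (simp add: f0_def f1_def)
qed

text \<open>Applied to the conjugate of \<open>f\<close>, the inequality of \<open>Im_form_le_boundary_term\<close> reverses, because
the differential expression has real coefficients.\<close>

lemma limit_point_if_dirichlet_solution_not_L2:
  assumes \<phi>: "AC_with_deriv ell \<phi>" "eigen_eq ell q \<i> \<phi>"
    "\<phi> ell = 0" "hderiv ell \<phi> ell = 1" "\<phi> \<notin> L2 ell"
  shows "limit_point ell q"
proof (rule limit_pointI)
  fix f assume f: "f \<in> Hplus ell q"
  note F = HplusD[OF f]
  let ?c = "\<lambda>x. cnj (f x)"
  have c: "?c \<in> Hplus ell q" by (rule Hplus_cnj(1)[OF f])
  have 1: "Im (op_form ell q f f) \<le> Im (hderiv ell f ell * cnj (f ell))"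
    by (rule Im_form_le_boundary_term[OF f \<phi>])
  have "op_form ell q ?c ?c = l2_inner ell (\<lambda>x. cnj (lexpr ell q f x)) ?c"
    by (rule l2_inner_cong_left[OF L2_cnj[OF F(3)] L2_cnj[OF F(2)] Hplus_cnj(2)[OF f]])
  also have "\<dots> = cnj (op_form ell q f f)"
    unfolding l2_inner_def by (simp flip: Bochner_Integration.integral_cnj)
  finally have "Im (cnj (op_form ell q f f)) \<le> Im (cnj (hderiv ell f ell) * cnj (cnj (f ell)))"
    using Im_form_le_boundary_term[OF c \<phi>] AC_with_deriv_cnj(2)[OF F(1), of ell] by simp
  with 1 have "Im (op_form ell q f f) = Im (hderiv ell f ell * cnj (f ell))" by simp
  then show "green_defect ell q f f = 0"
    unfolding green_defect_def l2_inner_cnj[of ell f "lexpr ell q f"]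
    by (simp add: complex_eq_iff)
qed

text \<open>If the Dirichlet solution at \<open>\<i>\<close> were square integrable, it would span together with the Weyl
solution a two-dimensional subspace of the deficiency space.\<close>

lemma deficiency_index_one_imp_limit_point:
  assumes dim: "fst (deficiency_indices ell q) = 1" and wt: "weyl_titchmarsh ell q m"
  shows "limit_point ell q"
proof -
  interpret vs: vector_space "cscale :: complex \<Rightarrow> (real \<Rightarrow> complex) \<Rightarrow> _"
    by standard (auto simp: cscale_def fun_eq_iff algebra_simps)
  obtain \<phi>1 \<phi>2 where s1: "solves_ivp ell q \<i> 0 1 \<phi>1" and s2: "solves_ivp ell q \<i> (-1) 0 \<phi>2"
      and L: "\<phi>2 + cscale (m \<i>) \<phi>1 \<in> L2 ell"
    using wt unfolding weyl_titchmarsh_def by (metis complex_nonneg_Reals_iff imaginary_unit.simps(2) zero_neq_one)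
  note S1 = s1[unfolded solves_ivp_def] and S2 = s2[unfolded solves_ivp_def]
  have "\<phi>1 \<notin> L2 ell"
  proof
    assume P: "\<phi>1 \<in> L2 ell"
    let ?D = "deficiency_space ell q \<i>"
    have mem: "zero_left ell u \<in> ?D" if "AC_with_deriv ell u" "eigen_eq ell q \<i> u" "u \<in> L2 ell" for u
    proof -
      note Z = Hplus_zero_left[OF that(1,3,2) L2_scale[OF that(3)]]
      show ?thesis unfolding deficiency_space_def
        using Z(1) Z(4) AE_halfline_space Z(2) by (auto elim: eventually_elim2)
    qed
    let ?w = "zero_left ell (\<phi>2 + cscale (m \<i>) \<phi>1)" and ?p = "zero_left ell \<phi>1"
    note C = AC_with_deriv_scale[of ell \<phi>1, where c="m \<i>"]
    note A = AC_with_deriv_add[of ell \<phi>2 "cscale (m \<i>) \<phi>1"]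
    have w: "?w \<in> ?D"
    proof (rule mem[OF A(1) _ L])
      show "eigen_eq ell q \<i> (\<phi>2 + cscale (m \<i>) \<phi>1)"
        using A(3)[of q] C(3)[of q] S1 S2 C(1)
        by (auto simp: cscale_def algebra_simps elim!: eventually_elim2)
    qed (use S1 S2 C(1) in auto)
    have p: "?p \<in> ?D" by (rule mem) (use S1 P in auto)
    \<comment> \<open>The values at \<open>ell\<close> are \<open>0\<close> and \<open>-1\<close>, so a multiple of the Weyl solution that equals \<open>\<phi>1\<close> would be zero.\<close>
    have pw: "?p \<notin> vs.span {?w}"
    proof
      assume "?p \<in> vs.span {?w}"
      then obtain k where k: "?p = cscale k ?w" by (auto simp: vs.span_singleton)
      then have "?p ell = k * ?w ell" by (simp add: cscale_def)
      then have "k = 0" using S1 S2 by (simp add: zero_left_def cscale_def)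
      then have "?p = (\<lambda>x. 0)" using k by (simp add: cscale_def)
      moreover have "hderiv ell ?p ell = 1"
        using Hplus_zero_left(3)[of ell \<phi>1 q "\<lambda>x. \<i> * \<phi>1 x" ell] S1 P L2_scale[OF P] by simp
      moreover have "hderiv ell (\<lambda>x. 0) ell = 0" by (rule hderiv_eqI) auto
      ultimately show False by simp
    qed
    have w0: "?w \<noteq> 0"
    proof
      assume "?w = 0"
      then have "?w ell = 0" by simp
      then show False using S1 S2 by (simp add: zero_left_def cscale_def)
    qed
    have ind: "vs.independent {?p, ?w}"
      using pw w0 by (intro vs.independent_insertI) (auto simp: vs.dependent_single vs.independent_empty)
    have neq: "?p \<noteq> ?w" using pw vs.span_base[of ?w "{?w}"] by auto
    have "vs.dim ?D = 1" using dim by (simp add: deficiency_indices_def)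
    then obtain B where B: "B \<subseteq> ?D" "vs.independent B" "?D \<subseteq> vs.span B" "card B = 1"
      using vs.basis_exists[of ?D] by metis
    have "finite B" using B(4) card.infinite[of B] by fastforce
    then have "card {?p, ?w} \<le> card B"
      using vs.independent_span_bound[of B "{?p, ?w}"] ind w p B(3) by auto
    then show False using neq B(4) by simp
  qed
  then show ?thesis
    using S1 by (intro limit_point_if_dirichlet_solution_not_L2[of ell \<phi>1]) auto
qed

section \<open>Density of the minimal domain\<close>

lemma max_power_has_derivative:
  "((\<lambda>t. (max 0 t) ^ (k + 2)) has_real_derivative (real k + 2) * (max 0 t) ^ (k + 1)) (at t)" for t :: real
proof (cases "t = 0")
  case True
  have "((\<lambda>y. ((max 0 y) ^ (k + 2) - (max 0 0) ^ (k + 2)) / (y - 0)) \<longlongrightarrow> 0) (at (0::real))"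
  proof (rule Lim_null_comparison)
    have "isCont (\<lambda>y. (max 0 y) ^ (k + 1)) (0::real)" by (intro continuous_intros)
    then show "((\<lambda>y. (max 0 y) ^ (k + 1)) \<longlongrightarrow> 0) (at (0::real))" by (simp add: isCont_def)
    show "\<forall>\<^sub>F y in at (0::real). norm (((max 0 y) ^ (k + 2) - (max 0 0) ^ (k + 2)) / (y - 0)) \<le> (max 0 y) ^ (k + 1)"
      by (intro always_eventually) (auto simp: max_def)
  qed
  then show ?thesis using True by (simp add: has_field_derivative_iff)
next
  case False
  show ?thesis
  proof (cases "t > 0")
    case True
    have "((\<lambda>t. t ^ (k + 2)) has_real_derivative (real k + 2) * t ^ (k + 1)) (at t)"
      using DERIV_pow[of "k + 2" t UNIV] by (simp add: add.commute)
    then have "((\<lambda>t. (max 0 t) ^ (k + 2)) has_real_derivative (real k + 2) * t ^ (k + 1)) (at t)"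
      by (rule has_field_derivative_transform_within_open[of _ _ _ "{0<..}"]) (use True in auto)
    then show ?thesis using True by simp
  next
    case F: False
    have "((\<lambda>t. (max 0 t) ^ (k + 2)) has_real_derivative 0) (at t)"
      by (rule has_field_derivative_transform_within_open[of "\<lambda>t. 0" _ _ "{..<0}"]) (use F False in auto)
    then show ?thesis using F False by simp
  qed
qed

lemma max_square_has_derivative: "((\<lambda>t. (max 0 t) ^ 2) has_real_derivative 2 * max 0 t) (at t)"
  and max_cube_has_derivative: "((\<lambda>t. (max 0 t) ^ 3) has_real_derivative 3 * (max 0 t) ^ 2) (at t)" for t :: real
  using max_power_has_derivative[of 0 t] max_power_has_derivative[of 1 t] by (simp_all add: eval_nat_numeral)

text \<open>Twice continuously differentiable. The derivatives are left unnamed because cutoffs are built by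
products and powers, and for density only their existence matters.\<close>

definition C2 :: "(real \<Rightarrow> real) \<Rightarrow> bool" where
  "C2 e \<longleftrightarrow> (\<exists>e1 e2. (\<forall>x. (e has_real_derivative e1 x) (at x)) \<and> (\<forall>x. (e1 has_real_derivative e2 x) (at x))
     \<and> continuous_on UNIV e2)"

lemma C2_mult:
  assumes "C2 e" "C2 f"
  shows "C2 (\<lambda>x. e x * f x)"
proof -
  obtain e1 e2 where e: "\<And>x. (e has_real_derivative e1 x) (at x)" "\<And>x. (e1 has_real_derivative e2 x) (at x)" "continuous_on UNIV e2"
    using assms(1) unfolding C2_def by blast
  obtain f1 f2 where f: "\<And>x. (f has_real_derivative f1 x) (at x)" "\<And>x. (f1 has_real_derivative f2 x) (at x)" "continuous_on UNIV f2"
    using assms(2) unfolding C2_def by blast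
  have c: "continuous_on UNIV e" "continuous_on UNIV e1" "continuous_on UNIV f" "continuous_on UNIV f1"
    using e f by (meson DERIV_isCont continuous_at_imp_continuous_on)+
  show ?thesis unfolding C2_def
  proof (intro exI conjI allI)
    fix x
    show "((\<lambda>x. e x * f x) has_real_derivative (e1 x * f x + e x * f1 x)) (at x)"
      using DERIV_mult[OF e(1) f(1), of x] by (simp add: algebra_simps)
    show "((\<lambda>x. e1 x * f x + e x * f1 x) has_real_derivative ((e2 x * f x + e1 x * f1 x) + (e1 x * f1 x + e x * f2 x))) (at x)"
      using DERIV_add[OF DERIV_mult[OF e(2) f(1), of x] DERIV_mult[OF e(1) f(2), of x]] by (simp add: algebra_simps)
    show "continuous_on UNIV (\<lambda>x. (e2 x * f x + e1 x * f1 x) + (e1 x * f1 x + e x * f2 x))"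
      by (intro continuous_intros c e(3) f(3))
  qed
qed

lemma C2_const: "C2 (\<lambda>x. c)"
  unfolding C2_def by (rule exI[of _ "\<lambda>x. 0"], rule exI[of _ "\<lambda>x. 0"]) auto

lemma C2_one_minus:
  assumes "C2 e" shows "C2 (\<lambda>x. 1 - e x)"
proof -
  obtain e1 e2 where e: "\<And>x. (e has_real_derivative e1 x) (at x)" "\<And>x. (e1 has_real_derivative e2 x) (at x)" "continuous_on UNIV e2"
    using assms(1) unfolding C2_def by blast
  show ?thesis unfolding C2_def
    by (rule exI[of _ "\<lambda>x. 0 - e1 x"], rule exI[of _ "\<lambda>x. 0 - e2 x"])
       (intro conjI allI DERIV_diff DERIV_const e continuous_intros)
qed

lemma C2_power: "C2 e \<Longrightarrow> C2 (\<lambda>x. e x ^ n)"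
  by (induction n) (auto intro: C2_const C2_mult)

lemma C2_max_cube: "C2 (\<lambda>x. (max 0 (c * x + d)) ^ 3)"
proof -
  have lin: "((\<lambda>x. c * x + d) has_real_derivative c) (at x)" for x
    by (auto intro!: derivative_eq_intros)
  show ?thesis unfolding C2_def
  proof (intro exI conjI allI)
    show "((\<lambda>x. (max 0 (c * x + d)) ^ 3) has_real_derivative 3 * (max 0 (c * x + d)) ^ 2 * c) (at x)" for x
      by (rule DERIV_cong[OF DERIV_chain'[OF lin max_cube_has_derivative]]) simp
    show "((\<lambda>x. 3 * (max 0 (c * x + d)) ^ 2 * c) has_real_derivative 3 * (2 * max 0 (c * x + d) * c) * c) (at x)" for x
      by (intro DERIV_cmult DERIV_cmult_right DERIV_cong[OF DERIV_chain'[OF lin max_square_has_derivative]]) simp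
  qed (intro continuous_intros)
qed

text \<open>The cutoffs \<open>1 - (1 - w)^n\<close>, for a bump \<open>w \<le> 1\<close> that is positive exactly on the interval, are
bounded by \<open>1\<close> and converge to its indicator.\<close>

lemma integral_against_solution_zero:
  assumes h: "h \<in> L2 ell" and orth: "\<And>g. g \<in> dom_min ell q \<Longrightarrow> l2_inner ell h g = 0"
    and u: "AC_with_deriv ell u" "eigen_eq ell q z u"
    and ab: "ell \<le> a" "a < b"
  shows "integrable (halfline ell) (\<lambda>x. indicator {..b} x *\<^sub>R (h x * cnj (u x)))"
    "(LINT x|halfline ell. indicator {a<..<b} x *\<^sub>R (h x * cnj (u x))) = 0"
proof -
  have int: "integrable (halfline ell) (\<lambda>x. h x * cnj (indicator {..b} x * u x))"
    by (intro l2_inner_integrable h continuous_truncate_L2 AC_with_deriv_continuous(1)[OF u(1)])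
  then show int': "integrable (halfline ell) (\<lambda>x. indicator {..b} x *\<^sub>R (h x * cnj (u x)))"
    by (rule integrable_ext) (auto simp: indicator_def)
  \<comment> \<open>The factor makes \<open>w \<le> 1\<close>.\<close>
  define w where "w = (\<lambda>x. (1 / (b - a) ^ 6) * ((max 0 (1 * x + (- a))) ^ 3 * (max 0 ((-1) * x + b)) ^ 3))"
  define e where "e = (\<lambda>n x. 1 - (1 - w x) ^ n)"
  have w0: "w x = 0" if "x \<notin> {a<..<b}" for x using that by (auto simp: w_def)
  have w1: "0 < w x \<and> w x \<le> 1" if "x \<in> {a<..<b}" for x
  proof -
    have "(x - a) ^ 3 * (b - x) ^ 3 \<le> (b - a) ^ 3 * (b - a) ^ 3"
      using that by (intro mult_mono power_mono) auto
    also have "\<dots> = (b - a) ^ 6" by (simp flip: power_add)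
    finally show ?thesis using that by (auto simp: w_def max_def field_simps)
  qed
  have C2e: "C2 (e n)" for n
    unfolding e_def w_def by (intro C2_one_minus C2_power C2_mult C2_const C2_max_cube)
  have e0: "e n x = 0" if "x \<notin> {a<..<b}" for n x using w0[OF that] by (simp add: e_def)
  have e1: "0 \<le> e n x \<and> e n x \<le> 1" for n x
  proof (cases "x \<in> {a<..<b}")
    case True
    have "0 \<le> 1 - w x" "1 - w x \<le> 1" using w1[OF True] by auto
    then show ?thesis unfolding e_def by (auto simp: power_le_one)
  qed (simp add: e0)
  have zero: "(LINT x|halfline ell. h x * cnj (of_real (e n x) * u x)) = 0" for n
  proof -
    obtain d1 d2 where d: "\<And>x. (e n has_real_derivative d1 x) (at x)" "\<And>x. (d1 has_real_derivative d2 x) (at x)" "continuous_on UNIV d2"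
      using C2e[of n] unfolding C2_def by blast
    let ?g = "zero_left ell (\<lambda>x. of_real (e n x) * u x)"
    note R = cutoff_in_Hplus[OF u d, of b]
    have supp: "\<And>x. b \<le> x \<Longrightarrow> e n x = 0" using e0 by auto
    \<comment> \<open>If \<open>a = ell\<close>, the cutoff starts at \<open>ell\<close> itself, where it attains its minimum \<open>0\<close>.\<close>
    have "d1 ell = 0"
    proof (rule DERIV_local_min[OF d(1) zero_less_one], intro allI impI)
      fix y show "e n ell \<le> e n y" using e0[of ell n] ab e1[of n y] by auto
    qed
    then have "?g \<in> dom_min ell q"
      using R(1,2,3)[OF supp] e0[of ell n] ab by (auto simp: dom_min_def)
    then have "l2_inner ell h ?g = 0" by (rule orth)
    also have "l2_inner ell h ?g = (LINT x|halfline ell. h x * cnj (of_real (e n x) * u x))"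
      unfolding l2_inner_def by (intro Bochner_Integration.integral_cong refl) (auto simp: R(2)[OF supp])
    finally show ?thesis .
  qed
  have "(\<lambda>n. LINT x|halfline ell. h x * cnj (of_real (e n x) * u x)) \<longlonglongrightarrow>
      (LINT x|halfline ell. indicator {a<..<b} x *\<^sub>R (h x * cnj (u x)))"
  proof (rule integral_dominated_convergence[where w="\<lambda>x. norm (indicator {..b} x *\<^sub>R (h x * cnj (u x)))"])
    have um: "u \<in> borel_measurable (halfline ell)"
      by (rule continuous_imp_measurable_on_sets_lebesgue[OF AC_with_deriv_continuous(1)[OF u(1)]]) simp
    have cm: "(\<lambda>x. cnj (f x)) \<in> borel_measurable (halfline ell)" if "f \<in> borel_measurable (halfline ell)" for f
      using that by (rule measurable_compose) (intro borel_measurable_continuous_onI continuous_intros)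
    have im: "(indicator {a<..<b} :: real \<Rightarrow> real) \<in> borel_measurable (halfline ell)"
      by (intro measurable_restrict_space1 borel_measurable_indicator) simp
    show "(\<lambda>x. indicator {a<..<b} x *\<^sub>R (h x * cnj (u x))) \<in> borel_measurable (halfline ell)"
      by (intro borel_measurable_scaleR borel_measurable_times im L2_measurable h cm um)
    show "(\<lambda>x. h x * cnj (of_real (e n x) * u x)) \<in> borel_measurable (halfline ell)" for n
    proof -
      obtain d1 where "\<And>x. (e n has_real_derivative d1 x) (at x)" using C2e[of n] unfolding C2_def by blast
      then have "continuous_on {ell..} (\<lambda>x. complex_of_real (e n x))"
        by (intro continuous_on_of_real) (meson DERIV_isCont continuous_at_imp_continuous_on)
      then have "(\<lambda>x. complex_of_real (e n x)) \<in> borel_measurable (halfline ell)"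
        by (intro continuous_imp_measurable_on_sets_lebesgue) auto
      then show ?thesis by (intro borel_measurable_times[OF L2_measurable[OF h]] cm borel_measurable_times um)
    qed
    show "integrable (halfline ell) (\<lambda>x. norm (indicator {..b} x *\<^sub>R (h x * cnj (u x))))"
      using int' by (rule integrable_norm)
    show "AE x in halfline ell. (\<lambda>n. h x * cnj (of_real (e n x) * u x)) \<longlonglongrightarrow> indicator {a<..<b} x *\<^sub>R (h x * cnj (u x))"
    proof (rule AE_I2)
      fix x
      have "(\<lambda>n. e n x) \<longlonglongrightarrow> indicator {a<..<b} x"
      proof (cases "x \<in> {a<..<b}")
        case True
        have "(\<lambda>n. 1 - (1 - w x) ^ n) \<longlonglongrightarrow> 1 - 0"
          using w1[OF True] by (intro tendsto_intros LIMSEQ_power_zero) auto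
        then show ?thesis using True by (simp add: e_def)
      qed (simp add: e0)
      then have "(\<lambda>n. h x * cnj (of_real (e n x) * u x)) \<longlonglongrightarrow> h x * cnj (of_real (indicator {a<..<b} x) * u x)"
        by (intro tendsto_intros)
      then show "(\<lambda>n. h x * cnj (of_real (e n x) * u x)) \<longlonglongrightarrow> indicator {a<..<b} x *\<^sub>R (h x * cnj (u x))"
        by (simp add: scaleR_conv_of_real mult_ac)
    qed
    show "AE x in halfline ell. norm (h x * cnj (of_real (e n x) * u x)) \<le> norm (indicator {..b} x *\<^sub>R (h x * cnj (u x)))" for n
    proof (rule AE_I2)
      fix x
      show "norm (h x * cnj (of_real (e n x) * u x)) \<le> norm (indicator {..b} x *\<^sub>R (h x * cnj (u x)))"
      proof (cases "x \<in> {a<..<b}")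
        case True
        have "e n x * (cmod (h x) * cmod (u x)) \<le> 1 * (cmod (h x) * cmod (u x))"
          using e1 by (intro mult_right_mono) auto
        then show ?thesis using True e1[of n x] by (simp add: norm_mult mult_ac)
      qed (simp add: e0)
    qed
  qed
  then show "(LINT x|halfline ell. indicator {a<..<b} x *\<^sub>R (h x * cnj (u x))) = 0"
    unfolding zero using LIMSEQ_unique tendsto_const by blast
qed

lemma AE_zero_if_interval_integrals_zero:
  fixes k :: "real \<Rightarrow> complex"
  assumes int: "\<And>b. ell < b \<Longrightarrow> integrable (halfline ell) (\<lambda>x. indicator {..b} x *\<^sub>R k x)"
    and zero: "\<And>a b. ell \<le> a \<Longrightarrow> a < b \<Longrightarrow> (LINT x|halfline ell. indicator {a<..<b} x *\<^sub>R k x) = 0"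
  shows "AE x in halfline ell. k x = 0"
proof -
  define K where "K = (\<lambda>x. if x \<in> {ell..} then k x else 0)"
  have absint: "integrable lebesgue (\<lambda>x. indicator {..b} x *\<^sub>R K x)" if b: "ell < b" for b
  proof -
    have "integrable lebesgue (\<lambda>x. indicator {ell..} x *\<^sub>R (indicator {..b} x *\<^sub>R k x))"
      using int[OF b] by (subst (asm) integrable_restrict_space) auto
    then show ?thesis
      by (rule integrable_ext) (auto simp: K_def indicator_def)
  qed
  have setint: "set_integrable lebesgue {a..b} K" for a b
    using set_integrable_subset[of lebesgue "{..max b (ell + 1)}" K "{a..b}"] absint[of "max b (ell + 1)"]
    by (auto simp: set_integrable_def[of _ "{..max b (ell + 1)}"])
  then have Kint: "K integrable_on cbox a b" for a b
    by (auto intro: set_lebesgue_integral_eq_integral(1))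
  have K0: "integral {a..b} K = 0" if "ell \<le> a" "a < b" for a b
  proof -
    have "set_integrable lebesgue {a<..<b} K"
      by (rule set_integrable_subset[OF setint[of a b]]) auto
    then have "integral {a<..<b} K = (LINT x:{a<..<b}|lebesgue. K x)"
      by (simp add: set_lebesgue_integral_eq_integral(2))
    also have "\<dots> = (LINT x|lebesgue. indicator {ell..} x *\<^sub>R (indicator {a<..<b} x *\<^sub>R k x))"
      unfolding set_lebesgue_integral_def using that
      by (intro Bochner_Integration.integral_cong) (auto simp: K_def indicator_def)
    also have "\<dots> = (LINT x|halfline ell. indicator {a<..<b} x *\<^sub>R k x)"
      by (subst integral_restrict_space) auto
    finally show ?thesis using zero[OF that] by (simp add: integral_open_interval_real)
  qed
  \<comment> \<open>At a Lebesgue point \<open>K\<close> is the limit of averages, all of which vanish.\<close>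
  obtain N where N: "negligible N" "\<And>x e. \<lbrakk>x \<notin> N; 0 < e\<rbrakk> \<Longrightarrow> \<exists>d>0. \<forall>h. 0 < h \<and> h < d \<longrightarrow>
       norm (integral (cbox x (x + h *\<^sub>R One)) K /\<^sub>R h ^ DIM(real) - K x) < e"
    by (rule integrable_ccontinuous_explicit[OF Kint]) blast
  show ?thesis
  proof (rule AE_halflineI[OF N(1)])
    fix x assume x: "ell \<le> x" "x \<notin> N"
    have "norm (K x) < e" if e: "e > 0" for e
    proof -
      obtain d where d: "d > 0" "\<And>h. 0 < h \<Longrightarrow> h < d \<Longrightarrow> norm (integral {x..x + h} K /\<^sub>R h - K x) < e"
        using N(2)[OF x(2) e] by auto
      then show ?thesis using d(2)[of "d / 2"] K0[of x "x + d / 2"] x(1) by simp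
    qed
    then have "K x = 0" by (metis less_irrefl zero_less_norm_iff)
    then show "k x = 0" using x(1) by (simp add: K_def)
  qed
qed

text \<open>Two solutions with nonzero Wronskian do not vanish simultaneously.\<close>

lemma orthogonal_to_dom_min_imp_zero:
  assumes h: "h \<in> L2 ell" and orth: "\<And>g. g \<in> dom_min ell q \<Longrightarrow> l2_inner ell h g = 0"
    and u: "solves_ivp ell q z 0 1 u" and v: "solves_ivp ell q z (-1) 0 v"
  shows "AE x in halfline ell. h x = 0"
proof -
  note U = u[unfolded solves_ivp_def] and V = v[unfolded solves_ivp_def]
  have *: "AE x in halfline ell. h x * cnj (y x) = 0"
    if y: "AC_with_deriv ell y" "eigen_eq ell q z y" for y
  proof (rule AE_zero_if_interval_integrals_zero)
    show "integrable (halfline ell) (\<lambda>x. indicator {..b} x *\<^sub>R (h x * cnj (y x)))" if "ell < b" for b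
      using integral_against_solution_zero(1)[OF h orth y order_refl that] by simp
  qed (use integral_against_solution_zero(2)[OF h orth y] in auto)
  have "AE x in halfline ell. h x * cnj (u x) = 0" "AE x in halfline ell. h x * cnj (v x) = 0"
    by (rule *; use U V in blast)+
  then show ?thesis using AE_halfline_space
  proof eventually_elim
    case (elim x)
    have "hderiv ell u x * v x - u x * hderiv ell v x = -1"
      using wronskian_constant[of ell u q z v x] U V elim(3) by simp
    then have "u x \<noteq> 0 \<or> v x \<noteq> 0" by auto
    then show ?case using elim(1,2) by auto
  qed
qed

section \<open>Nonnegativity of the Dirichlet and Neumann forms\<close>

text \<open>The profile \<open>t (1 - n t)_+^3\<close> has slope \<open>1\<close> at \<open>0\<close>, height of order \<open>1 / n\<close> and support of length
\<open>1 / n\<close>. The last two expressions are its first and second derivatives, so the second derivative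
is only of order \<open>n\<close>.\<close>

lemma bump_bounds:
  fixes t :: real and n :: nat
  assumes n: "0 < n" and t: "0 \<le> t"
  defines "p \<equiv> max 0 (1 - real n * t)"
  shows "t * p ^ 3 \<le> 1 / real n" "0 \<le> t * p ^ 3" "\<bar>p ^ 3 - 3 * real n * t * p ^ 2\<bar> \<le> 4"
    "\<bar>- 6 * real n * p ^ 2 + 6 * (real n)\<^sup>2 * t * p\<bar> \<le> 12 * real n"
proof -
  have p: "0 \<le> p" "p \<le> 1" using t by (auto simp: p_def)
  show "0 \<le> t * p ^ 3" using p t by simp
  have nt: "real n * t * p \<le> 1"
  proof (cases "real n * t \<le> 1")
    case True
    then show ?thesis using p t mult_mono[of "real n * t" 1 p 1] by simp
  next
    case False
    then show ?thesis by (simp add: p_def)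
  qed
  have nt0: "0 \<le> real n * t * p" using t p by simp
  have p3: "0 \<le> p ^ k" "p ^ k \<le> 1" for k using p by (auto simp: power_le_one)
  have "real n * (t * p ^ 3) = (real n * t * p) * p ^ 2" by (simp add: eval_nat_numeral)
  also have "\<dots> \<le> 1 * 1" using nt nt0 p3 by (intro mult_mono) auto
  finally show "t * p ^ 3 \<le> 1 / real n" using n by (simp add: field_simps)
  have "3 * real n * t * p ^ 2 = 3 * ((real n * t * p) * p)" by (simp add: power2_eq_square)
  moreover have "(real n * t * p) * p \<le> 1 * 1" using nt nt0 p by (intro mult_mono) auto
  moreover have "0 \<le> (real n * t * p) * p" using nt0 p by simp
  ultimately show "\<bar>p ^ 3 - 3 * real n * t * p ^ 2\<bar> \<le> 4" using p3[of 3] unfolding abs_le_iff by linarith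
  have "6 * (real n)\<^sup>2 * t * p = 6 * (real n * (real n * t * p))" by (simp add: power2_eq_square)
  moreover have "real n * (real n * t * p) \<le> real n * 1" using nt by (intro mult_left_mono) auto
  moreover have "0 \<le> real n * (real n * t * p)" using nt0 by simp
  moreover have "real n * p ^ 2 \<le> real n * 1" using p3 by (intro mult_left_mono) auto
  moreover have "0 \<le> real n * p ^ 2" by simp
  ultimately show "\<bar>- 6 * real n * p ^ 2 + 6 * (real n)\<^sup>2 * t * p\<bar> \<le> 12 * real n" unfolding abs_le_iff by linarith
qed

text \<open>The elements with \<open>f ell = 0\<close> differ from the minimal domain by a one-dimensional space, spanned
by any bump \<open>\<eta> n\<close> with \<open>\<eta> n ell = 0\<close> and slope \<open>1\<close> at \<open>ell\<close>. Its form is an integral over an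
interval of length \<open>1 / n\<close> of a function that stays bounded, being of order \<open>n\<close> times \<open>1 / n\<close>, so
that the bump costs nothing in the limit. In other words, the Dirichlet condition at \<open>ell\<close> belongs
to the Friedrichs extension.\<close>

lemma dirichlet_form_nonneg:
  assumes lp: "limit_point ell q" and nn: "nonnegative_min ell q"
    and u: "AC_with_deriv ell u" "eigen_eq ell q z u" "u ell = 1"
    and f: "f \<in> Hplus ell q" "f ell = 0"
  shows "0 \<le> Re (op_form ell q f f)"
proof -
  note F = HplusD[OF f(1)]
  note cu = AC_with_deriv_continuous[OF u(1)]
  \<comment> \<open>The profile of \<open>bump_bounds\<close> and its first two derivatives, moved to \<open>ell\<close>.\<close>
  define P where "P = (\<lambda>n x. max 0 (1 - real n * (x - ell)))"
  define e where "e = (\<lambda>n x. (x - ell) * P n x ^ 3)"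
  define e1 where "e1 = (\<lambda>n x. P n x ^ 3 - 3 * real n * (x - ell) * P n x ^ 2)"
  define e2 where "e2 = (\<lambda>n x. - 6 * real n * P n x ^ 2 + 6 * (real n)\<^sup>2 * (x - ell) * P n x)"
  have lin: "((\<lambda>x. 1 - real n * (x - ell)) has_real_derivative - real n) (at x)" for n x
    by (auto intro!: derivative_eq_intros)
  have P3: "((\<lambda>x. P n x ^ 3) has_real_derivative 3 * P n x ^ 2 * (- real n)) (at x)" for n x
    unfolding P_def by (rule DERIV_cong[OF DERIV_chain'[OF lin max_cube_has_derivative]]) simp
  have P2: "((\<lambda>x. P n x ^ 2) has_real_derivative 2 * P n x * (- real n)) (at x)" for n x
    unfolding P_def by (rule DERIV_cong[OF DERIV_chain'[OF lin max_square_has_derivative]]) simp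
  have d1: "(e n has_real_derivative e1 n x) (at x)" for n x
    unfolding e_def e1_def
    by (rule DERIV_cong[OF DERIV_mult[OF DERIV_diff[OF DERIV_ident DERIV_const] P3]]) (simp add: algebra_simps)
  have d2: "(e1 n has_real_derivative e2 n x) (at x)" for n x
    unfolding e1_def e2_def
    by (rule DERIV_cong[OF DERIV_diff[OF P3 DERIV_mult[OF DERIV_cmult[OF DERIV_diff[OF DERIV_ident DERIV_const]] P2]]])
      (simp add: algebra_simps power2_eq_square)
  have c2: "continuous_on UNIV (e2 n)" for n
    unfolding e2_def P_def by (intro continuous_intros)
  have supp: "e n x = 0" if "ell + 1 / real n \<le> x" "0 < n" for n x
  proof -
    have "1 \<le> real n * (x - ell)" using that by (simp add: field_simps)
    then show ?thesis by (simp add: e_def P_def)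
  qed
  define \<eta> where "\<eta> = (\<lambda>n. zero_left ell (\<lambda>x. of_real (e (Suc n) x) * u x))"
  have far: "e (Suc n) x = 0" if "ell + 1 \<le> x" for n x
  proof (rule supp)
    have "1 / real (Suc n) \<le> 1" by simp
    then show "ell + 1 / real (Suc n) \<le> x" using that by linarith
  qed simp
  have \<eta>: "\<eta> n \<in> Hplus ell q" and \<eta>_val: "\<And>x. ell \<le> x \<Longrightarrow> \<eta> n x = of_real (e (Suc n) x) * u x"
    and \<eta>_deriv: "hderiv ell (\<eta> n) ell = of_real (e1 (Suc n) ell) * u ell + of_real (e (Suc n) ell) * hderiv ell u ell"
    and l\<eta>: "AE x in halfline ell. lexpr ell q (\<eta> n) x = z * (of_real (e (Suc n) x) * u x)
       - 2 * of_real (e1 (Suc n) x) * hderiv ell u x - of_real (e2 (Suc n) x) * u x" for n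
    unfolding \<eta>_def
    by (rule cutoff_in_Hplus[OF u(1,2) d1 d2 c2, where b="ell + 1"]; (assumption | erule far))+
  have \<eta>_bd: "\<eta> n ell = 0" "hderiv ell (\<eta> n) ell = 1" for n
    using \<eta>_val[of ell n] \<eta>_deriv[of n] u(3) by (simp_all add: e_def e1_def P_def)
  note X = HplusD[OF \<eta>]
  obtain B where B: "\<And>x. x \<in> {ell..ell+1} \<Longrightarrow> cmod (u x) \<le> B" "\<And>x. x \<in> {ell..ell+1} \<Longrightarrow> cmod (hderiv ell u x) \<le> B"
  proof -
    have "bounded (u ` {ell..ell+1})" "bounded (hderiv ell u ` {ell..ell+1})"
      by (intro compact_imp_bounded compact_continuous_image continuous_on_subset[OF cu(1)] continuous_on_subset[OF cu(2)]; auto)+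
    then obtain B1 B2 where "\<forall>x\<in>{ell..ell+1}. cmod (u x) \<le> B1" "\<forall>x\<in>{ell..ell+1}. cmod (hderiv ell u x) \<le> B2"
      unfolding bounded_iff by blast
    then show thesis by (intro that[of "max B1 B2"]) (auto simp: le_max_iff_disj)
  qed
  have B0: "0 \<le> B" using B(1)[of ell] norm_ge_zero[of "u ell"] by (simp del: norm_ge_zero)
  have e_small: "\<bar>e (Suc n) x\<bar> \<le> 1 / real (Suc n)" "\<bar>e1 (Suc n) x\<bar> \<le> 4" "\<bar>e2 (Suc n) x\<bar> \<le> 12 * real (Suc n)" if "ell \<le> x" for n x
    using bump_bounds[of "Suc n" "x - ell"] that unfolding e_def e1_def e2_def P_def by simp_all
  have \<eta>_small: "cmod (\<eta> n x) \<le> indicator {..ell + 1} x * B / real (Suc n)" if "ell \<le> x" for n x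
  proof (cases "x \<le> ell + 1")
    case True
    have "\<bar>e (Suc n) x\<bar> * cmod (u x) \<le> 1 / real (Suc n) * B"
      using e_small(1)[OF that, of n] B(1)[of x] that True by (intro mult_mono) auto
    then show ?thesis using True \<eta>_val[OF that, of n] by (simp add: norm_mult)
  next
    case False
    then show ?thesis using \<eta>_val[OF that, of n] far[of x n] by simp
  qed
  have \<eta>_lim: "(\<lambda>n. \<eta> n x) \<longlonglongrightarrow> 0" if "ell \<le> x" for x
  proof (rule Lim_null_comparison)
    show "\<forall>\<^sub>F n in sequentially. cmod (\<eta> n x) \<le> indicator {..ell + 1} x * B * inverse (real (Suc n))"
      using \<eta>_small[OF that] by (intro always_eventually) (simp add: divide_inverse)
    show "(\<lambda>n. indicator {..ell + 1} x * B * inverse (real (Suc n))) \<longlonglongrightarrow> 0"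
      by (intro tendsto_mult_right_zero LIMSEQ_inverse_real_of_nat)
  qed
  have lim1: "(\<lambda>n. op_form ell q f (\<eta> n)) \<longlonglongrightarrow> 0"
  proof -
    have "(\<lambda>n. LINT x|halfline ell. lexpr ell q f x * cnj (\<eta> n x)) \<longlonglongrightarrow> (LINT x|halfline ell. 0)"
    proof (rule integral_dominated_convergence[where w="\<lambda>x. B * norm (lexpr ell q f x * cnj (indicator {..ell + 1} x * 1))"])
      show "integrable (halfline ell) (\<lambda>x. B * norm (lexpr ell q f x * cnj (indicator {..ell + 1} x * 1)))"
        by (intro integrable_mult_right integrable_norm l2_inner_integrable F continuous_truncate_L2 continuous_intros)
      show "(\<lambda>x. lexpr ell q f x * cnj (\<eta> n x)) \<in> borel_measurable (halfline ell)" for n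
        by (rule borel_measurable_integrable[OF l2_inner_integrable[OF F(3) X(2)]])
      show "AE x in halfline ell. (\<lambda>n. lexpr ell q f x * cnj (\<eta> n x)) \<longlonglongrightarrow> 0"
        using AE_halfline_space
      proof eventually_elim
        case (elim x)
        have "(\<lambda>n. lexpr ell q f x * cnj (\<eta> n x)) \<longlonglongrightarrow> lexpr ell q f x * cnj 0"
          by (intro tendsto_intros \<eta>_lim elim)
        then show ?case by simp
      qed
      show "AE x in halfline ell. norm (lexpr ell q f x * cnj (\<eta> n x)) \<le> B * norm (lexpr ell q f x * cnj (indicator {..ell + 1} x * 1))" for n
        using AE_halfline_space
      proof eventually_elim
        case (elim x)
        have "indicator {..ell + 1} x * B / real (Suc n) \<le> indicator {..ell + 1} x * B / 1"
          using B0 by (intro divide_left_mono) (auto simp: indicator_def)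
        then have "cmod (\<eta> n x) \<le> indicator {..ell + 1} x * B" using \<eta>_small[OF elim, of n] by simp
        then have "cmod (lexpr ell q f x) * cmod (\<eta> n x) \<le> cmod (lexpr ell q f x) * (indicator {..ell + 1} x * B)"
          by (intro mult_left_mono) auto
        then show ?case by (auto simp: norm_mult indicator_def mult.commute)
      qed
    qed simp
    then show ?thesis by (simp add: l2_inner_def)
  qed
  have lim2: "(\<lambda>n. op_form ell q (\<eta> n) (\<eta> n)) \<longlonglongrightarrow> 0"
  proof -
    \<comment> \<open>From \<open>|lexpr (\<eta> n)| \<le> (|z| + 20) B n\<close> and \<open>|\<eta> n| \<le> B / n\<close>.\<close>
    define A where "A = (cmod z + 20) * B * B"
    have "(\<lambda>n. LINT x|halfline ell. lexpr ell q (\<eta> n) x * cnj (\<eta> n x)) \<longlonglongrightarrow> (LINT x|halfline ell. 0)"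
    proof (rule integral_dominated_convergence[where w="\<lambda>x. A * (cmod (indicator {..ell + 1} x * 1))\<^sup>2"])
      show "integrable (halfline ell) (\<lambda>x. A * (cmod (indicator {..ell + 1} x * 1))\<^sup>2)"
        by (intro integrable_mult_right L2_square_integrable continuous_truncate_L2 continuous_intros)
      show "(\<lambda>x. lexpr ell q (\<eta> n) x * cnj (\<eta> n x)) \<in> borel_measurable (halfline ell)" for n
        by (rule borel_measurable_integrable[OF l2_inner_integrable[OF X(3) X(2)]])
      have "AE x in halfline ell. x \<noteq> ell" by (rule AE_halflineI[of "{ell}"]) auto
      then show "AE x in halfline ell. (\<lambda>n. lexpr ell q (\<eta> n) x * cnj (\<eta> n x)) \<longlonglongrightarrow> 0"
        using AE_halfline_space
      proof eventually_elim
        case (elim x)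
        then have "0 < x - ell" by simp
        then obtain N where N: "inverse (real (Suc N)) < x - ell" using reals_Archimedean by blast
        have "\<eta> n x = 0" if "N \<le> n" for n
        proof -
          have "1 / real (Suc n) \<le> 1 / real (Suc N)" using that by (intro divide_left_mono) auto
          then have "e (Suc n) x = 0" using N by (intro supp) (auto simp: inverse_eq_divide)
          then show ?thesis using \<eta>_val[of x n] elim by simp
        qed
        then have "eventually (\<lambda>n. lexpr ell q (\<eta> n) x * cnj (\<eta> n x) = 0) sequentially"
          unfolding eventually_sequentially by (intro exI[of _ N]) auto
        then show ?case by (rule tendsto_eventually)
      qed
      show "AE x in halfline ell. norm (lexpr ell q (\<eta> n) x * cnj (\<eta> n x)) \<le> A * (cmod (indicator {..ell + 1} x * 1))\<^sup>2" for n
        using AE_halfline_space l\<eta>[of n]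
      proof eventually_elim
        case (elim x)
        show ?case
        proof (cases "x \<le> ell + 1")
          case True
          let ?n = "real (Suc n)"
          have x: "x \<in> {ell..ell + 1}" using True elim(1) by auto
          have n1: "1 / ?n \<le> 1" "1 \<le> ?n" by auto
          have "cmod (lexpr ell q (\<eta> n) x) \<le> cmod (z * (of_real (e (Suc n) x) * u x))
             + cmod (2 * of_real (e1 (Suc n) x) * hderiv ell u x) + cmod (of_real (e2 (Suc n) x) * u x)"
            unfolding elim(2) by (intro order_trans[OF norm_triangle_ineq4] add_mono norm_triangle_ineq4 order_refl)
          also have "\<dots> = cmod z * (\<bar>e (Suc n) x\<bar> * cmod (u x)) + 2 * (\<bar>e1 (Suc n) x\<bar> * cmod (hderiv ell u x)) + \<bar>e2 (Suc n) x\<bar> * cmod (u x)"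
            by (simp add: norm_mult)
          also have "\<dots> \<le> cmod z * (1 * B) + 2 * (4 * B) + 12 * ?n * B"
            using e_small[OF elim(1), of n] n1 B[OF x] B0
            by (intro add_mono mult_left_mono mult_mono) (auto intro: order_trans)
          also have "\<dots> \<le> cmod z * (?n * B) + 2 * (4 * (?n * B)) + 12 * ?n * B"
            using n1 B0 by (intro add_mono mult_left_mono mult_right_mono) (auto simp: mult_le_cancel_right1)
          also have "\<dots> = (cmod z + 20) * B * ?n" by (simp add: algebra_simps)
          finally have l: "cmod (lexpr ell q (\<eta> n) x) \<le> (cmod z + 20) * B * ?n" .
          have "cmod (lexpr ell q (\<eta> n) x) * cmod (\<eta> n x) \<le> ((cmod z + 20) * B * ?n) * (B / ?n)"
            using l \<eta>_small[OF elim(1), of n] True B0 by (intro mult_mono) auto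
          also have "\<dots> = A" by (simp add: A_def)
          finally show ?thesis using True by (simp add: norm_mult)
        next
          case False
          then show ?thesis using \<eta>_val[OF elim(1), of n] far[of x n] by simp
        qed
      qed
    qed simp
    then show ?thesis by (simp add: l2_inner_def)
  qed
  \<comment> \<open>With this factor \<open>f + c \<eta> n\<close> has slope \<open>0\<close> at \<open>ell\<close> and so lies in the minimal domain.\<close>
  define c where "c = - hderiv ell f ell"
  have nonneg: "0 \<le> Re (op_form ell q f f + cnj c * op_form ell q f (\<eta> n)
      + c * cnj (op_form ell q f (\<eta> n)) + c * cnj c * op_form ell q (\<eta> n) (\<eta> n))" for n
  proof -
    let ?g = "f + cscale c (\<eta> n)"
    have sc: "cscale c (\<eta> n) \<in> Hplus ell q" by (rule Hplus_scale(1)[OF \<eta>])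
    have "?g \<in> Hplus ell q" by (rule Hplus_add(1)[OF f(1) sc])
    moreover have "?g ell = 0" "hderiv ell ?g ell = 0"
      using Hplus_boundary[OF f(1) sc] Hplus_boundary(2)[OF \<eta> \<eta>, of c n] f(2) \<eta>_bd[of n]
      by (simp_all add: c_def cscale_def)
    ultimately have "?g \<in> dom_min ell q" by (simp add: dom_min_def)
    then have "op_form ell q ?g ?g \<in> \<real>\<^sub>\<ge>\<^sub>0" using nn by (simp add: nonnegative_min_def)
    then have "0 \<le> Re (op_form ell q ?g ?g)" by (simp add: complex_nonneg_Reals_iff)
    moreover have "op_form ell q (\<eta> n) f = cnj (op_form ell q f (\<eta> n))"
      using limit_pointD[OF lp \<eta>[of n] f(1)] \<eta>_bd(1)[of n] f(2) l2_inner_cnj[of ell "\<eta> n" "lexpr ell q f"] by simp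
    ultimately show ?thesis unfolding l2_inner_lexpr_expand[OF f(1) \<eta>] by simp
  qed
  have "(\<lambda>n. Re (op_form ell q f f + cnj c * op_form ell q f (\<eta> n)
      + c * cnj (op_form ell q f (\<eta> n)) + c * cnj c * op_form ell q (\<eta> n) (\<eta> n))) \<longlonglongrightarrow>
     Re (op_form ell q f f + cnj c * 0 + c * cnj 0 + c * cnj c * 0)"
    by (intro tendsto_intros lim1 lim2)
  then have "0 \<le> Re (op_form ell q f f + cnj c * 0 + c * cnj 0 + c * cnj c * 0)"
    by (rule LIMSEQ_le_const) (use nonneg in auto)
  then show ?thesis by simp
qed

lemma weyl_titchmarshD:
  assumes "weyl_titchmarsh ell q m" "z \<notin> \<real>\<^sub>\<ge>\<^sub>0"
  obtains \<phi>1 \<phi>2 where "solves_ivp ell q z 0 1 \<phi>1" "solves_ivp ell q z (-1) 0 \<phi>2" "\<phi>2 + cscale (m z) \<phi>1 \<in> L2 ell"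
  using assms unfolding weyl_titchmarsh_def by blast

lemma weyl_solution:
  assumes wt: "weyl_titchmarsh ell q m" and z: "z \<notin> \<real>\<^sub>\<ge>\<^sub>0"
  obtains \<psi> where "\<psi> \<in> Hplus ell q" "eigen_eq ell q z \<psi>"
    "\<psi> ell = -1" "hderiv ell \<psi> ell = m z"
proof -
  obtain \<phi>1 \<phi>2 where s: "solves_ivp ell q z 0 1 \<phi>1" "solves_ivp ell q z (-1) 0 \<phi>2" "\<phi>2 + cscale (m z) \<phi>1 \<in> L2 ell"
    by (rule weyl_titchmarshD[OF wt z])
  note S1 = s(1)[unfolded solves_ivp_def] and S2 = s(2)[unfolded solves_ivp_def]
  let ?w = "\<phi>2 + cscale (m z) \<phi>1"
  have ac1: "AC_with_deriv ell \<phi>1" and ac2: "AC_with_deriv ell \<phi>2" using S1 S2 by blast+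
  note C = AC_with_deriv_scale[OF ac1, where c="m z"]
  note A = AC_with_deriv_add[OF ac2 C(1)]
  have e1: "eigen_eq ell q z \<phi>1"
    and e2: "eigen_eq ell q z \<phi>2" using S1 S2 by blast+
  have lw: "eigen_eq ell q z ?w"
    using A(3)[of q] C(3)[of q] e1 e2 by eventually_elim (simp add: cscale_def algebra_simps)
  note Z = Hplus_zero_left[OF A(1) s(3) lw L2_scale[OF s(3)]]
  show thesis
  proof (rule that[of "zero_left ell ?w"])
    show "AE x in halfline ell. lexpr ell q (zero_left ell ?w) x = z * zero_left ell ?w x"
      using Z(4) AE_halfline_space by eventually_elim (simp add: Z(2))
    show "zero_left ell ?w ell = -1" using Z(2)[of ell] S1 S2 by (simp add: cscale_def)
    show "hderiv ell (zero_left ell ?w) ell = m z"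
      using Z(3)[of ell] A(2)[of ell] C(2)[of ell] S1 S2 by simp
  qed (rule Z(1))
qed

text \<open>For \<open>t < 0\<close>, adding \<open>f ell\<close> times the Weyl solution at \<open>t\<close> makes \<open>f\<close> vanish at \<open>ell\<close>. The cross
terms of the form are evaluated by Green's formula and combine to the difference of the squared
norms of the two functions, times \<open>t\<close>.\<close>

lemma neumann_form_nonneg:
  assumes lp: "limit_point ell q" and nn: "nonnegative_min ell q" and wt: "weyl_titchmarsh ell q m"
    and lim: "((\<lambda>x. m (complex_of_real x)) \<longlongrightarrow> complex_of_real m0) (at_left 0)" and m0: "0 \<le> m0"
    and f: "f \<in> Hplus ell q"
  shows "0 \<le> Re (op_form ell q f f - hderiv ell f ell * cnj (f ell))"
proof -
  note F = HplusD[OF f]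
  have "- 1 \<notin> \<real>\<^sub>\<ge>\<^sub>0" by (simp add: complex_nonneg_Reals_iff)
  \<comment> \<open>Some solution with value \<open>1\<close> at \<open>ell\<close> is needed to build the bumps; \<open>-1\<close> is a convenient spectral parameter.\<close>
  then obtain \<phi> where \<phi>: "solves_ivp ell q (- 1) (-1) 0 \<phi>" using weyl_titchmarshD[OF wt] by metis
  then have ac: "AC_with_deriv ell \<phi>" and l\<phi>: "eigen_eq ell q (- 1) \<phi>"
    unfolding solves_ivp_def by blast+
  note S = AC_with_deriv_scale[OF ac, where c="-1"]
  have u: "AC_with_deriv ell (cscale (-1) \<phi>)" "cscale (-1) \<phi> ell = 1"
    "AE x in halfline ell. lexpr ell q (cscale (-1) \<phi>) x = (- 1) * cscale (-1) \<phi> x"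
    using S(1) \<phi> S(3)[of q] l\<phi> by (auto simp: solves_ivp_def cscale_def elim: eventually_elim2)
  define c where "c = f ell"
  let ?Q = "Re (op_form ell q f f - hderiv ell f ell * cnj (f ell))"
  let ?n = "Re (l2_inner ell f f)"
  \<comment> \<open>The bound \<open>0 \<le> Q(f + c \<psi>)\<close>, rewritten; the term \<open>t ||f + c \<psi>||\<^sup>2\<close> has the favourable sign.\<close>
  have key: "(cmod c)\<^sup>2 * Re (m (complex_of_real t)) + t * ?n \<le> ?Q" if t: "t < 0" for t
  proof -
    let ?z = "complex_of_real t"
    have z: "?z \<notin> \<real>\<^sub>\<ge>\<^sub>0" using t by (simp add: complex_nonneg_Reals_iff)
    obtain \<psi> where p: "\<psi> \<in> Hplus ell q" "eigen_eq ell q ?z \<psi>"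
        "\<psi> ell = -1" "hderiv ell \<psi> ell = m ?z"
      by (rule weyl_solution[OF wt z])
    note P = HplusD[OF p(1)]
    have lp_left: "op_form ell q \<psi> k = ?z * l2_inner ell \<psi> k" if "k \<in> L2 ell" for k
      using l2_inner_cong_left[OF L2_scale[OF P(2)] that p(2)] by (simp add: l2_inner_scale_left)
    have lp_right: "l2_inner ell k (lexpr ell q \<psi>) = ?z * l2_inner ell k \<psi>" if "k \<in> L2 ell" for k
      using lp_left[OF that] l2_inner_cnj[of ell k "lexpr ell q \<psi>"] l2_inner_cnj[of ell k \<psi>] by simp
    let ?f0 = "f + cscale c \<psi>"
    have sc: "cscale c \<psi> \<in> Hplus ell q" by (rule Hplus_scale(1)[OF p(1)])
    have f0: "?f0 \<in> Hplus ell q" by (rule Hplus_add(1)[OF f sc])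
    have "?f0 ell = 0" using p(3) by (simp add: cscale_def c_def)
    then have pos: "0 \<le> Re (op_form ell q ?f0 ?f0)"
      by (rule dirichlet_form_nonneg[OF lp nn u(1,3,2) f0])
    have "l2_inner ell ?f0 ?f0 = l2_inner ell f f + cnj c * l2_inner ell f \<psi> + c * l2_inner ell \<psi> f + c * cnj c * l2_inner ell \<psi> \<psi>"
    proof -
      have right: "l2_inner ell k ?f0 = l2_inner ell k f + cnj c * l2_inner ell k \<psi>" if "k \<in> L2 ell" for k
        using l2_inner_add_right[OF F(2) HplusD(2)[OF sc] that] by (simp add: plus_fun_def cscale_def l2_inner_scale_right)
      show ?thesis
        using F(2) P(2) HplusD(2)[OF sc] HplusD(2)[OF f0]
        by (simp add: l2_inner_plus_left l2_inner_cscale_left right algebra_simps)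
    qed
    moreover have "0 \<le> Re (l2_inner ell ?f0 ?f0)"
      using l2_inner_self[OF HplusD(2)[OF f0]] by simp
    ultimately have n0: "0 \<le> Re (l2_inner ell f f + cnj c * l2_inner ell f \<psi> + c * l2_inner ell \<psi> f + c * cnj c * l2_inner ell \<psi> \<psi>)"
      by simp
    have green: "op_form ell q f \<psi> = ?z * l2_inner ell f \<psi> - hderiv ell f ell - c * cnj (m ?z)"
      using limit_pointD[OF lp f p(1)] lp_right[OF F(2)] p(3,4) by (simp add: c_def algebra_simps)
    have "op_form ell q ?f0 ?f0 = (op_form ell q f f - hderiv ell f ell * cnj c) - c * cnj c * cnj (m ?z)
       + ?z * (l2_inner ell f f + cnj c * l2_inner ell f \<psi> + c * l2_inner ell \<psi> f + c * cnj c * l2_inner ell \<psi> \<psi>) - ?z * l2_inner ell f f"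
      unfolding l2_inner_lexpr_expand[OF f p(1)] green lp_left[OF F(2)] lp_left[OF P(2)] by (simp add: algebra_simps)
    then have "Re (op_form ell q ?f0 ?f0) = ?Q - (cmod c)\<^sup>2 * Re (m ?z)
       + t * Re (l2_inner ell f f + cnj c * l2_inner ell f \<psi> + c * l2_inner ell \<psi> f + c * cnj c * l2_inner ell \<psi> \<psi>) - t * ?n"
      by (simp add: complex_norm_square[symmetric] c_def flip: of_real_power)
    moreover have "t * Re (l2_inner ell f f + cnj c * l2_inner ell f \<psi> + c * l2_inner ell \<psi> f + c * cnj c * l2_inner ell \<psi> \<psi>) \<le> 0"
      using n0 t by (intro mult_nonpos_nonneg) auto
    ultimately show ?thesis using pos by linarith
  qed
  have "((\<lambda>t. (cmod c)\<^sup>2 * Re (m (complex_of_real t)) + t * ?n) \<longlongrightarrow> (cmod c)\<^sup>2 * Re (complex_of_real m0) + 0 * ?n) (at_left 0)"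
    by (intro tendsto_intros lim)
  moreover have "eventually (\<lambda>t. (cmod c)\<^sup>2 * Re (m (complex_of_real t)) + t * ?n \<le> ?Q) (at_left 0)"
    unfolding eventually_at_filter using key by (intro always_eventually) auto
  ultimately have "(cmod c)\<^sup>2 * Re (complex_of_real m0) + 0 * ?n \<le> ?Q"
    by (rule tendsto_upperbound) simp
  moreover have "0 \<le> (cmod c)\<^sup>2 * Re (complex_of_real m0) + 0 * ?n" using m0 by simp
  ultimately show ?thesis by linarith
qed

text \<open>At a zero of \<open>m\<close> the Weyl solution is an eigenfunction of the Neumann problem, whose spectrum is
nonnegative.\<close>

lemma weyl_function_nonzero:
  assumes lp: "limit_point ell q" and nn: "nonnegative_min ell q" and wt: "weyl_titchmarsh ell q m"
    and lim: "((\<lambda>x. m (complex_of_real x)) \<longlongrightarrow> complex_of_real m0) (at_left 0)" and m0: "0 \<le> m0"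
    and z: "z \<notin> \<real>\<^sub>\<ge>\<^sub>0"
  shows "m z \<noteq> 0"
proof
  assume mz: "m z = 0"
  obtain \<psi> where p: "\<psi> \<in> Hplus ell q" "eigen_eq ell q z \<psi>"
      "\<psi> ell = -1" "hderiv ell \<psi> ell = m z"
    by (rule weyl_solution[OF wt z])
  note P = HplusD[OF p(1)]
  define n where "n = (LINT x|halfline ell. (cmod (\<psi> x))\<^sup>2)"
  have n: "l2_inner ell \<psi> \<psi> = complex_of_real n" unfolding n_def by (rule l2_inner_self[OF P(2)])
  have lpp: "op_form ell q \<psi> \<psi> = z * complex_of_real n"
    using l2_inner_cong_left[OF L2_scale[OF P(2)] P(2) p(2)] by (simp add: l2_inner_scale_left n)
  have "n \<noteq> 0" using l2_inner_self_eq_0[OF p(1), of ell] p(3) n by auto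
  moreover have "0 \<le> n" by (simp add: n_def)
  ultimately have npos: "0 < n" by simp
  have "0 \<le> Re z * n" using neumann_form_nonneg[OF lp nn wt lim m0 p(1)] lpp p(4) mz by simp
  moreover have "Im z * n = 0"
    using limit_pointD[OF lp p(1) p(1)] l2_inner_cnj[of ell \<psi> "lexpr ell q \<psi>"] lpp p(4) mz
    by (auto simp: complex_eq_iff)
  ultimately have "0 \<le> Re z" "Im z = 0" using npos by (auto simp: zero_le_mult_iff)
  then show False using z by (simp add: complex_nonneg_Reals_iff)
qed

section \<open>Realization by the L-systems\<close>

text \<open>Green's formula for \<open>f\<close> and the conjugate of the Weyl solution says that their Wronskian vanishes
at \<open>ell\<close>. Since \<open>m z \<noteq> 0\<close>, either boundary condition then makes both initial values of \<open>f\<close> zero.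
The Wronskians of \<open>f\<close> with two solutions that have Wronskian \<open>-1\<close> with each other are therefore
zero everywhere, and they determine \<open>f\<close>.\<close>

lemma eigenfunction_zero:
  assumes lp: "limit_point ell q" and wt: "weyl_titchmarsh ell q m" and z: "z \<notin> \<real>\<^sub>\<ge>\<^sub>0" and mz: "m z \<noteq> 0"
    and f: "f \<in> Hplus ell q" "eigen_eq ell q z f"
    and bc: "f ell = 0 \<or> hderiv ell f ell = 0"
  shows "f = (\<lambda>x. 0)"
proof -
  note F = HplusD[OF f(1)]
  obtain \<psi> where p: "\<psi> \<in> Hplus ell q" "eigen_eq ell q z \<psi>"
      "\<psi> ell = -1" "hderiv ell \<psi> ell = m z"
    by (rule weyl_solution[OF wt z])
  note P = HplusD[OF p(1)]
  let ?c = "\<lambda>x. cnj (\<psi> x)"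
  have c: "?c \<in> Hplus ell q" by (rule Hplus_cnj(1)[OF p(1)])
  have lc: "AE x in halfline ell. lexpr ell q ?c x = cnj z * ?c x"
    using Hplus_cnj(2)[OF p(1)] p(2) by eventually_elim simp
  have "op_form ell q f ?c = z * l2_inner ell f ?c"
    using l2_inner_cong_left[OF L2_scale[OF F(2)] HplusD(2)[OF c] f(2)] by (simp add: l2_inner_scale_left)
  moreover have "op_form ell q ?c f = cnj z * l2_inner ell ?c f"
    using l2_inner_cong_left[OF L2_scale[OF HplusD(2)[OF c]] F(2) lc] by (simp add: l2_inner_scale_left)
  then have "l2_inner ell f (lexpr ell q ?c) = z * l2_inner ell f ?c"
    using l2_inner_cnj[of ell f "lexpr ell q ?c"] l2_inner_cnj[of ell f ?c] by simp
  ultimately have "hderiv ell f ell * \<psi> ell - f ell * hderiv ell \<psi> ell = 0"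
    using limit_pointD[OF lp f(1) c] AC_with_deriv_cnj(2)[OF P(1), of ell] by simp
  then have "- hderiv ell f ell = f ell * m z" using p(3,4) by simp
  then have "hderiv ell f ell = - (f ell * m z)" by (metis minus_minus)
  then have init: "f ell = 0" "hderiv ell f ell = 0" using bc mz by auto
  obtain \<phi>1 \<phi>2 where s: "solves_ivp ell q z 0 1 \<phi>1" "solves_ivp ell q z (-1) 0 \<phi>2"
    using weyl_titchmarshD[OF wt z] by metis
  note S1 = s(1)[unfolded solves_ivp_def] and S2 = s(2)[unfolded solves_ivp_def]
  show ?thesis
  proof
    fix x
    show "f x = 0"
    proof (cases "ell \<le> x")
      case True
      have w1: "hderiv ell f x * \<phi>1 x - f x * hderiv ell \<phi>1 x = 0"
        using wronskian_constant[OF F(1) f(2), of \<phi>1 x] S1 True init by simp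
      have w2: "hderiv ell f x * \<phi>2 x - f x * hderiv ell \<phi>2 x = 0"
        using wronskian_constant[OF F(1) f(2), of \<phi>2 x] S2 True init by simp
      have w12: "hderiv ell \<phi>1 x * \<phi>2 x - \<phi>1 x * hderiv ell \<phi>2 x = -1"
        using wronskian_constant[of ell \<phi>1 q z \<phi>2 x] S1 S2 True by simp
      have "f x * (hderiv ell \<phi>1 x * \<phi>2 x - \<phi>1 x * hderiv ell \<phi>2 x)
          = \<phi>1 x * (hderiv ell f x * \<phi>2 x - f x * hderiv ell \<phi>2 x) - \<phi>2 x * (hderiv ell f x * \<phi>1 x - f x * hderiv ell \<phi>1 x)"
        by (simp add: algebra_simps)
      then show ?thesis using w1 w2 w12 by simp
    qed (use F(4) in auto)
  qed
qed

lemma Re_state_op_0: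
  assumes lp: "limit_point ell q" and f: "f \<in> Hplus ell q" and g: "g \<in> Hplus ell q"
  shows "rigged_Re ell q (state_op (schroedinger_system ell q (Fin_param 0) \<i>)) f g
    = op_form ell q f g + f ell * cnj (hderiv ell g ell)"
proof -
  have "cnj (op_form ell q g f) = l2_inner ell f (lexpr ell q g)"
    by (rule l2_inner_cnj[symmetric])
  also have "\<dots> = op_form ell q f g - hderiv ell f ell * cnj (g ell) + f ell * cnj (hderiv ell g ell)"
    using limit_pointD[OF lp f g] by (simp add: algebra_simps)
  finally show ?thesis
    using f g by (simp add: rigged_Re_def rigged_adjoint_def schroedinger_system_def cscale_def embed_def
        delta_def delta'_def field_simps)
qed

lemma Re_state_op_Inf:
  assumes lp: "limit_point ell q" and f: "f \<in> Hplus ell q" and g: "g \<in> Hplus ell q"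
  shows "rigged_Re ell q (state_op (schroedinger_system ell q Inf_param \<i>)) f g
    = op_form ell q f g - hderiv ell f ell * cnj (g ell)"
proof -
  have "cnj (op_form ell q g f) = l2_inner ell f (lexpr ell q g)"
    by (rule l2_inner_cnj[symmetric])
  also have "\<dots> = op_form ell q f g - hderiv ell f ell * cnj (g ell) + f ell * cnj (hderiv ell g ell)"
    using limit_pointD[OF lp f g] by (simp add: algebra_simps)
  finally show ?thesis
    using f g by (simp add: rigged_Re_def rigged_adjoint_def schroedinger_system_def cscale_def embed_def
        delta_def field_simps)
qed

lemma shifted_Re_outside_Hplus:
  assumes "g \<notin> Hplus ell q"
  shows "shifted_Re ell q (schroedinger_system ell q \<mu> h) z f g = 0"
  using assms by (cases \<mu>) (simp_all add: shifted_Re_def rigged_Re_def rigged_adjoint_def schroedinger_system_def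
      cscale_def embed_def delta_def delta'_def)

text \<open>Test functions from the minimal domain do not see the boundary terms and yield the equation. The
Weyl solution as test function then yields the boundary condition.\<close>

lemma weak_solution_satisfies_equation:
  assumes lp: "limit_point ell q" and wt: "weyl_titchmarsh ell q m" and z: "z \<notin> \<real>\<^sub>\<ge>\<^sub>0"
    and f: "f \<in> Hplus ell q"
    and weak: "\<And>g. g \<in> Hplus ell q \<Longrightarrow>
       op_form ell q f g - z * l2_inner ell f g + \<alpha> * cnj (hderiv ell g ell) + \<beta> * cnj (g ell) = 0"
  shows "eigen_eq ell q z f" "\<alpha> * cnj (m z) = \<beta>"
proof -
  note F = HplusD[OF f]
  obtain \<phi>1 \<phi>2 where s: "solves_ivp ell q z 0 1 \<phi>1" "solves_ivp ell q z (-1) 0 \<phi>2"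
    using weyl_titchmarshD[OF wt z] by metis
  let ?h = "\<lambda>x. lexpr ell q f x + (- z) * f x"
  have h: "?h \<in> L2 ell" by (intro L2_add L2_scale F)
  have hg: "l2_inner ell ?h g = op_form ell q f g - z * l2_inner ell f g" if "g \<in> L2 ell" for g
    using l2_inner_add_left[OF F(3) L2_scale[OF F(2), of "- z"] that] l2_inner_scale_left[of ell "- z" f g] by simp
  have "AE x in halfline ell. ?h x = 0"
  proof (rule orthogonal_to_dom_min_imp_zero[OF h _ s])
    fix g assume "g \<in> dom_min ell q"
    then have "g \<in> Hplus ell q" "g ell = 0" "hderiv ell g ell = 0" by (auto simp: dom_min_def)
    then show "l2_inner ell ?h g = 0" using weak[of g] hg[OF HplusD(2)] by simp
  qed
  then show l: "eigen_eq ell q z f"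
    by eventually_elim simp
  obtain \<psi> where p: "\<psi> \<in> Hplus ell q" "\<psi> ell = -1" "hderiv ell \<psi> ell = m z"
    using weyl_solution[OF wt z] by metis
  have "op_form ell q f \<psi> = z * l2_inner ell f \<psi>"
    using l2_inner_cong_left[OF L2_scale[OF F(2)] HplusD(2)[OF p(1)] l] by (simp add: l2_inner_scale_left)
  then show "\<alpha> * cnj (m z) = \<beta>" using weak[OF p(1)] p(2,3) by simp
qed

text \<open>Both systems at once: \<open>(a, b)\<close> is \<open>(1, 0)\<close> for \<open>\<Theta>\<^sub>0\<^sub>,\<^sub>i\<close> and \<open>(0, -1)\<close> for \<open>\<Theta>\<^sub>\<infinity>\<^sub>,\<^sub>i\<close>.\<close>

lemma shifted_Re_injective:
  assumes lp: "limit_point ell q" and wt: "weyl_titchmarsh ell q m" and z: "z \<notin> \<real>\<^sub>\<ge>\<^sub>0" and mz: "m z \<noteq> 0"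
    and T: "\<And>f g. f \<in> Hplus ell q \<Longrightarrow> g \<in> Hplus ell q \<Longrightarrow> T f g =
        op_form ell q f g - z * l2_inner ell f g + a * f ell * cnj (hderiv ell g ell) + b * hderiv ell f ell * cnj (g ell)"
    and ab: "(a = 1 \<and> b = 0) \<or> (a = 0 \<and> b = -1)"
  shows "inj_on T (Hplus ell q)"
proof (rule inj_onI)
  fix y1 y2 assume y1: "y1 \<in> Hplus ell q" and y2: "y2 \<in> Hplus ell q" and eq: "T y1 = T y2"
  define f where "f = y1 + cscale (-1) y2"
  have s2: "cscale (-1) y2 \<in> Hplus ell q" by (rule Hplus_scale(1)[OF y2])
  have f: "f \<in> Hplus ell q" unfolding f_def by (rule Hplus_add(1)[OF y1 s2])
  have bd: "f ell = y1 ell - y2 ell" "hderiv ell f ell = hderiv ell y1 ell - hderiv ell y2 ell"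
    using Hplus_boundary[OF y1 s2] Hplus_boundary(2)[OF y2 y2, of "-1"] by (simp_all add: f_def cscale_def)
  have weak: "op_form ell q f g - z * l2_inner ell f g + (a * f ell) * cnj (hderiv ell g ell) + (b * hderiv ell f ell) * cnj (g ell) = 0"
    if g: "g \<in> Hplus ell q" for g
  proof -
    have fg: "op_form ell q f g = op_form ell q y1 g - op_form ell q y2 g"
      "l2_inner ell f g = l2_inner ell y1 g - l2_inner ell y2 g"
      using HplusD(2)[OF g] HplusD(2)[OF y1] HplusD(2)[OF s2]
      by (simp_all add: f_def l2_inner_lexpr_add[OF y1 s2] l2_inner_lexpr_scale[OF y2] l2_inner_plus_left l2_inner_cscale_left)
    have "op_form ell q f g - z * l2_inner ell f g + (a * f ell) * cnj (hderiv ell g ell)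
        + (b * hderiv ell f ell) * cnj (g ell) = T y1 g - T y2 g"
      unfolding fg bd T[OF y1 g] T[OF y2 g] by (simp add: algebra_simps)
    then show ?thesis using eq by simp
  qed
  note W = weak_solution_satisfies_equation[OF lp wt z f weak]
  have "f ell = 0 \<or> hderiv ell f ell = 0" using W(2) ab mz by auto
  from eigenfunction_zero[OF lp wt z mz f W(1) this] have "f = (\<lambda>x. 0)" .
  then have "y1 x - y2 x = 0" for x by (simp add: f_def cscale_def fun_eq_iff)
  then show "y1 = y2" by (simp add: fun_eq_iff)
qed

text \<open>Both systems at once, with \<open>(a, b)\<close> as in \<open>shifted_Re_injective\<close>. The multiple \<open>d\<close> of the Weyl
solution has boundary values \<open>- d\<close> and \<open>d * m z\<close>, and \<open>k\<close> must be the boundary functional that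
these produce: \<open>d = 1\<close> gives \<open>\<delta>'\<close>, and \<open>d = - 1 / m z\<close> gives \<open>\<delta>\<close>.\<close>

lemma realizes_at:
  assumes lp: "limit_point ell q" and wt: "weyl_titchmarsh ell q m" and z: "z \<notin> \<real>\<^sub>\<ge>\<^sub>0" and mz: "m z \<noteq> 0"
    and T: "\<And>f g. f \<in> Hplus ell q \<Longrightarrow> g \<in> Hplus ell q \<Longrightarrow> shifted_Re ell q \<Theta> z f g =
        op_form ell q f g - z * l2_inner ell f g + a * f ell * cnj (hderiv ell g ell) + b * hderiv ell f ell * cnj (g ell)"
    and T0: "\<And>f g. g \<notin> Hplus ell q \<Longrightarrow> shifted_Re ell q \<Theta> z f g = 0"
    and ab: "(a = 1 \<and> b = 0) \<or> (a = 0 \<and> b = -1)"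
    and K: "channel_op \<Theta> = (\<lambda>c. cscale c k)"
    and k: "\<And>g. g \<in> Hplus ell q \<Longrightarrow> k g = a * (- d) * cnj (hderiv ell g ell) + b * (d * m z) * cnj (g ell)"
    and k0: "\<And>g. g \<notin> Hplus ell q \<Longrightarrow> k g = 0"
    and V: "V = cnj (a * (- d) * cnj (d * m z) + b * (d * m z) * cnj (- d))"
  shows "inj_on (shifted_Re ell q \<Theta> z) (Hplus ell q)
        \<and> range (channel_op \<Theta>) \<subseteq> shifted_Re ell q \<Theta> z ` Hplus ell q
        \<and> impedance ell q \<Theta> z = V"
proof -
  obtain \<psi> where p: "\<psi> \<in> Hplus ell q" "eigen_eq ell q z \<psi>"
      "\<psi> ell = -1" "hderiv ell \<psi> ell = m z"
    by (rule weyl_solution[OF wt z])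
  have weak: "op_form ell q \<psi> g = z * l2_inner ell \<psi> g" if "g \<in> Hplus ell q" for g
    using l2_inner_cong_left[OF L2_scale[OF HplusD(2)[OF p(1)]] HplusD(2)[OF that] p(2)]
    by (simp add: l2_inner_scale_left)
  note inj = shifted_Re_injective[OF lp wt z mz T ab]
  have mem: "cscale c \<psi> \<in> Hplus ell q" for c by (rule Hplus_scale(1)[OF p(1)])
  have bd: "cscale c \<psi> ell = - c" "hderiv ell (cscale c \<psi>) ell = c * m z" for c
    using Hplus_boundary(2,4)[OF p(1) p(1), of c] p(3,4) by simp_all
  have sol: "shifted_Re ell q \<Theta> z (cscale (c * d) \<psi>) = channel_op \<Theta> c" for c
  proof
    fix g
    show "shifted_Re ell q \<Theta> z (cscale (c * d) \<psi>) g = channel_op \<Theta> c g"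
    proof (cases "g \<in> Hplus ell q")
      case True
      have "op_form ell q (cscale (c * d) \<psi>) g = z * l2_inner ell (cscale (c * d) \<psi>) g"
        using l2_inner_lexpr_scale[OF p(1) HplusD(2)[OF True], of "c * d"] weak[OF True] by (simp add: l2_inner_cscale_left)
      moreover have "channel_op \<Theta> c g = c * k g" by (simp add: K cscale_def)
      ultimately show ?thesis unfolding T[OF mem True] bd k[OF True] by (simp add: algebra_simps)
    qed (simp add: T0 K k0 cscale_def)
  qed
  have "inv_into (Hplus ell q) (shifted_Re ell q \<Theta> z) (channel_op \<Theta> 1) = cscale d \<psi>"
    using sol[of 1] inv_into_f_f[OF inj mem, of d] by simp
  then have "impedance ell q \<Theta> z = V"
    using k[OF mem[of d]] by (simp add: impedance_def channel_adjoint_def K cscale_def[of 1] V bd)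
  moreover have "range (channel_op \<Theta>) \<subseteq> shifted_Re ell q \<Theta> z ` Hplus ell q"
    using sol mem by (metis image_eqI image_subsetI)
  ultimately show ?thesis using inj by blast
qed

theorem theorem6:
  fixes ell m0 :: real and q :: "real \<Rightarrow> real" and m :: "complex \<Rightarrow> complex"
  assumes "0 \<le> ell"
    and "locally_summable ell q"
    and "deficiency_indices ell q = (1, 1)"
    and "nonnegative_min ell q"
    and "weyl_titchmarsh ell q m"
    and "((\<lambda>x. m (complex_of_real x)) \<longlongrightarrow> complex_of_real m0) (at_left 0)"
    and "0 \<le> m0"
  shows "realizes_on ell q (schroedinger_system ell q (Fin_param 0) \<i>) (\<lambda>z. - m z) (- \<real>\<^sub>\<ge>\<^sub>0)
    \<and> accumulative ell q (schroedinger_system ell q (Fin_param 0) \<i>)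
    \<and> realizes_on ell q (schroedinger_system ell q Inf_param \<i>) (\<lambda>z. 1 / m z) (- \<real>\<^sub>\<ge>\<^sub>0)
    \<and> accretive ell q (schroedinger_system ell q Inf_param \<i>)"
proof -
  let ?\<Theta>0 = "schroedinger_system ell q (Fin_param 0) \<i>" and ?\<Theta>i = "schroedinger_system ell q Inf_param \<i>"
  have lp: "limit_point ell q"
    using assms(3,5) by (intro deficiency_index_one_imp_limit_point) auto
  have form: "0 \<le> Re (op_form ell q f f - hderiv ell f ell * cnj (f ell))" if "f \<in> Hplus ell q" for f
    by (rule neumann_form_nonneg[OF lp assms(4-7) that])
  have mz: "m z \<noteq> 0" if "z \<notin> \<real>\<^sub>\<ge>\<^sub>0" for z
    by (rule weyl_function_nonzero[OF lp assms(4-7) that])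
  have sh0: "shifted_Re ell q ?\<Theta>0 z f g = op_form ell q f g - z * l2_inner ell f g
      + 1 * f ell * cnj (hderiv ell g ell) + 0 * hderiv ell f ell * cnj (g ell)"
    if "f \<in> Hplus ell q" "g \<in> Hplus ell q" for z f g
    using Re_state_op_0[OF lp that] that by (simp add: shifted_Re_def cscale_def embed_def)
  have shi: "shifted_Re ell q ?\<Theta>i z f g = op_form ell q f g - z * l2_inner ell f g
      + 0 * f ell * cnj (hderiv ell g ell) + (-1) * hderiv ell f ell * cnj (g ell)"
    if "f \<in> Hplus ell q" "g \<in> Hplus ell q" for z f g
    using Re_state_op_Inf[OF lp that] that by (simp add: shifted_Re_def cscale_def embed_def)
  have "realizes_on ell q ?\<Theta>0 (\<lambda>z. - m z) (- \<real>\<^sub>\<ge>\<^sub>0)"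
    unfolding realizes_on_def
  proof
    fix z :: complex assume "z \<in> - \<real>\<^sub>\<ge>\<^sub>0"
    then have z: "z \<notin> \<real>\<^sub>\<ge>\<^sub>0" by simp
    show "inj_on (shifted_Re ell q ?\<Theta>0 z) (Hplus ell q) \<and>
        range (channel_op ?\<Theta>0) \<subseteq> shifted_Re ell q ?\<Theta>0 z ` Hplus ell q \<and> impedance ell q ?\<Theta>0 z = - m z"
      by (rule realizes_at[OF lp assms(5) z mz[OF z] sh0 shifted_Re_outside_Hplus, where k="delta' ell q" and d=1])
         (auto simp: schroedinger_system_def cscale_def fun_eq_iff delta'_def)
  qed
  moreover have "realizes_on ell q ?\<Theta>i (\<lambda>z. 1 / m z) (- \<real>\<^sub>\<ge>\<^sub>0)"
    unfolding realizes_on_def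
  proof
    fix z :: complex assume "z \<in> - \<real>\<^sub>\<ge>\<^sub>0"
    then have z: "z \<notin> \<real>\<^sub>\<ge>\<^sub>0" by simp
    show "inj_on (shifted_Re ell q ?\<Theta>i z) (Hplus ell q) \<and>
        range (channel_op ?\<Theta>i) \<subseteq> shifted_Re ell q ?\<Theta>i z ` Hplus ell q \<and> impedance ell q ?\<Theta>i z = 1 / m z"
      by (rule realizes_at[OF lp assms(5) z mz[OF z] shi shifted_Re_outside_Hplus, where k="delta ell q" and d="- 1 / m z"])
         (use mz[OF z] in \<open>auto simp: schroedinger_system_def cscale_def fun_eq_iff delta_def\<close>)
  qed
  moreover have "accumulative ell q ?\<Theta>0"
    unfolding accumulative_def
  proof
    fix f assume f: "f \<in> Hplus ell q"
    have "Re (l2_inner ell f (lexpr ell q f)) = Re (op_form ell q f f)"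
      using l2_inner_cnj[of ell f "lexpr ell q f"] by simp
    moreover have "Re (f ell * cnj (hderiv ell f ell)) = Re (hderiv ell f ell * cnj (f ell))" by simp
    ultimately show "Re (rigged_Re ell q (state_op ?\<Theta>0) f f)
        \<le> Re (op_form ell q f f + l2_inner ell f (lexpr ell q f))"
      using form[OF f] unfolding Re_state_op_0[OF lp f f] by (simp add: mult.commute)
  qed
  moreover have "accretive ell q ?\<Theta>i"
    unfolding accretive_def
  proof
    fix f assume f: "f \<in> Hplus ell q"
    have "Re (rigged_Re ell q (state_op ?\<Theta>i) f f) = Re (state_op ?\<Theta>i f f)"
      using f by (simp add: rigged_Re_def rigged_adjoint_def cscale_def)
    then show "0 \<le> Re (state_op ?\<Theta>i f f)"
      using form[OF f] unfolding Re_state_op_Inf[OF lp f f] by simp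
  qed
  ultimately show ?thesis by blast
qed

end
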